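(* Let $M$ be a persistence bimodule (indexed over $\mathbb{R}^2$) over a field $\mathbf{k}$ that is pointwise finite-dimensional and exact. Then $M$ decomposes as a direct sum of block modules: $$M \simeq \bigoplus_{B\in\mathcal{B}(M)} \mathbf{k}_B,$$ where $\mathcal{B}(M)$ is some multiset of blocks that depends on $M$. The decomposition is unique up to isomorphism and reordering of the terms.
   Context: Fix a field $\mathbf{k}$. Equip $\mathbb{R}^2$ with the product order: $s\le t$ iff $s_x\le t_x$ and $s_y\le t_y$. A persistence bimodule is a functor $M$ from the poset $(\mathbb{R}^2,\le)$ to $\mathbf{k}$-vector spaces, with spaces $M_t$ and linear maps $\rho_s^t:M_s\to M_t$ for $s\le t$. It is pointwise finite-dimensional (pfd) if every $M_t$ is finite-dimensional. It is exact if for all $s\le t$ in $\mathbb{R}^2$ the sequence $$M_s \xrightarrow{\ \phi=(\rho_s^{(t_x,s_y)},\,\rho_s^{(s_x,t_y)})\ } M_{(t_x,s_y)}\oplus M_{(s_x,t_y)} \xrightarrow{\ \psi=\rho_{(t_x,s_y)}^t-\rho_{(s_x,t_y)}^t\ } M_t$$ satisfies $\operatorname{Im}\phi=\operatorname{Ker}\psi$. A cut is a partition $c=(c^-,c^+)$ of $\mathbb{R}$ into two (possibly empty) sets with $x<y$ for all $x\in c^-$, $y\in c^+$. A (non-empty) rectangle is a non-empty set $R=(\ell^+\cap r^-)\times(b^+\cap\tau^-)$ with $\ell,r,b,\tau$ cuts (left, right, bottom, top). The rectangle module $\mathbf{k}_R$ has a copy of $\mathbf{k}$ at each $t\in R$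 and $0$ elsewhere, with identity maps between the copies of $\mathbf{k}$ and zero maps otherwise. A block is a rectangle of one of the following (not mutually exclusive) types: birth quadrant ($r^+=\tau^+=\emptyset$), death quadrant ($\ell^-=b^-=\emptyset$), horizontal band ($\ell^-=r^+=\emptyset$), vertical band ($b^-=\tau^+=\emptyset$). A block module is $\mathbf{k}_B$ with $B$ a block. *)

theory Defs
  imports Complex_Main "HOL-Library.Product_Order" "HOL-Library.Function_Algebras"
begin

text \<open>
  The order on \<^typ>\<open>real \<times> real\<close> is the product order of HOL-Library.

  The spaces \<open>M\<^sub>t\<close> of a bimodule are subspaces of one ambient vector space, the type \<open>'v\<close> with
  the scalar multiplication \<open>smult M\<close>. No relation between the different \<open>M\<^sub>t\<close> is implied:
  they may overlap arbitrarily, and since \<open>'v\<close> is arbitrary every family of vector spaces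
  arises in this way up to isomorphism (inside its direct sum, for instance). The transition map
  \<open>tmap M s t\<close> is relevant only for \<open>s \<le> t\<close> and on elements of \<open>fiber M s\<close>.
\<close>

record ('k, 'v) bimodule =
  smult :: "'k \<Rightarrow> 'v \<Rightarrow> 'v"
  fiber :: "real \<times> real \<Rightarrow> 'v set"
  tmap :: "real \<times> real \<Rightarrow> real \<times> real \<Rightarrow> 'v \<Rightarrow> 'v"

definition linear_between ::
  "('k \<Rightarrow> 'v \<Rightarrow> 'v) \<Rightarrow> ('k \<Rightarrow> 'w \<Rightarrow> 'w) \<Rightarrow> 'v set \<Rightarrow> 'w set
    \<Rightarrow> ('v::ab_group_add \<Rightarrow> 'w::ab_group_add) \<Rightarrow> bool" where
  "linear_between sc sc' V W f \<longleftrightarrow>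
     (\<forall>x\<in>V. f x \<in> W) \<and>
     (\<forall>x\<in>V. \<forall>y\<in>V. f (x + y) = f x + f y) \<and>
     (\<forall>c. \<forall>x\<in>V. f (sc c x) = sc' c (f x))"

definition persistence_bimodule :: "('k::field, 'v::ab_group_add) bimodule \<Rightarrow> bool" where
  "persistence_bimodule M \<longleftrightarrow>
     vector_space (smult M) \<and>
     (\<forall>t. module.subspace (smult M) (fiber M t)) \<and>
     (\<forall>s t. s \<le> t \<longrightarrow> linear_between (smult M) (smult M) (fiber M s) (fiber M t) (tmap M s t)) \<and>
     (\<forall>t. \<forall>x\<in>fiber M t. tmap M t t x = x) \<and>
     (\<forall>s t u. s \<le> t \<longrightarrow> t \<le> u \<longrightarrow>
        (\<forall>x\<in>fiber M s. tmap M t u (tmap M s t x) = tmap M s u x))"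

definition pfd :: "('k::field, 'v::ab_group_add) bimodule \<Rightarrow> bool" where
  "pfd M \<longleftrightarrow> (\<forall>t. \<exists>S. finite S \<and> S \<subseteq> fiber M t \<and> module.span (smult M) S = fiber M t)"

definition exact_bimodule :: "('k::field, 'v::ab_group_add) bimodule \<Rightarrow> bool" where
  "exact_bimodule M \<longleftrightarrow>
     (\<forall>s t. s \<le> t \<longrightarrow>
        (let u = (fst t, snd s); v = (fst s, snd t);
             \<phi> = (\<lambda>x. (tmap M s u x, tmap M s v x));
             \<psi> = (\<lambda>(a, b). tmap M u t a - tmap M v t b)
         in \<phi> ` fiber M s = {p \<in> fiber M u \<times> fiber M v. \<psi> p = 0}))"

definition bimodule_isomorphic ::
  "('k, 'v::ab_group_add) bimodule \<Rightarrow> ('k, 'w::ab_group_add) bimodule \<Rightarrow> bool"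
  (infix "\<simeq>\<^sub>b" 50) where
  "M \<simeq>\<^sub>b N \<longleftrightarrow>
     (\<exists>f. (\<forall>t. linear_between (smult M) (smult N) (fiber M t) (fiber N t) (f t) \<and>
               bij_betw (f t) (fiber M t) (fiber N t)) \<and>
          (\<forall>s t. s \<le> t \<longrightarrow>
             (\<forall>x\<in>fiber M s. f t (tmap M s t x) = tmap N s t (f s x))))"

definition direct_sum ::
  "'i set \<Rightarrow> ('i \<Rightarrow> ('k, 'v::ab_group_add) bimodule) \<Rightarrow> ('k, 'i \<Rightarrow> 'v) bimodule" where
  "direct_sum I N =
     \<lparr>smult = (\<lambda>c x i. smult (N i) c (x i)),
      fiber = (\<lambda>t. {x. finite {i. x i \<noteq> 0} \<and> (\<forall>i\<in>I. x i \<in> fiber (N i) t) \<and> (\<forall>i. i \<notin> I \<longrightarrow> x i = 0)}),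
      tmap = (\<lambda>s t x i. if i \<in> I then tmap (N i) s t (x i) else 0)\<rparr>"

text \<open>A cut is represented as the pair \<open>(c\<^sup>-, c\<^sup>+)\<close>.\<close>

definition is_cut :: "real set \<times> real set \<Rightarrow> bool" where
  "is_cut c \<longleftrightarrow> fst c \<union> snd c = UNIV \<and> fst c \<inter> snd c = {} \<and> (\<forall>x\<in>fst c. \<forall>y\<in>snd c. x < y)"

definition rectangle_of_cuts ::
  "real set \<times> real set \<Rightarrow> real set \<times> real set \<Rightarrow> real set \<times> real set \<Rightarrow> real set \<times> real set
    \<Rightarrow> (real \<times> real) set" where
  "rectangle_of_cuts l r b t = (snd l \<inter> fst r) \<times> (snd b \<inter> fst t)"

definition birth_quadrant :: "(real \<times> real) set \<Rightarrow> bool" where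
  "birth_quadrant R \<longleftrightarrow> R \<noteq> {} \<and>
     (\<exists>l r b t. is_cut l \<and> is_cut r \<and> is_cut b \<and> is_cut t \<and> R = rectangle_of_cuts l r b t \<and>
        snd r = {} \<and> snd t = {})"

definition death_quadrant :: "(real \<times> real) set \<Rightarrow> bool" where
  "death_quadrant R \<longleftrightarrow> R \<noteq> {} \<and>
     (\<exists>l r b t. is_cut l \<and> is_cut r \<and> is_cut b \<and> is_cut t \<and> R = rectangle_of_cuts l r b t \<and>
        fst l = {} \<and> fst b = {})"

definition horizontal_band :: "(real \<times> real) set \<Rightarrow> bool" where
  "horizontal_band R \<longleftrightarrow> R \<noteq> {} \<and>
     (\<exists>l r b t. is_cut l \<and> is_cut r \<and> is_cut b \<and> is_cut t \<and> R = rectangle_of_cuts l r b t \<and>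
        fst l = {} \<and> snd r = {})"

definition vertical_band :: "(real \<times> real) set \<Rightarrow> bool" where
  "vertical_band R \<longleftrightarrow> R \<noteq> {} \<and>
     (\<exists>l r b t. is_cut l \<and> is_cut r \<and> is_cut b \<and> is_cut t \<and> R = rectangle_of_cuts l r b t \<and>
        fst b = {} \<and> snd t = {})"

definition block :: "(real \<times> real) set \<Rightarrow> bool" where
  "block R \<longleftrightarrow> birth_quadrant R \<or> death_quadrant R \<or> horizontal_band R \<or> vertical_band R"

definition rectangle_module :: "(real \<times> real) set \<Rightarrow> ('k::field, 'k) bimodule" where
  "rectangle_module R =
     \<lparr>smult = (*),
      fiber = (\<lambda>t. if t \<in> R then UNIV else {0}),
      tmap = (\<lambda>s t x. if s \<in> R \<and> t \<in> R then x else 0)\<rparr>"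

text \<open>
  The multiset of blocks in a decomposition is in general infinite, even uncountable, so the finite
  multisets of HOL-Library do not apply and a multiset is given by its multiplicity function
  \<open>m\<close>. In a pointwise finite-dimensional module each (non-empty) block has finite multiplicity,
  so values in \<^typ>\<open>nat\<close> suffice. The copies of \<open>B\<close> are the pairs \<open>(B, n)\<close> with \<open>n < m B\<close>.
\<close>

definition copies :: "('a \<Rightarrow> nat) \<Rightarrow> ('a \<times> nat) set" where
  "copies m = {(B, n). n < m B}"

end

theory Submission
  imports Defs "HOL-Library.Countable"
begin

text \<open>
  A block submodule is given by a section: vectors \<open>z t \<in> V t\<close>, nonzero exactly for \<open>t\<close> in the block
  and matched by the structure maps. A section over a directed block \<open>B\<close> spans a direct summand as
  soon as \<open>z t\<close> is never in the span of the vectors born outside \<open>B\<close>. In an exact module such sections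
  come from three sources. If some nonzero element persists down to \<open>- \<infinity>\<close>, there is a death quadrant;
  if some element never dies, there is a birth quadrant; otherwise every element is a sum of one that
  dies horizontally and one that dies vertically, and either kind yields a band. In each case the block is
  cut out by a choice that is extremal among the finitely many subspaces (kernels and images) involved.
  Splitting off sections transfinitely exhausts the module, since at each point only finitely many
  steps are visible. Uniqueness holds because homomorphisms \<open>k\<^sub>B \<rightarrow> k\<^sub>D \<rightarrow> k\<^sub>B\<close> compose to zero unless
  \<open>B = D\<close>, so comparing two decompositions at a point of \<open>B\<close> gives mutually inverse matrices between the
  copies of \<open>k\<^sub>B\<close>.
\<close>

section \<open>Subspaces of a finite-dimensional space\<close>

text \<open>The value of a section must come from every earlier point of the block through vectors
  that die on leaving it, yet it must never become a combination of vectors born outside. Exactness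
  reconciles the two by one recurring move: a vector that dies in one direction can be lifted
  arbitrarily far back in the other, and the lift dies at the same level. One well-chosen vector at
  one point is then enough, since finite dimension makes images stabilise and allows lifting along a
  countable sequence although the block is uncountable. The priority of death quadrants is forced: a
  band is built around a vector that fails to come from some row or column, and nothing guarantees
  this while there are vectors persisting from everywhere below. A complement of a block submodule
  is not given by a formula, so it is chosen maximal. It is carried along with the sections because
  an arbitrary submodule need not be exact, whereas a summand is, and the next section has to be
  found in an exact module.\<close>

context vector_space
begin

lemma dim_psubset:
  assumes "finite S" "subspace U" "U \<subset> W" "W \<subseteq> span S"
  shows "dim U < dim W"
proof -
  obtain B where B: "B \<subseteq> U" "independent B" "U \<subseteq> span B" "card B = dim U"
    using basis_exists[of U] by blast
  obtain B' where B': "B' \<subseteq> W" "independent B'" "W \<subseteq> span B'" "card B' = dim W"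
    using basis_exists[of W] by blast
  have "B \<subseteq> span S" "B' \<subseteq> span S" using B(1) B'(1) assms(3,4) by auto
  then have fin: "finite B" "finite B'"
    using independent_span_bound[OF assms(1)] B(2) B'(2) by simp_all
  obtain x where x: "x \<in> W" "x \<notin> U" using assms by blast
  have "span B \<subseteq> U" using B assms(2) by (simp add: span_minimal)
  then have xB: "x \<notin> span B" using x by blast
  then have "independent (insert x B)" using B independent_insert by auto
  moreover have "insert x B \<subseteq> span B'" using B(1) B'(3) x(1) assms(3) by auto
  ultimately have "card (insert x B) \<le> card B'"
    using independent_span_bound[OF fin(2)] by blast
  moreover have "x \<notin> B" using xB span_superset by blast
  ultimately show ?thesis using fin B B' by simp
qed

text \<open>A member of least dimension is already the least member: a common lower bound of it and
  any other member cannot be strictly smaller. Stabilisation of images, kernels and complements is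
  obtained this way.\<close>

lemma directed_least:
  assumes S: "finite S" and ne: "I \<noteq> {}"
    and G: "\<And>i. i \<in> I \<Longrightarrow> subspace (G i)" "\<And>i. i \<in> I \<Longrightarrow> G i \<subseteq> span S"
    and dir: "\<And>i j. i \<in> I \<Longrightarrow> j \<in> I \<Longrightarrow> \<exists>k\<in>I. G k \<subseteq> G i \<and> G k \<subseteq> G j"
  shows "\<exists>k\<in>I. \<forall>i\<in>I. G k \<subseteq> G i"
proof -
  obtain k where k: "k \<in> I" "\<And>i. i \<in> I \<Longrightarrow> dim (G k) \<le> dim (G i)"
    using ne ex_has_least_nat[of "\<lambda>i. i \<in> I" _ "\<lambda>i. dim (G i)"] by blast
  have "G k \<subseteq> G i" if "i \<in> I" for i
  proof -
    obtain j where j: "j \<in> I" "G j \<subseteq> G k" "G j \<subseteq> G i" using dir[OF k(1) \<open>i \<in> I\<close>] by blast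
    have "\<not> G j \<subset> G k" using dim_psubset[OF S G(1)[OF j(1)] _ G(2)[OF k(1)]] k(2)[OF j(1)] by auto
    then show ?thesis using j by blast
  qed
  then show ?thesis using k by blast
qed

lemma directed_greatest:
  assumes S: "finite S" and ne: "I \<noteq> {}"
    and G: "\<And>i. i \<in> I \<Longrightarrow> subspace (G i)" "\<And>i. i \<in> I \<Longrightarrow> G i \<subseteq> span S"
    and dir: "\<And>i j. i \<in> I \<Longrightarrow> j \<in> I \<Longrightarrow> \<exists>k\<in>I. G i \<subseteq> G k \<and> G j \<subseteq> G k"
  shows "\<exists>k\<in>I. \<forall>i\<in>I. G i \<subseteq> G k"
proof -
  have bound: "dim (G i) \<le> card S" if "i \<in> I" for i
    using dim_le_card[OF G(2)[OF that] S] .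
  obtain i0 where i0: "i0 \<in> I" using ne by blast
  obtain k where k: "k \<in> I" "\<And>i. i \<in> I \<Longrightarrow> dim (G i) \<le> dim (G k)"
    using ex_has_greatest_nat[of "\<lambda>i. i \<in> I" i0 "\<lambda>i. dim (G i)" "Suc (card S)"] i0 bound by (auto simp: less_Suc_eq_le)
  have "G i \<subseteq> G k" if "i \<in> I" for i
  proof -
    obtain j where j: "j \<in> I" "G k \<subseteq> G j" "G i \<subseteq> G j" using dir[OF k(1) \<open>i \<in> I\<close>] by blast
    have "\<not> G k \<subset> G j" using dim_psubset[OF S G(1)[OF k(1)] _ G(2)[OF j(1)]] k(2)[OF j(1)] by auto
    then show ?thesis using j by blast
  qed
  then show ?thesis using k by blast
qed

text \<open>Among the nonzero intersections \<open>Z \<inter> P i\<close> finite dimension provides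
  a smallest one, and a nonzero vector of it lies in all the others. One vector thereby realises
  every membership that some nonzero vector of \<open>Z\<close> can realise; the \<open>P i\<close>
  will be kernels or images along a line.\<close>

lemma chain_common_nonzero:
  assumes S: "finite S" and Z: "subspace Z" "Z \<subseteq> span S" "z0 \<in> Z" "z0 \<noteq> 0"
    and P: "\<And>i. i \<in> T \<Longrightarrow> subspace (P i)"
    and chain: "\<And>i j. i \<in> T \<Longrightarrow> j \<in> T \<Longrightarrow> P i \<subseteq> P j \<or> P j \<subseteq> P i"
  shows "\<exists>z\<in>Z. z \<noteq> 0 \<and> (\<forall>i\<in>T. (\<exists>w\<in>Z. w \<noteq> 0 \<and> w \<in> P i) \<longrightarrow> z \<in> P i)"
proof -
  define I where "I = {i \<in> T. \<exists>w\<in>Z. w \<noteq> 0 \<and> w \<in> P i}"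
  show ?thesis
  proof (cases "I = {}")
    case True
    then show ?thesis using Z unfolding I_def by blast
  next
    case False
    have "\<exists>k\<in>I. \<forall>i\<in>I. Z \<inter> P k \<subseteq> Z \<inter> P i"
    proof (rule directed_least[OF S False])
      show "subspace (Z \<inter> P i)" if "i \<in> I" for i
        using that Z P subspace_inter unfolding I_def by blast
      show "Z \<inter> P i \<subseteq> span S" for i using Z by blast
      show "\<exists>k\<in>I. Z \<inter> P k \<subseteq> Z \<inter> P i \<and> Z \<inter> P k \<subseteq> Z \<inter> P j" if "i \<in> I" "j \<in> I" for i j
        using that chain[of i j] unfolding I_def by blast
    qed
    then obtain k where k: "k \<in> I" "\<forall>i\<in>I. Z \<inter> P k \<subseteq> Z \<inter> P i" by blast
    then obtain w where "w \<in> Z" "w \<noteq> 0" "w \<in> P k" unfolding I_def by blast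
    moreover have "w \<in> P i" if "i \<in> I" for i using k(2) that \<open>w \<in> Z\<close> \<open>w \<in> P k\<close> by blast
    ultimately show ?thesis unfolding I_def by (intro bexI[of _ w]) auto
  qed
qed

text \<open>Dual to the choice of a common nonzero vector: the largest proper \<open>W + P i\<close>
  absorbs every \<open>P i\<close> that does not generate everything modulo \<open>W\<close>. If no
  such sum is proper, \<open>W\<close> itself serves.\<close>

lemma chain_common_proper:
  assumes S: "finite S" and W: "subspace W" "W \<subset> span S"
    and P: "\<And>i. i \<in> T \<Longrightarrow> subspace (P i)" "\<And>i. i \<in> T \<Longrightarrow> P i \<subseteq> span S"
    and chain: "\<And>i j. i \<in> T \<Longrightarrow> j \<in> T \<Longrightarrow> P i \<subseteq> P j \<or> P j \<subseteq> P i"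
  shows "\<exists>W'. subspace W' \<and> W' \<subset> span S \<and> W \<subseteq> W' \<and>
    (\<forall>i\<in>T. {w + p | w p. w \<in> W \<and> p \<in> P i} = span S \<or> P i \<subseteq> W')"
proof -
  define Q where "Q i = {w + p | w p. w \<in> W \<and> p \<in> P i}" for i
  define I where "I = {i \<in> T. Q i \<noteq> span S}"
  have sub: "subspace (Q i)" if "i \<in> T" for i
    using subspace_sums[OF W(1) P(1)[OF that]] by (simp add: Q_def)
  have le: "Q i \<subseteq> span S" if "i \<in> T" for i
    using W P(2)[OF that] by (auto simp: Q_def intro!: span_add)
  have PQ: "P i \<subseteq> Q i" for i
    using subspace_0[OF W(1)] unfolding Q_def by force
  have WQ: "W \<subseteq> Q i" if "i \<in> T" for i
    using subspace_0[OF P(1)[OF that]] unfolding Q_def by force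
  have mono: "P i \<subseteq> P j \<Longrightarrow> Q i \<subseteq> Q j" for i j unfolding Q_def by blast
  show ?thesis
  proof (cases "I = {}")
    case True
    then have "\<forall>i\<in>T. Q i = span S" unfolding I_def by auto
    then show ?thesis using W unfolding Q_def by (intro exI[of _ W]) simp
  next
    case False
    have "\<exists>k\<in>I. \<forall>i\<in>I. Q i \<subseteq> Q k"
    proof (rule directed_greatest[OF S False])
      show "\<exists>k\<in>I. Q i \<subseteq> Q k \<and> Q j \<subseteq> Q k" if "i \<in> I" "j \<in> I" for i j
      proof -
        have "P i \<subseteq> P j \<or> P j \<subseteq> P i" using that chain by (simp add: I_def)
        then show ?thesis using that mono[of i j] mono[of j i] by auto
      qed
    qed (use sub le I_def in auto)
    then obtain k where k: "k \<in> I" "\<forall>i\<in>I. Q i \<subseteq> Q k" by blast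
    then have kT: "k \<in> T" "Q k \<noteq> span S" by (simp_all add: I_def)
    have "Q i = span S \<or> P i \<subseteq> Q k" if "i \<in> T" for i
    proof (cases "Q i = span S")
      case False
      then have "Q i \<subseteq> Q k" using k(2) that by (simp add: I_def)
      then show ?thesis using PQ[of i] by (meson subset_trans)
    qed simp
    then show ?thesis using sub[OF kT(1)] le[OF kT(1)] WQ[OF kT(1)] kT(2)
      unfolding Q_def by (intro exI[of _ "Q k", unfolded Q_def]) auto
  qed
qed

text \<open>The added \<open>{0}\<close> covers the empty chain, which occurs when a block is
  unbounded towards one side.\<close>

lemma subspace_chain_Union:
  assumes "\<And>i. i \<in> T \<Longrightarrow> subspace (P i)"
    and chain: "\<And>i j. i \<in> T \<Longrightarrow> j \<in> T \<Longrightarrow> P i \<subseteq> P j \<or> P j \<subseteq> P i"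
  shows "subspace ({0} \<union> (\<Union>i\<in>T. P i))"
proof (rule subspaceI)
  fix x y assume x: "x \<in> {0} \<union> (\<Union>i\<in>T. P i)" and y: "y \<in> {0} \<union> (\<Union>i\<in>T. P i)"
  show "x + y \<in> {0} \<union> (\<Union>i\<in>T. P i)"
  proof (cases "x = 0 \<or> y = 0")
    case True then show ?thesis using x y by auto
  next
    case False
    then obtain i j where ij: "i \<in> T" "x \<in> P i" "j \<in> T" "y \<in> P j" using x y by auto
    then obtain k where k: "k \<in> T" "x \<in> P k" "y \<in> P k" using chain[of i j] by auto
    then show ?thesis using subspace_add[OF assms(1)[OF k(1)] k(2,3)] by auto
  qed
next
  fix c x assume "x \<in> {0} \<union> (\<Union>i\<in>T. P i)"
  then consider "x = 0" | i where "i \<in> T" "x \<in> P i" by auto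
  then show "c *s x \<in> {0} \<union> (\<Union>i\<in>T. P i)"
  proof cases
    case 2
    then show ?thesis using subspace_scale[OF assms(1)[OF 2(1)] 2(2), of c] by auto
  qed simp
qed auto

text \<open>Applying \<open>\<phi> i\<close> to a vanishing combination isolates the coefficient of
  \<open>v i\<close>. Linearity is asked for on \<open>U\<close> only, because a form on a fibre is
  unconstrained elsewhere; injectivity is separate because independence is a property of the set of
  values.\<close>

lemma independent_of_dual_family:
  assumes "\<And>i. i \<in> I \<Longrightarrow> v i \<in> U" "subspace U"
    and add: "\<And>i x y. i \<in> I \<Longrightarrow> x \<in> U \<Longrightarrow> y \<in> U \<Longrightarrow> \<phi> i (x + y) = \<phi> i x + \<phi> i y"
    and scale: "\<And>i c x. i \<in> I \<Longrightarrow> x \<in> U \<Longrightarrow> \<phi> i (c *s x) = c * \<phi> i x"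
    and dual: "\<And>i j. i \<in> I \<Longrightarrow> j \<in> I \<Longrightarrow> \<phi> i (v j) = (if i = j then 1 else 0)"
  shows "inj_on v I" and "independent (v ` I)"
proof -
  show inj: "inj_on v I"
    proof (rule inj_onI)
    fix i j assume "i \<in> I" "j \<in> I" "v i = v j"
    then have "\<phi> i (v i) = \<phi> i (v j)" by simp
    then show "i = j" using dual[of i i] dual[of i j] \<open>i \<in> I\<close> \<open>j \<in> I\<close> by (auto split: if_splits)
  qed
  have zero: "\<phi> i 0 = 0" if "i \<in> I" for i
    using scale[OF that, of 0 0] subspace_0[OF assms(2)] by simp
  show "independent (v ` I)"
    unfolding independent_explicit_module
  proof (intro allI impI)
    fix T u w assume T: "finite T" "T \<subseteq> v ` I" and 0: "(\<Sum>x\<in>T. u x *s x) = 0" and w: "w \<in> T"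
    obtain i where i: "i \<in> I" "w = v i" using T w by blast
    have TU: "T \<subseteq> U" using T assms(1) by blast
    have "\<phi> i (\<Sum>x\<in>T'. u x *s x) = (\<Sum>x\<in>T'. u x * \<phi> i x)" if "finite T'" "T' \<subseteq> U" for T'
      using that
    proof (induction T' rule: finite_induct)
      case empty then show ?case using zero i by simp
    next
      case (insert x T')
      then have "(\<Sum>x\<in>T'. u x *s x) \<in> U"
        by (intro subspace_sum[OF assms(2)] subspace_scale[OF assms(2)]) auto
      then show ?case
        using insert add scale i subspace_scale[OF assms(2)] by simp
    qed
    from this[OF T(1) TU] have "(\<Sum>x\<in>T. u x * \<phi> i x) = 0" using 0 zero i by simp
    moreover have "(\<Sum>x\<in>T. u x * \<phi> i x) = (\<Sum>x\<in>T. if x = w then u x else 0)"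
    proof (rule sum.cong)
      fix x assume "x \<in> T"
      then obtain j where j: "j \<in> I" "x = v j" using T by blast
      have "x = w \<longleftrightarrow> j = i" using i j inj_on_eq_iff[OF inj] by simp
      then show "u x * \<phi> i x = (if x = w then u x else 0)" using dual[of i j] i j by auto
    qed simp
    ultimately show "u w = 0" using T w by simp
  qed
qed

end

section \<open>Persistence modules and complements of block submodules\<close>

declare split_paired_All [simp del] split_paired_Ex [simp del]

locale persistence_module = vector_space sc
  for sc :: "'k::field \<Rightarrow> 'v::ab_group_add \<Rightarrow> 'v" (infixr "*s" 75) +
  fixes V :: "real \<times> real \<Rightarrow> 'v set"
    and \<rho> :: "real \<times> real \<Rightarrow> real \<times> real \<Rightarrow> 'v \<Rightarrow> 'v"
  assumes subspace_V: "subspace (V t)"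
    and map_in: "s \<le> t \<Longrightarrow> x \<in> V s \<Longrightarrow> \<rho> s t x \<in> V t"
    and map_add: "s \<le> t \<Longrightarrow> x \<in> V s \<Longrightarrow> y \<in> V s \<Longrightarrow> \<rho> s t (x + y) = \<rho> s t x + \<rho> s t y"
    and map_scale: "s \<le> t \<Longrightarrow> x \<in> V s \<Longrightarrow> \<rho> s t (c *s x) = c *s \<rho> s t x"
    and map_refl: "x \<in> V t \<Longrightarrow> \<rho> t t x = x"
    and map_comp: "s \<le> t \<Longrightarrow> t \<le> u \<Longrightarrow> x \<in> V s \<Longrightarrow> \<rho> t u (\<rho> s t x) = \<rho> s u x"
begin

lemma zero_in: "0 \<in> V t"
  and add_in: "x \<in> V t \<Longrightarrow> y \<in> V t \<Longrightarrow> x + y \<in> V t"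
  and diff_in: "x \<in> V t \<Longrightarrow> y \<in> V t \<Longrightarrow> x - y \<in> V t"
  and scale_in: "x \<in> V t \<Longrightarrow> c *s x \<in> V t"
  using subspace_0 subspace_add subspace_diff subspace_scale subspace_V by auto

lemma map_zero: "s \<le> t \<Longrightarrow> \<rho> s t 0 = 0"
  using map_scale[of s t 0 0] zero_in by simp

lemma map_diff:
  assumes "s \<le> t" "x \<in> V s" "y \<in> V s"
  shows "\<rho> s t (x - y) = \<rho> s t x - \<rho> s t y"
proof -
  have "\<rho> s t (x + (-1) *s y) = \<rho> s t x + (-1) *s \<rho> s t y"
    using assms scale_in by (simp only: map_add map_scale)
  then show ?thesis by simp
qed

lemma subspace_image_map:
  assumes "s \<le> t" "subspace U" "U \<subseteq> V s"
  shows "subspace (\<rho> s t ` U)"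
proof (rule subspaceI)
  show "0 \<in> \<rho> s t ` U"
    using map_zero[OF assms(1)] subspace_0[OF assms(2)] by (metis imageI)
next
  fix x y assume "x \<in> \<rho> s t ` U" "y \<in> \<rho> s t ` U"
  then obtain a b where ab: "a \<in> U" "b \<in> U" "x = \<rho> s t a" "y = \<rho> s t b" by auto
  then have "x + y = \<rho> s t (a + b)" using map_add[OF assms(1)] subsetD[OF assms(3)] by metis
  then show "x + y \<in> \<rho> s t ` U" using ab subspace_add[OF assms(2)] by auto
next
  fix c x assume "x \<in> \<rho> s t ` U"
  then obtain a where a: "a \<in> U" "x = \<rho> s t a" by auto
  then have "c *s x = \<rho> s t (c *s a)" using assms map_scale[OF assms(1)] by auto
  then show "c *s x \<in> \<rho> s t ` U" using a subspace_scale[OF assms(2)] by auto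
qed

lemma subspace_kernel_map:
  assumes "s \<le> t"
  shows "subspace {x \<in> V s. \<rho> s t x = 0}"
  using assms map_zero map_add map_scale zero_in add_in scale_in by (intro subspaceI) auto

lemma image_map_mono:
  assumes "u \<le> s" "s \<le> t"
  shows "\<rho> u t ` V u \<subseteq> \<rho> s t ` V s"
proof
  fix x assume "x \<in> \<rho> u t ` V u"
  then obtain a where a: "a \<in> V u" "x = \<rho> u t a" by auto
  then have "x = \<rho> s t (\<rho> u s a)" using map_comp assms by simp
  then show "x \<in> \<rho> s t ` V s" using a map_in assms by blast
qed

lemma kernel_map_mono:
  assumes "s \<le> t" "t \<le> u"
  shows "{x \<in> V s. \<rho> s t x = 0} \<subseteq> {x \<in> V s. \<rho> s u x = 0}"
  using map_comp[OF assms] map_zero[OF assms(2)] by force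

section \<open>Sections, and what dies or is born outside a set\<close>

definition dying_outside :: "(real \<times> real) set \<Rightarrow> real \<times> real \<Rightarrow> 'v set" where
  "dying_outside B t = {x \<in> V t. \<forall>u. t \<le> u \<longrightarrow> u \<notin> B \<longrightarrow> \<rho> t u x = 0}"

text \<open>The obstruction to splitting off a block module: a retraction onto it vanishes at points
  outside \<open>B\<close>, hence on everything that comes from there. A span is taken because the
  images from different points outside \<open>B\<close> need not be nested.\<close>

definition born_outside :: "(real \<times> real) set \<Rightarrow> real \<times> real \<Rightarrow> 'v set" where
  "born_outside B t = span {\<rho> u t x | u x. u \<le> t \<and> u \<notin> B \<and> x \<in> V u}"

definition submodule :: "(real \<times> real \<Rightarrow> 'v set) \<Rightarrow> bool" where
  "submodule N \<longleftrightarrow> (\<forall>t. subspace (N t) \<and> N t \<subseteq> V t) \<and> (\<forall>s t. s \<le> t \<longrightarrow> (\<forall>x\<in>N s. \<rho> s t x \<in> N t))"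

text \<open>An embedding of the block module, recorded by the images of the generators 1. With value
  0 off \<open>B\<close>, the transition rule also says that the section dies on leaving
  \<open>B\<close>.\<close>

definition block_section :: "(real \<times> real) set \<Rightarrow> (real \<times> real \<Rightarrow> 'v) \<Rightarrow> bool" where
  "block_section B z \<longleftrightarrow> (\<forall>t. z t \<in> V t) \<and> (\<forall>t. z t \<noteq> 0 \<longleftrightarrow> t \<in> B) \<and>
    (\<forall>s t. s \<le> t \<longrightarrow> s \<in> B \<longrightarrow> \<rho> s t (z s) = z t)"

lemma subspace_dying_outside: "subspace (dying_outside B t)"
  unfolding dying_outside_def
  using map_zero map_add map_scale zero_in add_in scale_in by (intro subspaceI) auto

lemma dying_outside_subset: "dying_outside B t \<subseteq> V t"
  unfolding dying_outside_def by auto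

lemma map_dying_outside:
  assumes "s \<le> t" "x \<in> dying_outside B s"
  shows "\<rho> s t x \<in> dying_outside B t"
  using assms map_in map_comp unfolding dying_outside_def by (auto intro: order_trans)

lemma subspace_born_outside: "subspace (born_outside B t)"
  unfolding born_outside_def by simp

lemma born_outside_subset: "born_outside B t \<subseteq> V t"
  unfolding born_outside_def
proof (intro span_minimal subsetI)
  fix y assume "y \<in> {\<rho> u t x | u x. u \<le> t \<and> u \<notin> B \<and> x \<in> V u}"
  then obtain u x where "y = \<rho> u t x" "u \<le> t" "x \<in> V u" by blast
  then show "y \<in> V t" using map_in by simp
qed (rule subspace_V)

lemma map_born_outside:
  assumes "s \<le> t" "x \<in> born_outside B s"
  shows "\<rho> s t x \<in> born_outside B t"
proof -
  let ?U = "{x \<in> V s. \<rho> s t x \<in> born_outside B t}"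
  have "subspace ?U"
    using map_zero map_add map_scale zero_in add_in scale_in assms(1) subspace_born_outside[of B t]
    by (intro subspaceI) (auto simp: subspace_0 subspace_add subspace_scale)
  moreover have "{\<rho> u s x | u x. u \<le> s \<and> u \<notin> B \<and> x \<in> V u} \<subseteq> ?U"
  proof safe
    fix u x assume u: "u \<le> s" "u \<notin> B" "x \<in> V u"
    then show "\<rho> u s x \<in> V s" using map_in by simp
    have "\<rho> s t (\<rho> u s x) = \<rho> u t x" using u assms(1) map_comp by simp
    moreover have "u \<le> t" using u assms(1) by (meson order_trans)
    ultimately show "\<rho> s t (\<rho> u s x) \<in> born_outside B t"
      using u unfolding born_outside_def by (intro span_base) blast
  qed
  ultimately have "born_outside B s \<subseteq> ?U" unfolding born_outside_def[of B s] by (intro span_minimal)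
  then show ?thesis using assms(2) by auto
qed

lemma born_outside_eq: "t \<notin> B \<Longrightarrow> born_outside B t = V t"
proof
  assume t: "t \<notin> B"
  show "V t \<subseteq> born_outside B t"
  proof
    fix x assume "x \<in> V t"
    then have "x = \<rho> t t x" by (simp add: map_refl)
    then show "x \<in> born_outside B t"
      using t \<open>x \<in> V t\<close> unfolding born_outside_def by (intro span_base) blast
  qed
qed (rule born_outside_subset)

lemma submodule_born_outside: "submodule (born_outside B)"
  unfolding submodule_def
  using subspace_born_outside born_outside_subset map_born_outside by auto

section \<open>Submodules and complements\<close>

lemma submoduleD:
  assumes "submodule N"
  shows "subspace (N t)" "x \<in> N t \<Longrightarrow> x \<in> V t" "s \<le> t \<Longrightarrow> x \<in> N s \<Longrightarrow> \<rho> s t x \<in> N t"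
  using assms unfolding submodule_def by auto

text \<open>Only points above \<open>t\<close> see \<open>m\<close>, so the submodule generated by
  \<open>N\<close> and \<open>m\<close> grows by at most a line at each of them. It is the test
  object for maximality of a complement.\<close>

lemma submodule_extend:
  assumes N: "submodule N" and m: "m \<in> V t"
  shows "submodule (\<lambda>u. if t \<le> u then {c *s \<rho> t u m + n | c n. n \<in> N u} else N u)" (is "submodule ?N'")
    and "\<forall>u. N u \<subseteq> (if t \<le> u then {c *s \<rho> t u m + n | c n. n \<in> N u} else N u)"
    and "m \<in> (if t \<le> t then {c *s \<rho> t t m + n | c n. n \<in> N t} else N t)"
proof -
  show "\<forall>u. N u \<subseteq> ?N' u"
  proof (intro allI subsetI)
    fix u x assume x: "x \<in> N u"
    then show "x \<in> ?N' u" by (auto intro!: exI[of _ 0] exI[of _ x])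
  qed
  have "m = 1 *s \<rho> t t m + 0" using m map_refl by simp
  moreover have "0 \<in> N t" using subspace_0[OF submoduleD(1)[OF N]] .
  ultimately show "m \<in> ?N' t" by (simp only: order_refl if_True) blast
  have line: "{c *s \<rho> t u m + n | c n. n \<in> N u} = {x + y | x y. x \<in> span {\<rho> t u m} \<and> y \<in> N u}" for u
    unfolding span_singleton by auto
  show "submodule ?N'" unfolding submodule_def
  proof (intro conjI allI impI ballI)
    show "subspace (?N' u)" for u
      unfolding line using subspace_sums[OF subspace_span submoduleD(1)[OF N]] submoduleD(1)[OF N] by simp
    show "?N' u \<subseteq> V u" for u
      by (auto intro!: add_in scale_in map_in m dest: submoduleD(2)[OF N])
    fix u w x assume uw: "u \<le> w" and x: "x \<in> ?N' u"
    show "\<rho> u w x \<in> ?N' w"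
    proof (cases "t \<le> u")
      case True
      then obtain c n where cn: "n \<in> N u" "x = c *s \<rho> t u m + n" using x by auto
      have "t \<le> w" using True uw by (meson order_trans)
      have "\<rho> u w x = c *s \<rho> t w m + \<rho> u w n"
        using True cn uw m submoduleD(2)[OF N cn(1)]
        by (simp add: map_add map_scale map_comp map_in scale_in)
      then show ?thesis using \<open>t \<le> w\<close> submoduleD(3)[OF N uw cn(1)] by auto
    next
      case False
      then have "x \<in> N u" using x by simp
      then have "\<rho> u w x \<in> N w" using submoduleD(3)[OF N uw] by simp
      then show ?thesis using \<open>\<forall>u. N u \<subseteq> ?N' u\<close> by blast
    qed
  qed
qed

lemma submodule_chain_Union:
  assumes ne: "\<C> \<noteq> {}" and sub: "\<And>N. N \<in> \<C> \<Longrightarrow> submodule N"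
    and chain: "\<And>N N'. N \<in> \<C> \<Longrightarrow> N' \<in> \<C> \<Longrightarrow> N \<le> N' \<or> N' \<le> N"
  shows "submodule (\<lambda>t. \<Union>N\<in>\<C>. N t)"
  unfolding submodule_def
proof (intro conjI allI impI ballI)
  fix t
  have "subspace ({0} \<union> (\<Union>N\<in>\<C>. N t))"
  proof (intro subspace_chain_Union)
    show "N t \<subseteq> N' t \<or> N' t \<subseteq> N t" if "N \<in> \<C>" "N' \<in> \<C>" for N N'
      using chain[OF that] by (auto simp: le_fun_def)
  qed (use sub submoduleD(1) in auto)
  moreover have "0 \<in> (\<Union>N\<in>\<C>. N t)" using ne sub submoduleD(1) subspace_0 by fastforce
  ultimately show "subspace (\<Union>N\<in>\<C>. N t)" by (simp add: insert_absorb)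
  show "(\<Union>N\<in>\<C>. N t) \<subseteq> V t" using sub by (simp add: UN_least submodule_def)
next
  fix s t :: "real \<times> real" and x assume "s \<le> t" "x \<in> (\<Union>N\<in>\<C>. N s)"
  then show "\<rho> s t x \<in> (\<Union>N\<in>\<C>. N t)" by (auto intro: submoduleD(3)[OF sub])
qed

text \<open>The complement of a block submodule is a submodule that is maximal among those avoiding the
  section. Maximality alone makes it a hyperplane at every point of the block: if neither \<open>m\<close> nor
  \<open>c *s m - z t\<close> could be adjoined, a combination of the two failures would put the section into
  the submodule at a common later point.\<close>

lemma block_section_complement:
  assumes z: "block_section B z"
    and dir: "\<And>s t. s \<in> B \<Longrightarrow> t \<in> B \<Longrightarrow> sup s t \<in> B"
    and avoid: "\<And>t. t \<in> B \<Longrightarrow> z t \<notin> born_outside B t"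
  shows "\<exists>N. submodule N \<and> (\<forall>t\<in>B. z t \<notin> N t) \<and> (\<forall>t. \<forall>m\<in>V t. \<exists>c. m - c *s z t \<in> N t)"
proof -
  define \<A> where "\<A> = {N. submodule N \<and> (\<forall>t. born_outside B t \<subseteq> N t) \<and> (\<forall>t\<in>B. z t \<notin> N t)}"
  have "\<exists>N\<in>\<A>. \<forall>N'\<in>\<A>. N \<le> N' \<longrightarrow> N' = N"
  proof (rule predicate_Zorn)
    show "partial_order_on \<A> (relation_of (\<le>) \<A>)"
      by (rule partial_order_on_relation_ofI) auto
    fix \<C> assume "\<C> \<in> Chains (relation_of (\<le>) \<A>)"
    then have \<C>: "\<C> \<subseteq> \<A>" "\<And>N N'. N \<in> \<C> \<Longrightarrow> N' \<in> \<C> \<Longrightarrow> N \<le> N' \<or> N' \<le> N"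
      unfolding Chains_def relation_of_def by auto
    show "\<exists>u\<in>\<A>. \<forall>N\<in>\<C>. N \<le> u"
    proof (cases "\<C> = {}")
      case True
      have "born_outside B \<in> \<A>" using avoid submodule_born_outside by (simp add: \<A>_def)
      then show ?thesis using True by blast
    next
      case False
      have "submodule (\<lambda>t. \<Union>N\<in>\<C>. N t)"
        using \<C> False by (intro submodule_chain_Union) (auto simp: \<A>_def)
      moreover have "born_outside B t \<subseteq> (\<Union>N\<in>\<C>. N t)" for t
        using False \<C>(1) unfolding \<A>_def by blast
      moreover have "z t \<notin> (\<Union>N\<in>\<C>. N t)" if "t \<in> B" for t
        using that \<C>(1) unfolding \<A>_def by blast
      ultimately have "(\<lambda>t. \<Union>N\<in>\<C>. N t) \<in> \<A>" unfolding \<A>_def by auto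
      then show ?thesis by (intro bexI[of _ "\<lambda>t. \<Union>N\<in>\<C>. N t"]) (auto simp: le_fun_def)
    qed
  qed
  then obtain N where "N \<in> \<A>" and max: "\<And>N'. N' \<in> \<A> \<Longrightarrow> N \<le> N' \<Longrightarrow> N' = N" by auto
  then have N: "submodule N" "\<And>t. born_outside B t \<subseteq> N t" "\<And>t. t \<in> B \<Longrightarrow> z t \<notin> N t"
    unfolding \<A>_def by auto
  have zV: "z t \<in> V t" for t using z by (simp add: block_section_def)
  have zmap: "\<rho> s t (z s) = z t" if "s \<le> t" "s \<in> B" for s t using z that by (simp add: block_section_def)
  \<comment> \<open>Adjoining \<open>m\<close> enlarges a maximal submodule, so it must capture the
    section at some later point \<open>u\<close> of the block; solving for the captured
    \<open>z u\<close> gives this form.\<close>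
  have key: "\<exists>u\<ge>t. u \<in> B \<and> (\<exists>c. c *s \<rho> t u m - z u \<in> N u)" if m: "m \<in> V t" "m \<notin> N t" for t m
  proof (rule ccontr)
    assume neg: "\<not> ?thesis"
    define N' where "N' = (\<lambda>u. if t \<le> u then {c *s \<rho> t u m + n | c n. n \<in> N u} else N u)"
    have N': "submodule N'" "\<And>u. N u \<subseteq> N' u" "m \<in> N' t"
      using submodule_extend[OF N(1) m(1)] unfolding N'_def by blast+
    have "z u \<notin> N' u" if u: "u \<in> B" for u
    proof
      assume zu: "z u \<in> N' u"
      then have tu: "t \<le> u" using N(3)[OF u] by (auto simp: N'_def split: if_splits)
      then obtain c n where n: "n \<in> N u" "z u = c *s \<rho> t u m + n" using zu by (auto simp: N'_def)
      then have "c *s \<rho> t u m - z u = 0 - n" by simp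
      moreover have "0 - n \<in> N u" using n submoduleD(1)[OF N(1)] subspace_0 subspace_diff by blast
      ultimately have "c *s \<rho> t u m - z u \<in> N u" by (simp only:)
      then show False using neg tu u by blast
    qed
    moreover have "born_outside B u \<subseteq> N' u" for u using N(2) N'(2) by blast
    ultimately have "N' \<in> \<A>" unfolding \<A>_def using N'(1) by simp
    then have "N' = N" using N'(2) by (intro max) (auto simp: le_fun_def)
    then show False using N'(3) m(2) by simp
  qed
  have "\<exists>c. m - c *s z t \<in> N t" if m: "m \<in> V t" for t m
  proof (cases "m \<in> N t")
    case True
    then show ?thesis by (intro exI[of _ 0]) simp
  next
    case False
    then have tB: "t \<in> B" using N(2)[of t] born_outside_eq[of t B] m by auto
    obtain u c where u: "t \<le> u" "u \<in> B" "c *s \<rho> t u m - z u \<in> N u" using key[OF m False] by auto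
    \<comment> \<open>This vector has entered \<open>N\<close> at \<open>u\<close>, so adjoining it
      at \<open>t\<close> changes nothing above \<open>u\<close>. A capture of the section at
      \<open>w\<close> would therefore put the section into \<open>N\<close> itself at the join of
      \<open>u\<close> and \<open>w\<close>.\<close>
    define m' where "m' = c *s m - z t"
    have m': "m' \<in> V t" "\<rho> t u m' \<in> N u"
      using u m zV zmap tB by (simp_all add: m'_def diff_in scale_in map_diff map_scale)
    have "m' \<in> N t"
    proof (rule ccontr)
      assume "m' \<notin> N t"
      then obtain w d where w: "t \<le> w" "w \<in> B" "d *s \<rho> t w m' - z w \<in> N w" using key[OF m'(1)] by auto
      let ?v = "sup u w"
      have le: "u \<le> ?v" "w \<le> ?v" by simp_all
      have tv: "t \<le> ?v" using le u by (meson order_trans)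
      have "\<rho> w ?v (d *s \<rho> t w m' - z w) = d *s \<rho> t ?v m' - z ?v"
        using le w m' zV zmap by (simp add: map_diff map_scale map_comp scale_in map_in)
      then have h1: "d *s \<rho> t ?v m' - z ?v \<in> N ?v" using submoduleD(3)[OF N(1) le(2) w(3)] by simp
      have h2: "d *s \<rho> t ?v m' \<in> N ?v"
        using submoduleD(3)[OF N(1) le(1) m'(2)] map_comp[OF u(1) le(1) m'(1)]
          subspace_scale[OF submoduleD(1)[OF N(1)]] by simp
      have "z ?v \<in> N ?v"
        using subspace_diff[OF submoduleD(1)[OF N(1)] h2 h1] by (simp only: diff_diff_eq2 add_diff_cancel_left')
      then show False using N(3) dir[OF u(2) w(2)] by simp
    qed
    moreover have "c \<noteq> 0"
    proof
      assume "c = 0"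
      then have "0 - m' \<in> N t" using \<open>m' \<in> N t\<close> submoduleD(1)[OF N(1)] subspace_0 subspace_diff by blast
      then show False using N(3)[OF tB] \<open>c = 0\<close> by (simp add: m'_def)
    qed
    moreover have "inverse c *s m' = m - inverse c *s z t"
      using \<open>c \<noteq> 0\<close> by (simp add: m'_def scale_right_diff_distrib)
    ultimately show ?thesis using subspace_scale[OF submoduleD(1)[OF N(1)]] by metis
  qed
  then show ?thesis using N by auto
qed

end

section \<open>Lifting an element to a section\<close>

text \<open>The rationals give every nonempty set of reals countable coinitiality, which is what
  allows a section over an uncountable block to be built by a sequence of choices. Running minima
  make the sequence decrease from the prescribed start.\<close>

lemma coinitial_sequence:
  fixes X :: "real set"
  assumes x0: "x0 \<in> X"
  shows "\<exists>p. p 0 = x0 \<and> (\<forall>n. p n \<in> X) \<and> (\<forall>n. p (Suc n) \<le> p n) \<and> (\<forall>x\<in>X. \<exists>n. p n \<le> x)"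
proof -
  have "\<exists>e :: nat \<Rightarrow> real. (\<forall>n. e n \<in> X) \<and> (\<forall>x\<in>X. \<exists>n. e n \<le> x)"
  proof (cases "\<exists>m\<in>X. \<forall>x\<in>X. m \<le> x")
    case True
    then obtain m where "m \<in> X" "\<forall>x\<in>X. m \<le> x" by auto
    then show ?thesis by (intro exI[of _ "\<lambda>_. m"]) auto
  next
    case False
    \<comment> \<open>For each rational bound, a member of \<open>X\<close> below it if there is
      one. Without a least element every \<open>x\<close> in \<open>X\<close> has a rational between
      it and a smaller member, so these choices get below \<open>x\<close>; the default
      \<open>x0\<close> only keeps the sequence inside \<open>X\<close>.\<close>
    define e where "e n = (if \<exists>x\<in>X. x < real_of_rat (from_nat n) then SOME x. x \<in> X \<and> x < real_of_rat (from_nat n) else x0)"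
      for n
    have e: "e n \<in> X \<and> e n < real_of_rat (from_nat n)" if "\<exists>x\<in>X. x < real_of_rat (from_nat n)" for n
    proof -
      have "\<exists>x. x \<in> X \<and> x < real_of_rat (from_nat n)" using that by auto
      from someI_ex[OF this] show ?thesis using that by (simp add: e_def)
    qed
    have "e n \<in> X" for n using e[of n] x0 by (cases "\<exists>x\<in>X. x < real_of_rat (from_nat n)") (auto simp: e_def)
    moreover have "\<exists>n. e n \<le> x" if "x \<in> X" for x
    proof -
      have "\<exists>y\<in>X. y < x" using False that by (auto simp: not_le)
      then obtain y where y: "y \<in> X" "y < x" ..
      obtain q where q: "y < real_of_rat q" "real_of_rat q < x" using of_rat_dense[OF y(2)] by auto
      have "\<exists>x\<in>X. x < real_of_rat (from_nat (to_nat q))" using y q by auto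
      then have "e (to_nat q) < real_of_rat q" using e[of "to_nat q"] by simp
      then show ?thesis using q by (intro exI[of _ "to_nat q"]) simp
    qed
    ultimately show ?thesis by blast
  qed
  then obtain e :: "nat \<Rightarrow> real" where e: "\<And>n. e n \<in> X" "\<And>x. x \<in> X \<Longrightarrow> \<exists>n. e n \<le> x" by metis
  define p where "p = rec_nat x0 (\<lambda>n r. min r (e n))"
  have p: "p 0 = x0" "p (Suc n) = min (p n) (e n)" for n by (simp_all add: p_def)
  have "p n \<in> X" for n by (induction n) (auto simp: p x0 e min_def)
  moreover have "\<exists>n. p n \<le> x" if x: "x \<in> X" for x
  proof -
    obtain n where "e n \<le> x" using e(2)[OF x] by auto
    then have "p (Suc n) \<le> x" by (simp add: p min_le_iff_disj)
    then show ?thesis by blast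
  qed
  ultimately show ?thesis using p by (intro exI[of _ p]) auto
qed

lemma coinitial_sequence_Times:
  assumes B: "B = X \<times> Y" and s: "s \<in> B"
  shows "\<exists>p :: nat \<Rightarrow> real \<times> real. p 0 = s \<and> (\<forall>n. p n \<in> B) \<and> (\<forall>n. p (Suc n) \<le> p n) \<and> (\<forall>t\<in>B. \<exists>n. p n \<le> t)"
proof -
  have "fst s \<in> X" "snd s \<in> Y" using s B by auto
  then obtain p q where p: "p 0 = fst s" "\<And>n. p n \<in> X" "\<And>n. p (Suc n) \<le> p n" "\<And>x. x \<in> X \<Longrightarrow> \<exists>n. p n \<le> x"
    and q: "q 0 = snd s" "\<And>n. q n \<in> Y" "\<And>n. q (Suc n) \<le> q n" "\<And>x. x \<in> Y \<Longrightarrow> \<exists>n. q n \<le> x"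
    using coinitial_sequence[of "fst s" X] coinitial_sequence[of "snd s" Y] by metis
  have dec: "p (m + k) \<le> p m" "q (m + k) \<le> q m" for m k
    by (induction k) (auto intro: order_trans p(3) q(3))
  have "\<exists>n. (p n, q n) \<le> t" if t: "t \<in> B" for t
  proof -
    have "fst t \<in> X" "snd t \<in> Y" using t B by auto
    then obtain m n where "p m \<le> fst t" "q n \<le> snd t" using p(4)[of "fst t"] q(4)[of "snd t"] by auto
    then have "p (m + n) \<le> fst t" "q (n + m) \<le> snd t"
      using dec(1)[of m n] dec(2)[of n m] by linarith+
    then show ?thesis by (intro exI[of _ "m + n"]) (auto simp: add.commute less_eq_prod_def)
  qed
  then show ?thesis using p q B by (intro exI[of _ "\<lambda>n. (p n, q n)"]) auto
qed

section \<open>Stable images and lifting to a section\<close>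

locale pfd_module = persistence_module +
  assumes finite_dim: "\<exists>S. finite S \<and> V t = span S"
begin

lemma least_subspace:
  assumes "I \<noteq> {}" "\<And>i. i \<in> I \<Longrightarrow> subspace (G i)" "\<And>i. i \<in> I \<Longrightarrow> G i \<subseteq> V t"
    "\<And>i j. i \<in> I \<Longrightarrow> j \<in> I \<Longrightarrow> \<exists>k\<in>I. G k \<subseteq> G i \<and> G k \<subseteq> G j"
  shows "\<exists>k\<in>I. \<forall>i\<in>I. G k \<subseteq> G i"
proof -
  obtain S where "finite S" "V t = span S" using finite_dim by blast
  then show ?thesis using directed_least[of S I G] assms by simp
qed

text \<open>A Mittag-Leffler argument. The images of the spaces \<open>dying_outside B\<close>
  stabilise by finite dimension, the stable images map onto one another, and \<open>z\<close>, which
  by \<open>old\<close> lies in the stable image at \<open>s\<close>, is lifted through them along a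
  coinitial sequence. All other values are pushed forward from that sequence.\<close>

lemma lift_to_section:
  assumes B: "B = X \<times> Y" and s: "s \<in> B" and z: "z \<in> V s"
    and old: "\<And>t. t \<in> B \<Longrightarrow> t \<le> s \<Longrightarrow> z \<in> \<rho> t s ` dying_outside B t"
    and new: "\<And>t. t \<in> B \<Longrightarrow> s \<le> t \<Longrightarrow> \<rho> s t z \<notin> born_outside B t"
  shows "\<exists>\<zeta>. block_section B \<zeta> \<and> (\<forall>t\<in>B. \<zeta> t \<notin> born_outside B t)"
proof -
  have inf: "inf t u \<in> B" and sup: "sup t u \<in> B" if "t \<in> B" "u \<in> B" for t u
    using that unfolding B by (auto simp: inf_prod_def sup_prod_def inf_min sup_max min_def max_def)
  define W where "W t = (\<Inter>u\<in>{u\<in>B. u \<le> t}. \<rho> u t ` dying_outside B u)" for t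
  have im_mono: "\<rho> u t ` dying_outside B u \<subseteq> \<rho> w t ` dying_outside B w" if "u \<le> w" "w \<le> t" for t u w
  proof
    fix x assume "x \<in> \<rho> u t ` dying_outside B u"
    then obtain a where a: "a \<in> dying_outside B u" "x = \<rho> u t a" by auto
    then have "x = \<rho> w t (\<rho> u w a)" using map_comp[OF that] subsetD[OF dying_outside_subset a(1)] by simp
    then show "x \<in> \<rho> w t ` dying_outside B w" using map_dying_outside[OF that(1) a(1)] by auto
  qed
  have WV: "W t \<subseteq> dying_outside B t" if "t \<in> B" for t
  proof
    fix x assume "x \<in> W t"
    then have "x \<in> \<rho> t t ` dying_outside B t"
      unfolding W_def by (rule INT_D) (use that in simp)
    then show "x \<in> dying_outside B t" using map_dying_outside[of t t] by auto
  qed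
  have stable: "\<exists>u\<in>B. u \<le> t \<and> W t = \<rho> u t ` dying_outside B u" if t: "t \<in> B" for t
  proof -
    let ?I = "{u\<in>B. u \<le> t}"
    have "\<exists>k\<in>?I. \<forall>i\<in>?I. \<rho> k t ` dying_outside B k \<subseteq> \<rho> i t ` dying_outside B i"
    proof (rule least_subspace)
      show "?I \<noteq> {}" using t by blast
      show "subspace (\<rho> i t ` dying_outside B i)" if "i \<in> ?I" for i
        using that by (intro subspace_image_map subspace_dying_outside dying_outside_subset) auto
      show "\<rho> i t ` dying_outside B i \<subseteq> V t" if "i \<in> ?I" for i
        using that map_dying_outside[of i t] dying_outside_subset[of B t] by blast
      show "\<exists>k\<in>?I. \<rho> k t ` dying_outside B k \<subseteq> \<rho> i t ` dying_outside B i \<and>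
          \<rho> k t ` dying_outside B k \<subseteq> \<rho> j t ` dying_outside B j" if "i \<in> ?I" "j \<in> ?I" for i j
      proof (intro bexI[of _ "inf i j"] conjI)
        show "inf i j \<in> ?I" using that inf by (auto intro: le_infI1)
      qed (use that in \<open>intro im_mono; simp\<close>)+
    qed
    then obtain k where k: "k \<in> ?I" "\<forall>i\<in>?I. \<rho> k t ` dying_outside B k \<subseteq> \<rho> i t ` dying_outside B i" ..
    then have "W t = \<rho> k t ` dying_outside B k" 
      unfolding W_def by (intro antisym INF_lower INF_greatest) blast+
    then show ?thesis using k by auto
  qed
  \<comment> \<open>The point \<open>w\<close> at which the images in \<open>u\<close> have
    stabilised lies below \<open>t\<close> too, so \<open>a\<close> has a preimage at
    \<open>w\<close>, and the image of that preimage at \<open>u\<close> lies in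
    \<open>W u\<close>.\<close>
  have lift: "\<exists>b. b \<in> W u \<and> \<rho> u t b = a" if tu: "t \<in> B" "u \<in> B" "u \<le> t" and a: "a \<in> W t" for t u a
  proof -
    obtain w where w: "w \<in> B" "w \<le> u" "W u = \<rho> w u ` dying_outside B w" using stable[OF tu(2)] by auto
    have "w \<le> t" using w tu by (meson order_trans)
    then obtain c where c: "c \<in> dying_outside B w" "a = \<rho> w t c" using a w(1) unfolding W_def by blast
    then have "\<rho> u t (\<rho> w u c) = a" 
      using map_comp[OF w(2) tu(3)] subsetD[OF dying_outside_subset c(1)] by simp
    then show ?thesis using w c by auto
  qed
  obtain p where p: "p 0 = s" "\<And>n. p n \<in> B" "\<And>n. p (Suc n) \<le> p n" "\<And>t. t \<in> B \<Longrightarrow> \<exists>n. p n \<le> t"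
    using coinitial_sequence_Times[OF B s] by metis
  \<comment> \<open>The clause for \<open>n = 0\<close> pins the start of the sequence to
    \<open>z\<close>.\<close>
  have "\<exists>a. \<forall>n. (a n \<in> W (p n) \<and> (n = 0 \<longrightarrow> a n = z)) \<and> \<rho> (p (Suc n)) (p n) (a (Suc n)) = a n"
  proof (rule dependent_nat_choice)
    show "\<exists>x. x \<in> W (p 0) \<and> ((0::nat) = 0 \<longrightarrow> x = z)" using old unfolding W_def p(1) by auto
    show "\<exists>y. (y \<in> W (p (Suc n)) \<and> (Suc n = 0 \<longrightarrow> y = z)) \<and> \<rho> (p (Suc n)) (p n) y = x"
      if "x \<in> W (p n) \<and> (n = 0 \<longrightarrow> x = z)" for x n
      using lift[OF p(2,2,3)] that by auto
  qed
  then obtain a where "\<forall>n. (a n \<in> W (p n) \<and> (n = 0 \<longrightarrow> a n = z)) \<and> \<rho> (p (Suc n)) (p n) (a (Suc n)) = a n" ..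
  then have a: "\<And>n. a n \<in> W (p n)" "a 0 = z" "\<And>n. \<rho> (p (Suc n)) (p n) (a (Suc n)) = a n" by simp_all
  have aA: "a n \<in> dying_outside B (p n)" for n
    using subsetD[OF WV[OF p(2)] a(1)] .
  have aV: "a n \<in> V (p n)" for n
    using subsetD[OF dying_outside_subset aA] .
  have coh: "p (m + k) \<le> p m \<and> \<rho> (p (m + k)) (p m) (a (m + k)) = a m" for m k
  proof (induction k)
    case 0 then show ?case using aV map_refl by simp
  next
    case (Suc k)
    have le: "p (Suc (m + k)) \<le> p (m + k)" "p (m + k) \<le> p m" using p(3) Suc by simp_all
    then have "\<rho> (p (Suc (m + k))) (p m) (a (Suc (m + k))) = \<rho> (p (m + k)) (p m) (a (m + k))"
      using map_comp[OF le aV] a(3) by simp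
    moreover have "p (Suc (m + k)) \<le> p m" using le by (rule order_trans)
    ultimately show ?case using Suc by simp
  qed
  \<comment> \<open>By coherence any \<open>n\<close> with \<open>p n \<le> t\<close> gives the same
    value; the least one merely makes a choice.\<close>
  define \<zeta> where "\<zeta> t = (if t \<in> B then let n = (LEAST n. p n \<le> t) in \<rho> (p n) t (a n) else 0)" for t
  have \<zeta>: "\<zeta> t = \<rho> (p n) t (a n)" if t: "t \<in> B" and n: "p n \<le> t" for t n
  proof -
    define m where "m = (LEAST n. p n \<le> t)"
    have m: "p m \<le> t" "m \<le> n" unfolding m_def using n by (rule LeastI, rule Least_le)
    then have le: "p n \<le> p m" and eq: "\<rho> (p n) (p m) (a n) = a m" using coh[of m "n - m"] by auto
    have "\<zeta> t = \<rho> (p m) t (a m)" using t by (simp add: \<zeta>_def m_def Let_def)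
    also have "\<dots> = \<rho> (p n) t (a n)" using map_comp[OF le m(1) aV] eq by simp
    finally show ?thesis .
  qed
  have \<zeta>A: "\<zeta> t \<in> dying_outside B t" for t
  proof (cases "t \<in> B")
    case True
    then obtain n where "p n \<le> t" using p(4) by blast
    then show ?thesis using \<zeta>[OF True] aA map_dying_outside by simp
  qed (use subspace_0[OF subspace_dying_outside] in \<open>simp add: \<zeta>_def\<close>)
  have \<zeta>map: "\<rho> t u (\<zeta> t) = \<zeta> u" if le: "t \<le> u" and t: "t \<in> B" for t u
  proof (cases "u \<in> B")
    case True
    obtain n where n: "p n \<le> t" using p(4) t by blast
    have nu: "p n \<le> u" using n le by (rule order_trans)
    show ?thesis using \<zeta>[OF t n] \<zeta>[OF True nu] map_comp[OF n le aV] by simp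
  next
    case False
    then have "\<rho> t u (\<zeta> t) = 0" using \<zeta>A[of t] le unfolding dying_outside_def by blast
    then show ?thesis using False by (simp add: \<zeta>_def)
  qed
  \<comment> \<open>A point of the block need not be comparable with \<open>s\<close>. At its join
    with \<open>s\<close> the section agrees with the image of \<open>z\<close>, and there
    \<open>new\<close> applies.\<close>
  have \<zeta>C: "\<zeta> t \<notin> born_outside B t" if t: "t \<in> B" for t
  proof
    assume "\<zeta> t \<in> born_outside B t"
    then have "\<rho> t (sup t s) (\<zeta> t) \<in> born_outside B (sup t s)" by (intro map_born_outside) simp_all
    moreover have "\<rho> t (sup t s) (\<zeta> t) = \<zeta> (sup t s)" using t by (intro \<zeta>map) simp_all
    moreover have "\<zeta> (sup t s) = \<rho> s (sup t s) z"
      using \<zeta>[of "sup t s" 0] sup[OF t s] p(1) a(2) by simp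
    ultimately show False using new[OF sup[OF t s]] by simp
  qed
  have "\<zeta> t \<noteq> 0 \<longleftrightarrow> t \<in> B" for t
    using \<zeta>C[of t] subspace_0[OF subspace_born_outside, of B t] by (metis \<zeta>_def)
  moreover have "\<zeta> t \<in> V t" for t using subsetD[OF dying_outside_subset \<zeta>A] .
  ultimately have "block_section B \<zeta>" using \<zeta>map by (simp add: block_section_def)
  then show ?thesis using \<zeta>C by auto
qed

end

section \<open>Blocks and exact bimodules\<close>

text \<open>Cuts will come from up-sets of the line: once dead, a vector stays dead further on, and
  an image grows as its source moves forward. The blocks below are described by two such up-sets
  \<open>P\<close> and \<open>Q\<close> or their complements.\<close>

lemma cut_of_upper:
  fixes U :: "real set"
  assumes "\<And>x y. x \<in> U \<Longrightarrow> x \<le> y \<Longrightarrow> y \<in> U"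
  shows "is_cut (- U, U)"
  using assms unfolding is_cut_def by (auto simp: not_less[symmetric] dest: leI)

lemma death_quadrantI:
  assumes "\<And>x y. x \<in> P \<Longrightarrow> x \<le> y \<Longrightarrow> y \<in> P" "\<And>x y. x \<in> Q \<Longrightarrow> x \<le> y \<Longrightarrow> y \<in> Q"
    and "(- P) \<times> (- Q) \<noteq> {}"
  shows "block ((- P) \<times> (- Q))"
proof -
  have "is_cut (- P, P)" "is_cut (- Q, Q)" "is_cut ({}, UNIV)"
    using assms(1,2) by (simp_all add: cut_of_upper) (simp_all add: is_cut_def)
  moreover have "(- P) \<times> (- Q) = rectangle_of_cuts ({}, UNIV) (- P, P) ({}, UNIV) (- Q, Q)"
    by (simp add: rectangle_of_cuts_def)
  ultimately show ?thesis
    using assms(3) unfolding block_def death_quadrant_def by (metis fst_conv)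
qed

lemma birth_quadrantI:
  assumes "\<And>x y. x \<in> P \<Longrightarrow> x \<le> y \<Longrightarrow> y \<in> P" "\<And>x y. x \<in> Q \<Longrightarrow> x \<le> y \<Longrightarrow> y \<in> Q"
    and "P \<times> Q \<noteq> {}"
  shows "block (P \<times> Q)"
proof -
  have "is_cut (- P, P)" "is_cut (- Q, Q)" "is_cut (UNIV, {})"
    using assms(1,2) by (simp_all add: cut_of_upper) (simp_all add: is_cut_def)
  moreover have "P \<times> Q = rectangle_of_cuts (- P, P) (UNIV, {}) (- Q, Q) (UNIV, {})"
    by (simp add: rectangle_of_cuts_def)
  ultimately show ?thesis
    using assms(3) unfolding block_def birth_quadrant_def by (metis snd_conv)
qed

lemma horizontal_bandI:
  assumes "\<And>x y. x \<in> P \<Longrightarrow> x \<le> y \<Longrightarrow> y \<in> P" "\<And>x y. x \<in> Q \<Longrightarrow> x \<le> y \<Longrightarrow> y \<in> Q"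
    and "P - Q \<noteq> {}"
  shows "horizontal_band (UNIV \<times> (P - Q))"
proof -
  have "is_cut (- P, P)" "is_cut (- Q, Q)" "is_cut (UNIV, {})" "is_cut ({}, UNIV)"
    using assms(1,2) by (simp_all add: cut_of_upper) (simp_all add: is_cut_def)
  moreover have "UNIV \<times> (P - Q) = rectangle_of_cuts ({}, UNIV) (UNIV, {}) (- P, P) (- Q, Q)"
    by (auto simp: rectangle_of_cuts_def)
  moreover have "(UNIV :: real set) \<times> (P - Q) \<noteq> {}" using assms(3) by auto
  ultimately show ?thesis
    unfolding horizontal_band_def by (metis fst_conv snd_conv)
qed

lemma vertical_band_swap:
  assumes "horizontal_band B"
  shows "vertical_band (prod.swap -` B)"
proof -
  obtain l r b t where "is_cut l" "is_cut r" "is_cut b" "is_cut t" "B = rectangle_of_cuts l r b t"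
    "fst l = {}" "snd r = {}" "B \<noteq> {}"
    using assms unfolding horizontal_band_def by blast
  moreover from this have "prod.swap -` B = rectangle_of_cuts b t l r" by (auto simp: rectangle_of_cuts_def)
  moreover have "prod.swap -` B \<noteq> {}"
  proof -
    obtain p where "p \<in> B" using \<open>B \<noteq> {}\<close> by blast
    then have "prod.swap p \<in> prod.swap -` B" by simp
    then show ?thesis by blast
  qed
  ultimately show ?thesis unfolding vertical_band_def by metis
qed

lemma block_Times: "block B \<Longrightarrow> \<exists>X Y. B = X \<times> Y"
  unfolding block_def birth_quadrant_def death_quadrant_def horizontal_band_def vertical_band_def
    rectangle_of_cuts_def by auto

lemma block_nonempty: "block B \<Longrightarrow> B \<noteq> {}"
  unfolding block_def birth_quadrant_def death_quadrant_def horizontal_band_def vertical_band_def by auto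

text \<open>The horizontal and the vertical line through \<open>s\<close> consist of points
  comparable with \<open>s\<close>, so agreement above and below \<open>s\<close> determines both
  factors. Uniqueness of the decomposition rests on information of this kind.\<close>

lemma Times_eqI:
  fixes B D :: "(real \<times> real) set"
  assumes "B = X \<times> Y" "D = X' \<times> Y'" "s \<in> B" "s \<in> D"
    and "\<And>t. t \<le> s \<Longrightarrow> t \<in> B \<longleftrightarrow> t \<in> D" "\<And>t. s \<le> t \<Longrightarrow> t \<in> B \<longleftrightarrow> t \<in> D"
  shows "B = D"
proof -
  obtain a b where s: "s = (a, b)" by (cases s)
  have ab: "a \<in> X" "b \<in> Y" "a \<in> X'" "b \<in> Y'" using assms(1-4) s by auto
  have eq: "t \<in> B \<longleftrightarrow> t \<in> D" if "t \<le> s \<or> s \<le> t" for t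
    using that assms(5,6) by (elim disjE)
  have "x \<in> X \<longleftrightarrow> x \<in> X'" for x
  proof -
    have "(x, b) \<le> s \<or> s \<le> (x, b)" using s by auto
    then show ?thesis using eq[of "(x, b)"] ab assms(1,2) by simp
  qed
  moreover have "y \<in> Y \<longleftrightarrow> y \<in> Y'" for y
  proof -
    have "(a, y) \<le> s \<or> s \<le> (a, y)" using s by auto
    then show ?thesis using eq[of "(a, y)"] ab assms(1,2) by simp
  qed
  ultimately show ?thesis using assms(1,2) by auto
qed

section \<open>Exactness as a lifting property\<close>

locale exact_module = pfd_module +
  assumes exact: "x \<le> x' \<Longrightarrow> y \<le> y' \<Longrightarrow> a \<in> V (x', y) \<Longrightarrow> b \<in> V (x, y') \<Longrightarrow>
      \<rho> (x', y) (x', y') a = \<rho> (x, y') (x', y') b \<Longrightarrow>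
      \<exists>c\<in>V (x, y). \<rho> (x, y) (x', y) c = a \<and> \<rho> (x, y) (x, y') c = b"
begin

lemma kernel_map_chain:
  assumes "s \<le> t" "s \<le> u" "t \<le> u \<or> u \<le> t"
  shows "{x \<in> V s. \<rho> s t x = 0} \<subseteq> {x \<in> V s. \<rho> s u x = 0} \<or> {x \<in> V s. \<rho> s u x = 0} \<subseteq> {x \<in> V s. \<rho> s t x = 0}"
  using assms kernel_map_mono by meson

text \<open>The kernels belonging to a chain of later points are nested, so by finite dimension a
  smallest one is attained. A lift that has to die at infinitely many places then needs to be
  controlled at a single one.\<close>

lemma earliest_death:
  assumes ne: "T \<noteq> {}" and ge: "\<And>t. t \<in> T \<Longrightarrow> s \<le> t" and chain: "\<And>t u. t \<in> T \<Longrightarrow> u \<in> T \<Longrightarrow> t \<le> u \<or> u \<le> t"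
  shows "\<exists>t\<in>T. \<forall>u\<in>T. \<forall>x\<in>V s. \<rho> s t x = 0 \<longrightarrow> \<rho> s u x = 0"
proof -
  have "\<exists>t\<in>T. \<forall>u\<in>T. {x \<in> V s. \<rho> s t x = 0} \<subseteq> {x \<in> V s. \<rho> s u x = 0}"
  proof (rule least_subspace[OF ne])
    fix t u assume "t \<in> T" "u \<in> T"
    then show "\<exists>w\<in>T. {x \<in> V s. \<rho> s w x = 0} \<subseteq> {x \<in> V s. \<rho> s t x = 0} \<and> {x \<in> V s. \<rho> s w x = 0} \<subseteq> {x \<in> V s. \<rho> s u x = 0}"
      using kernel_map_chain[OF ge ge chain] by (metis (no_types, lifting) order_refl)
  qed (use ge in \<open>auto intro: subspace_kernel_map\<close>)
  then show ?thesis by blast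
qed

lemma earliest_horizontal_death:
  assumes "P \<noteq> {}" "\<And>x'. x' \<in> P \<Longrightarrow> x \<le> x'"
  obtains x1 where "x1 \<in> P"
    "\<And>x' c. x' \<in> P \<Longrightarrow> c \<in> V (x, y) \<Longrightarrow> \<rho> (x, y) (x1, y) c = 0 \<Longrightarrow> \<rho> (x, y) (x', y) c = 0"
proof -
  have "\<exists>t\<in>(\<lambda>x'. (x', y)) ` P. \<forall>u\<in>(\<lambda>x'. (x', y)) ` P. \<forall>c\<in>V (x, y). \<rho> (x, y) t c = 0 \<longrightarrow> \<rho> (x, y) u c = 0"
  proof (rule earliest_death)
    show "t \<le> u \<or> u \<le> t" if "t \<in> (\<lambda>x'. (x', y)) ` P" "u \<in> (\<lambda>x'. (x', y)) ` P" for t u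
      using that by auto
  qed (use assms in auto)
  then show thesis using that by (simp only: bex_simps ball_simps) (elim bexE; simp)
qed

lemma earliest_vertical_death:
  assumes "Q \<noteq> {}" "\<And>y'. y' \<in> Q \<Longrightarrow> y \<le> y'"
  obtains y1 where "y1 \<in> Q"
    "\<And>y' c. y' \<in> Q \<Longrightarrow> c \<in> V (x, y) \<Longrightarrow> \<rho> (x, y) (x, y1) c = 0 \<Longrightarrow> \<rho> (x, y) (x, y') c = 0"
proof -
  have "\<exists>t\<in>(\<lambda>y'. (x, y')) ` Q. \<forall>u\<in>(\<lambda>y'. (x, y')) ` Q. \<forall>c\<in>V (x, y). \<rho> (x, y) t c = 0 \<longrightarrow> \<rho> (x, y) u c = 0"
  proof (rule earliest_death)
    show "t \<le> u \<or> u \<le> t" if "t \<in> (\<lambda>y'. (x, y')) ` Q" "u \<in> (\<lambda>y'. (x, y')) ` Q" for t u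
      using that by auto
  qed (use assms in auto)
  then show thesis using that by (simp only: bex_simps ball_simps) (elim bexE; simp)
qed

text \<open>The vector \<open>a\<close> agrees with 0 at \<open>(x', y')\<close>, so exactness
  applies to the pair \<open>(a, 0)\<close>. Death in the vertical direction thus permits a lift to
  any column on the left, with death at the same height.\<close>

lemma lift_horizontally:
  assumes "x \<le> x'" "y \<le> y'" "a \<in> V (x', y)" "\<rho> (x', y) (x', y') a = 0"
  shows "\<exists>c\<in>V (x, y). \<rho> (x, y) (x', y) c = a \<and> \<rho> (x, y) (x, y') c = 0"
  using exact[OF assms(1-3) zero_in] assms map_zero[of "(x, y')" "(x', y')"] by simp

lemma lift_vertically:
  assumes "x \<le> x'" "y \<le> y'" "a \<in> V (x, y')" "\<rho> (x, y') (x', y') a = 0"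
  shows "\<exists>c\<in>V (x, y). \<rho> (x, y) (x, y') c = a \<and> \<rho> (x, y) (x', y) c = 0"
  using exact[OF assms(1,2) zero_in assms(3)] assms map_zero[of "(x', y)" "(x', y')"] by auto

text \<open>Two preimages of \<open>z\<close> agree at \<open>(a, b)\<close>, so exactness merges
  them. Whether a vector comes from a point below can thus be tested in the two directions
  separately.\<close>

lemma image_Int:
  assumes "x \<le> a" "y \<le> b" "z \<in> \<rho> (x, b) (a, b) ` V (x, b)" "z \<in> \<rho> (a, y) (a, b) ` V (a, y)"
  shows "z \<in> \<rho> (x, y) (a, b) ` V (x, y)"
proof -
  obtain u v where uv: "u \<in> V (x, b)" "v \<in> V (a, y)" "z = \<rho> (x, b) (a, b) u" "z = \<rho> (a, y) (a, b) v"
    using assms by auto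
  then obtain c where c: "c \<in> V (x, y)" "\<rho> (x, y) (a, y) c = v"
    using exact[OF assms(1,2) uv(2,1)] by auto
  then have "\<rho> (x, y) (a, b) c = z" using uv assms map_comp[of "(x, y)" "(a, y)" "(a, b)" c] by simp
  then show ?thesis using c by auto
qed

lemma dies_mono:
  assumes "s \<le> t" "t \<le> u" "z \<in> V s" "\<rho> s t z = 0"
  shows "\<rho> s u z = 0"
  using assms map_comp[of s t u z] map_zero by simp

text \<open>Among the elements that persist down to \<open>- \<infinity>\<close> pick one that dies as early as possible,
  first vertically, then horizontally. By minimality it dies nowhere inside the resulting quadrant.\<close>

lemma death_section:
  assumes z0: "z0 \<in> V (a, b)" "z0 \<noteq> 0"
    and old: "\<And>x y. x \<le> a \<Longrightarrow> y \<le> b \<Longrightarrow> z0 \<in> \<rho> (x, y) (a, b) ` V (x, y)"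
  shows "\<exists>B \<zeta>. block B \<and> block_section B \<zeta> \<and> (\<forall>t\<in>B. \<zeta> t \<notin> born_outside B t)"
proof -
  let ?H = "\<lambda>x. {z \<in> V (a, b). \<rho> (a, b) (x, b) z = 0}"
  let ?K = "\<lambda>y. {z \<in> V (a, b). \<rho> (a, b) (a, y) z = 0}"
  obtain S where S: "finite S" "V (a, b) = span S" using finite_dim by blast
  define J where "J = (\<Inter>t\<in>{t. t \<le> (a, b)}. \<rho> t (a, b) ` V t)"
  have JI: "z \<in> J" if "\<And>x y. x \<le> a \<Longrightarrow> y \<le> b \<Longrightarrow> z \<in> \<rho> (x, y) (a, b) ` V (x, y)" for z
    using that unfolding J_def by auto
  have JD: "z \<in> \<rho> (x, y) (a, b) ` V (x, y)" if "z \<in> J" "x \<le> a" "y \<le> b" for z x y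
    using that unfolding J_def by auto
  have J: "subspace J" unfolding J_def
    by (intro subspace_Int subspace_image_map subspace_V) auto
  have JV: "J \<subseteq> V (a, b)"
  proof
    fix z assume "z \<in> J"
    then have "z \<in> \<rho> (a, b) (a, b) ` V (a, b)" using JD[of z a b] by simp
    then show "z \<in> V (a, b)" using map_refl by auto
  qed
  have "\<exists>z\<in>J. z \<noteq> 0 \<and> (\<forall>y\<in>{b..}. (\<exists>w\<in>J. w \<noteq> 0 \<and> w \<in> ?K y) \<longrightarrow> z \<in> ?K y)"
  proof (rule chain_common_nonzero[OF S(1) J _ JI[OF old] z0(2)])
    show "?K y \<subseteq> ?K y' \<or> ?K y' \<subseteq> ?K y" if "y \<in> {b..}" "y' \<in> {b..}" for y y'
      using that by (intro kernel_map_chain) auto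
    show "J \<subseteq> span S" using JV S(2) by simp
    show "subspace (?K y)" if "y \<in> {b..}" for y using that by (intro subspace_kernel_map) auto
  qed
  then obtain z1 where z1: "z1 \<in> J" "z1 \<noteq> 0"
    "\<forall>y\<in>{b..}. (\<exists>w\<in>J. w \<noteq> 0 \<and> w \<in> ?K y) \<longrightarrow> z1 \<in> ?K y" by auto
  define Q where "Q = {y. b \<le> y \<and> (\<exists>w\<in>J. w \<noteq> 0 \<and> \<rho> (a, b) (a, y) w = 0)}"
  \<comment> \<open>\<open>z1\<close> shows that one nonzero vector is dead at every height in
    \<open>Q\<close>. Hence \<open>Z\<close> is nonzero, and the horizontal choice can be made
    inside it without losing any vertical death.\<close>
  define Z where "Z = J \<inter> (\<Inter>y\<in>Q. ?K y)"
  have Z: "subspace Z" unfolding Z_def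
    by (intro subspace_inter J subspace_Int subspace_kernel_map) (auto simp: Q_def)
  have z1Z: "z1 \<in> Z" using z1 JV unfolding Z_def Q_def by auto
  have "\<exists>z\<in>Z. z \<noteq> 0 \<and> (\<forall>x\<in>{a..}. (\<exists>w\<in>Z. w \<noteq> 0 \<and> w \<in> ?H x) \<longrightarrow> z \<in> ?H x)"
  proof (rule chain_common_nonzero[OF S(1) Z _ z1Z z1(2)])
    show "?H x \<subseteq> ?H x' \<or> ?H x' \<subseteq> ?H x" if "x \<in> {a..}" "x' \<in> {a..}" for x x'
      using that by (intro kernel_map_chain) auto
    show "Z \<subseteq> span S" using JV S(2) unfolding Z_def by auto
    show "subspace (?H x)" if "x \<in> {a..}" for x using that by (intro subspace_kernel_map) auto
  qed
  then obtain z where z: "z \<in> Z" "z \<noteq> 0"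
    "\<forall>x\<in>{a..}. (\<exists>w\<in>Z. w \<noteq> 0 \<and> w \<in> ?H x) \<longrightarrow> z \<in> ?H x" by auto
  define P where "P = {x. a \<le> x \<and> (\<exists>w\<in>Z. w \<noteq> 0 \<and> \<rho> (a, b) (x, b) w = 0)}"
  have zJ: "z \<in> J" and zV: "z \<in> V (a, b)" using z(1) JV unfolding Z_def by auto
  have ZV: "w \<in> V (a, b)" if "w \<in> Z" for w using that JV unfolding Z_def by auto
  have zQ: "\<rho> (a, b) (a, y) z = 0" if "y \<in> Q" for y using z(1) that unfolding Z_def by auto
  have zP: "\<rho> (a, b) (x, b) z = 0" if "x \<in> P" for x
  proof -
    obtain w where w: "a \<le> x" "w \<in> Z" "w \<noteq> 0" "\<rho> (a, b) (x, b) w = 0" using \<open>x \<in> P\<close> by (auto simp: P_def)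
    then show ?thesis using z(3) ZV[OF w(2)] by auto
  qed
  have Pup: "x' \<in> P" if "x \<in> P" "x \<le> x'" for x x'
  proof -
    obtain w where w: "a \<le> x" "w \<in> Z" "w \<noteq> 0" "\<rho> (a, b) (x, b) w = 0" using \<open>x \<in> P\<close> by (auto simp: P_def)
    then have "\<rho> (a, b) (x', b) w = 0"
      using dies_mono[of "(a, b)" "(x, b)" "(x', b)" w] ZV[OF w(2)] \<open>x \<le> x'\<close> by simp
    then show ?thesis using w \<open>x \<le> x'\<close> by (auto simp: P_def)
  qed
  have Qup: "y' \<in> Q" if "y \<in> Q" "y \<le> y'" for y y'
  proof -
    obtain w where w: "b \<le> y" "w \<in> J" "w \<noteq> 0" "\<rho> (a, b) (a, y) w = 0" using \<open>y \<in> Q\<close> by (auto simp: Q_def)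
    then have "\<rho> (a, b) (a, y') w = 0"
      using dies_mono[of "(a, b)" "(a, y)" "(a, y')" w] subsetD[OF JV w(2)] \<open>y \<le> y'\<close> by simp
    then show ?thesis using w \<open>y \<le> y'\<close> by (auto simp: Q_def)
  qed
  have aP: "a \<notin> P" using map_refl ZV unfolding P_def by auto
  have bQ: "b \<notin> Q" using map_refl JV unfolding Q_def by auto
  define B where "B = (- P) \<times> (- Q)"
  have down: "u \<in> B" if "u \<le> t" "t \<in> B" for t u
    using that Pup[of "fst u" "fst t"] Qup[of "snd u" "snd t"] unfolding B_def by (auto simp: less_eq_prod_def mem_Times_iff)
  have born: "born_outside B t = {0}" if "t \<in> B" for t
  proof -
    have "{\<rho> u t x | u x. u \<le> t \<and> u \<notin> B \<and> x \<in> V u} = {}" using down that by blast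
    then show ?thesis unfolding born_outside_def by (simp only: span_empty)
  qed
  \<comment> \<open>If \<open>z\<close> dies only after moving in both directions, its image at
    \<open>(x, b)\<close> dies vertically and lifts to a \<open>z'\<close> at \<open>(a, b)\<close>
    that dies at height \<open>y\<close>. This \<open>z'\<close> is again in \<open>J\<close>: it
    lifts leftwards because it dies vertically, and downwards because \<open>z\<close> does and
    \<open>z - z'\<close> dies horizontally. As \<open>y\<close> is not in \<open>Q\<close>,
    \<open>z'\<close> is 0, so \<open>z\<close> already dies at \<open>(x, b)\<close>, against the
    choice of \<open>x\<close>.\<close>
  have alive: "\<rho> (a, b) (x, y) z \<noteq> 0" if x: "x \<notin> P" "a \<le> x" and y: "y \<notin> Q" "b \<le> y" for x y
  proof
    assume dead: "\<rho> (a, b) (x, y) z = 0"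
    have "\<rho> (a, b) (x, b) z \<in> V (x, b)" using zV x map_in by simp
    moreover have "\<rho> (x, b) (x, y) (\<rho> (a, b) (x, b) z) = 0"
      using dead map_comp[of "(a, b)" "(x, b)" "(x, y)"] zV x y by simp
    ultimately obtain z' where z': "z' \<in> V (a, b)" "\<rho> (a, b) (x, b) z' = \<rho> (a, b) (x, b) z" "\<rho> (a, b) (a, y) z' = 0"
      using lift_horizontally[OF x(2) y(2)] by auto
    have "z' \<in> J"
    proof (rule JI)
      fix x' y' assume le: "x' \<le> a" "y' \<le> b"
      have "z' \<in> \<rho> (x', b) (a, b) ` V (x', b)" using lift_horizontally[OF le(1) y(2) z'(1,3)] by blast
      moreover have "z' \<in> \<rho> (a, y') (a, b) ` V (a, y')"
      proof -
        have "\<rho> (a, b) (x, b) (z - z') = 0" using z' zV x by (simp add: map_diff)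
        then obtain w where w: "w \<in> V (a, y')" "\<rho> (a, y') (a, b) w = z - z'"
          using lift_vertically[OF x(2) le(2) diff_in[OF zV z'(1)]] by auto
        obtain v where v: "v \<in> V (a, y')" "z = \<rho> (a, y') (a, b) v" using JD[OF zJ _ le(2), of a] by auto
        have "z' = \<rho> (a, y') (a, b) (v - w)" using v w le by (simp add: map_diff)
        then show ?thesis using v w diff_in by blast
      qed
      ultimately show "z' \<in> \<rho> (x', y') (a, b) ` V (x', y')" by (rule image_Int[OF le])
    qed
    then have "z' = 0" using z' y unfolding Q_def by auto
    then have "\<rho> (a, b) (x, b) z = 0" using z' x map_zero by simp
    then show False using x z unfolding P_def by auto
  qed
  have lift: "z \<in> \<rho> (x, y) (a, b) ` dying_outside B (x, y)" if x: "x \<notin> P" "x \<le> a" and y: "y \<notin> Q" "y \<le> b" for x y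
  proof -
    \<comment> \<open>The preimage must die on all of \<open>P\<close> and all of \<open>Q\<close>.
      Earliest deaths reduce this to one \<open>x1\<close> and one \<open>y1\<close>, after which
      the lift can be made in one direction at a time.\<close>
    have "\<exists>c\<in>V (x, y). \<rho> (x, y) (a, b) c = z \<and> (\<forall>x'\<in>P. \<rho> (x, y) (x', y) c = 0) \<and> (\<forall>y'\<in>Q. \<rho> (x, y) (x, y') c = 0)"
    proof -
      have Pge: "a \<le> x'" if "x' \<in> P" for x' using that by (simp add: P_def)
      have Qge: "b \<le> y'" if "y' \<in> Q" for y' using that by (simp add: Q_def)
      show ?thesis
      proof (cases "Q = {}")
        case True
        show ?thesis
        proof (cases "P = {}")
          case True
          then show ?thesis using JD[OF zJ x(2) y(2)] \<open>Q = {}\<close> by auto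
        next
          case False
          obtain x1 where x1: "x1 \<in> P" "\<And>x' c. x' \<in> P \<Longrightarrow> c \<in> V (x, y) \<Longrightarrow> \<rho> (x, y) (x1, y) c = 0 \<Longrightarrow> \<rho> (x, y) (x', y) c = 0"
            by (rule earliest_horizontal_death[OF False order_trans[OF x(2) Pge]]) iprover+
          \<comment> \<open>With \<open>Q\<close> empty there is no vertical death that would permit
            a lift to the left, so that step uses membership in \<open>J\<close> and precedes the
            lift downwards.\<close>
          obtain c1 where c1: "c1 \<in> V (x, b)" "\<rho> (x, b) (a, b) c1 = z" using JD[OF zJ x(2), of b] by auto
          have "\<rho> (x, b) (x1, b) c1 = 0"
            using map_comp[of "(x, b)" "(a, b)" "(x1, b)" c1] c1 x(2) Pge[OF x1(1)] zP[OF x1(1)] by simp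
          then obtain c where c: "c \<in> V (x, y)" "\<rho> (x, y) (x, b) c = c1" "\<rho> (x, y) (x1, y) c = 0"
            using lift_vertically[of x x1 y b c1] c1 x(2) y(2) Pge[OF x1(1)] by auto
          then have "\<rho> (x, y) (a, b) c = z" using map_comp[of "(x, y)" "(x, b)" "(a, b)" c] c1 x(2) y(2) by simp
          then show ?thesis using c x1(2) \<open>Q = {}\<close> by auto
        qed
      next
        case False
        have "\<exists>c1\<in>V (a, y). \<rho> (a, y) (a, b) c1 = z \<and> (\<forall>x'\<in>P. \<rho> (a, y) (x', y) c1 = 0)"
        proof (cases "P = {}")
          case True
          then show ?thesis using JD[OF zJ _ y(2), of a] by auto
        next
          case False
          obtain x1 where x1: "x1 \<in> P" "\<And>x' c. x' \<in> P \<Longrightarrow> c \<in> V (a, y) \<Longrightarrow> \<rho> (a, y) (x1, y) c = 0 \<Longrightarrow> \<rho> (a, y) (x', y) c = 0"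
            by (rule earliest_horizontal_death[OF False Pge]) iprover+
          then show ?thesis
            using lift_vertically[OF Pge[OF x1(1)] y(2) zV zP[OF x1(1)]] by blast
        qed
        then obtain c1 where c1: "c1 \<in> V (a, y)" "\<rho> (a, y) (a, b) c1 = z" "\<And>x'. x' \<in> P \<Longrightarrow> \<rho> (a, y) (x', y) c1 = 0" by auto
        obtain y1 where y1: "y1 \<in> Q" "\<And>y' c. y' \<in> Q \<Longrightarrow> c \<in> V (x, y) \<Longrightarrow> \<rho> (x, y) (x, y1) c = 0 \<Longrightarrow> \<rho> (x, y) (x, y') c = 0"
          by (rule earliest_vertical_death[OF False order_trans[OF y(2) Qge]]) iprover+
        have "\<rho> (a, y) (a, y1) c1 = 0"
          using map_comp[of "(a, y)" "(a, b)" "(a, y1)" c1] c1 y(2) Qge[OF y1(1)] zQ[OF y1(1)] by simp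
        then obtain c where c: "c \<in> V (x, y)" "\<rho> (x, y) (a, y) c = c1" "\<rho> (x, y) (x, y1) c = 0"
          using lift_horizontally[of x a y y1 c1] c1 x(2) y(2) Qge[OF y1(1)] by auto
        have "\<rho> (x, y) (x', y) c = 0" if "x' \<in> P" for x'
          using map_comp[of "(x, y)" "(a, y)" "(x', y)" c] c c1(3)[OF that] x(2) Pge[OF that] by simp
        moreover have "\<rho> (x, y) (a, b) c = z" using map_comp[of "(x, y)" "(a, y)" "(a, b)" c] c c1 x(2) y(2) by simp
        ultimately show ?thesis using c y1(2) by blast
      qed
    qed
    then obtain c where c: "c \<in> V (x, y)" "\<rho> (x, y) (a, b) c = z"
      "\<And>x'. x' \<in> P \<Longrightarrow> \<rho> (x, y) (x', y) c = 0" "\<And>y'. y' \<in> Q \<Longrightarrow> \<rho> (x, y) (x, y') c = 0" by blast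
    have "\<rho> (x, y) (x', y') c = 0" if "x \<le> x'" "y \<le> y'" "(x', y') \<notin> B" for x' y'
    proof -
      from that consider "x' \<in> P" | "y' \<in> Q" unfolding B_def by auto
      then show ?thesis
        using dies_mono[of "(x, y)" "(x', y)" "(x', y')" c] dies_mono[of "(x, y)" "(x, y')" "(x', y')" c]
          c(1,3,4) that by cases auto
    qed
    then have "c \<in> dying_outside B (x, y)" using c(1) unfolding dying_outside_def by auto
    then show ?thesis using c(2) by blast
  qed
  have "\<exists>\<zeta>. block_section B \<zeta> \<and> (\<forall>t\<in>B. \<zeta> t \<notin> born_outside B t)"
  proof (rule lift_to_section[OF B_def])
    show "(a, b) \<in> B" using aP bQ by (simp add: B_def)
    show "z \<in> \<rho> t (a, b) ` dying_outside B t" if "t \<in> B" "t \<le> (a, b)" for t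
      using lift that by (cases t) (simp add: B_def)
    show "\<rho> (a, b) t z \<notin> born_outside B t" if "t \<in> B" "(a, b) \<le> t" for t
      using alive that born[OF that(1)] by (cases t) (simp add: B_def)
  qed (rule zV)
  moreover have "block B" unfolding B_def
  proof (rule death_quadrantI)
    show "(- P) \<times> (- Q) \<noteq> {}" using aP bQ by auto
  qed (use Pup Qup in auto)
  ultimately show ?thesis by blast
qed

text \<open>Dually, divide by the elements that eventually die and by as many early-born ones as possible,
  first horizontally, then vertically, keeping the quotient nonzero.\<close>

lemma birth_section:
  assumes v0: "v0 \<in> V (a, b)"
    and new: "\<And>x y. a \<le> x \<Longrightarrow> b \<le> y \<Longrightarrow> \<rho> (a, b) (x, y) v0 \<noteq> 0"
  shows "\<exists>B \<zeta>. block B \<and> block_section B \<zeta> \<and> (\<forall>t\<in>B. \<zeta> t \<notin> born_outside B t)"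
proof -
  let ?H = "\<lambda>x. \<rho> (x, b) (a, b) ` V (x, b)"
  let ?L = "\<lambda>y. \<rho> (a, y) (a, b) ` V (a, y)"
  obtain S where S: "finite S" "V (a, b) = span S" using finite_dim by blast
  define K where "K = {z \<in> V (a, b). \<exists>x y. a \<le> x \<and> b \<le> y \<and> \<rho> (a, b) (x, y) z = 0}"
  have KI: "z \<in> K" if "z \<in> V (a, b)" "a \<le> x" "b \<le> y" "\<rho> (a, b) (x, y) z = 0" for x y z
    using that unfolding K_def by blast
  have KV: "K \<subseteq> V (a, b)" unfolding K_def by auto
  have K: "subspace K"
  proof (rule subspaceI)
    show "0 \<in> K" by (rule KI[of 0 a b]) (simp_all add: zero_in map_zero)
    fix v w assume "v \<in> K" "w \<in> K"
    then obtain x y x' y' where *: "v \<in> V (a, b)" "a \<le> x" "b \<le> y" "\<rho> (a, b) (x, y) v = 0"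
      "w \<in> V (a, b)" "a \<le> x'" "b \<le> y'" "\<rho> (a, b) (x', y') w = 0" unfolding K_def by auto
    have "\<rho> (a, b) (max x x', max y y') v = 0" "\<rho> (a, b) (max x x', max y y') w = 0"
      using dies_mono[of "(a, b)" "(x, y)" "(max x x', max y y')" v]
        dies_mono[of "(a, b)" "(x', y')" "(max x x', max y y')" w] * by auto
    then show "v + w \<in> K" using * by (intro KI[of _ "max x x'" "max y y'"]) (auto simp: add_in map_add le_max_iff_disj)
  next
    fix c v assume "v \<in> K"
    then obtain x y where *: "v \<in> V (a, b)" "a \<le> x" "b \<le> y" "\<rho> (a, b) (x, y) v = 0" unfolding K_def by auto
    then show "c *s v \<in> K" by (intro KI[of _ x y]) (auto simp: scale_in map_scale)
  qed
  have "v0 \<notin> K" using new unfolding K_def by auto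
  then have "K \<subset> span S" using KV S(2) v0 by auto
  have Hmono: "?H x \<subseteq> ?H x'" if "x \<le> x'" "x' \<le> a" for x x' using that by (intro image_map_mono) auto
  have Lmono: "?L y \<subseteq> ?L y'" if "y \<le> y'" "y' \<le> b" for y y' using that by (intro image_map_mono) auto
  have HV: "?H x \<subseteq> V (a, b)" if "x \<le> a" for x using that map_in[of "(x, b)" "(a, b)"] by auto
  have LV: "?L y \<subseteq> V (a, b)" if "y \<le> b" for y using that map_in[of "(a, y)" "(a, b)"] by auto
  have subH: "subspace (?H x)" if "x \<le> a" for x using that by (intro subspace_image_map subspace_V) auto
  have subL: "subspace (?L y)" if "y \<le> b" for y using that by (intro subspace_image_map subspace_V) auto
  have "\<exists>W. subspace W \<and> W \<subset> span S \<and> K \<subseteq> W \<and>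
    (\<forall>x\<in>{..a}. {k + h | k h. k \<in> K \<and> h \<in> ?H x} = span S \<or> ?H x \<subseteq> W)"
  proof (rule chain_common_proper[OF S(1) K \<open>K \<subset> span S\<close>])
    show "?H x \<subseteq> ?H x' \<or> ?H x' \<subseteq> ?H x" if "x \<in> {..a}" "x' \<in> {..a}" for x x'
      using that Hmono[of x x'] Hmono[of x' x] by (cases "x \<le> x'") auto
  qed (use subH HV S(2) in simp_all)
  then obtain W1 where W1: "subspace W1" "W1 \<subset> span S" "K \<subseteq> W1"
    "\<forall>x\<in>{..a}. {k + h | k h. k \<in> K \<and> h \<in> ?H x} = span S \<or> ?H x \<subseteq> W1" by auto
  have "\<exists>W. subspace W \<and> W \<subset> span S \<and> W1 \<subseteq> W \<and>
    (\<forall>y\<in>{..b}. {w + l | w l. w \<in> W1 \<and> l \<in> ?L y} = span S \<or> ?L y \<subseteq> W)"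
  proof (rule chain_common_proper[OF S(1) W1(1,2)])
    show "?L y \<subseteq> ?L y' \<or> ?L y' \<subseteq> ?L y" if "y \<in> {..b}" "y' \<in> {..b}" for y y'
      using that Lmono[of y y'] Lmono[of y' y] by (cases "y \<le> y'") auto
  qed (use subL LV S(2) in simp_all)
  then obtain W where W: "subspace W" "W \<subset> span S" "W1 \<subseteq> W"
    "\<forall>y\<in>{..b}. {w + l | w l. w \<in> W1 \<and> l \<in> ?L y} = span S \<or> ?L y \<subseteq> W" by auto
  have KW: "K \<subseteq> W" using W1(3) W(3) by (rule order_trans)
  \<comment> \<open>\<open>P\<close> consists of the columns whose image is everything at
    \<open>(a, b)\<close> modulo \<open>K\<close>, \<open>Q\<close> of the rows with this property
    modulo \<open>W1\<close>. Images from all other columns and rows fall into \<open>W\<close>.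
    Columns beyond \<open>a\<close> and rows beyond \<open>b\<close> belong by default, which makes
    both sets up-sets.\<close>
  define P where "P = {x. x \<le> a \<longrightarrow> V (a, b) \<subseteq> {k + h | k h. k \<in> K \<and> h \<in> ?H x}}"
  define Q where "Q = {y. y \<le> b \<longrightarrow> V (a, b) \<subseteq> {w + l | w l. w \<in> W1 \<and> l \<in> ?L y}}"
  have notP: "x < a" "?H x \<subseteq> W" if "x \<notin> P" for x
  proof -
    have le: "x \<le> a" "\<not> V (a, b) \<subseteq> {k + h | k h. k \<in> K \<and> h \<in> ?H x}" using that by (auto simp: P_def)
    have "?H x \<subseteq> W1" by (rule disjE[OF bspec[OF W1(4), of x]]) (use le S(2) in simp_all)
    then show "?H x \<subseteq> W" using W(3) by (rule order_trans)
    have "x \<noteq> a"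
    proof
      assume "x = a"
      have "V (a, b) \<subseteq> {k + h | k h. k \<in> K \<and> h \<in> ?H a}"
      proof
        fix v assume v: "v \<in> V (a, b)"
        then have "v = 0 + \<rho> (a, b) (a, b) v" by (simp add: map_refl)
        then show "v \<in> {k + h | k h. k \<in> K \<and> h \<in> ?H a}" using v subspace_0[OF K] by blast
      qed
      then show False using le \<open>x = a\<close> by simp
    qed
    then show "x < a" using le by simp
  qed
  have notQ: "y < b" "?L y \<subseteq> W" if "y \<notin> Q" for y
  proof -
    have le: "y \<le> b" "\<not> V (a, b) \<subseteq> {w + l | w l. w \<in> W1 \<and> l \<in> ?L y}" using that by (auto simp: Q_def)
    show "?L y \<subseteq> W" by (rule disjE[OF bspec[OF W(4), of y]]) (use le S(2) in simp_all)
    have "y \<noteq> b"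
    proof
      assume "y = b"
      have "V (a, b) \<subseteq> {w + l | w l. w \<in> W1 \<and> l \<in> ?L b}"
      proof
        fix v assume v: "v \<in> V (a, b)"
        then have "v = 0 + \<rho> (a, b) (a, b) v" by (simp add: map_refl)
        then show "v \<in> {w + l | w l. w \<in> W1 \<and> l \<in> ?L b}" using v subspace_0[OF W1(1)] by blast
      qed
      then show False using le \<open>y = b\<close> by simp
    qed
    then show "y < b" using le by simp
  qed
  have Pup: "x' \<in> P" if "x \<in> P" "x \<le> x'" for x x'
  proof (cases "x' \<le> a")
    case True
    then show ?thesis using that Hmono[of x x'] unfolding P_def by fastforce
  qed (simp add: P_def)
  have Qup: "y' \<in> Q" if "y \<in> Q" "y \<le> y'" for y y'
  proof (cases "y' \<le> b")
    case True
    then show ?thesis using that Lmono[of y y'] unfolding Q_def by fastforce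
  qed (simp add: Q_def)
  have aP: "a \<in> P" and bQ: "b \<in> Q" using notP(1)[of a] notQ(1)[of b] by auto
  define B where "B = P \<times> Q"
  have up: "u \<in> B" if "t \<le> u" "t \<in> B" for t u
    using that Pup[of "fst t" "fst u"] Qup[of "snd t" "snd u"] unfolding B_def
    by (auto simp: less_eq_prod_def mem_Times_iff)
  have dying: "dying_outside B t = V t" if "t \<in> B" for t
    using up that unfolding dying_outside_def by blast
  \<comment> \<open>Modulo \<open>W1\<close> a vector \<open>m\<close> comes from the row
    \<open>y\<close>, and modulo \<open>K\<close> that part comes from the column \<open>x\<close>.
    The error \<open>k\<close> in \<open>K\<close> is split by exactness into \<open>kv\<close>,
    which dies vertically and so comes from the column \<open>x\<close>, and \<open>k - kv\<close>,
    which dies horizontally and so comes from the row \<open>y\<close>. After moving these to the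
    proper side, \<open>h + kv\<close> comes from both, hence from \<open>(x, y)\<close>.\<close>
  have big: "\<not> \<rho> (x, y) (a, b) ` V (x, y) \<subseteq> W" if x: "x \<in> P" "x \<le> a" and y: "y \<in> Q" "y \<le> b" for x y
  proof
    assume sub: "\<rho> (x, y) (a, b) ` V (x, y) \<subseteq> W"
    have "m \<in> W" if m: "m \<in> V (a, b)" for m
    proof -
      have "m \<in> {w + l | w l. w \<in> W1 \<and> l \<in> ?L y}" using m y unfolding Q_def by blast
      then obtain w v where wv: "w \<in> W1" "v \<in> ?L y" "m = w + v" by blast
      then have "v \<in> V (a, b)" using LV[OF y(2)] by auto
      then have "v \<in> {k + h | k h. k \<in> K \<and> h \<in> ?H x}" using x unfolding P_def by blast
      then obtain k h where kh: "k \<in> K" "h \<in> ?H x" "v = k + h" by blast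
      obtain x' y' where k: "k \<in> V (a, b)" "a \<le> x'" "b \<le> y'" "\<rho> (a, b) (x', y') k = 0"
        using kh(1) unfolding K_def by auto
      have "\<rho> (x', b) (x', y') (\<rho> (a, b) (x', b) k) = 0" "\<rho> (a, b) (x', b) k \<in> V (x', b)"
        using k map_comp[of "(a, b)" "(x', b)" "(x', y')" k] map_in by simp_all
      then obtain kv where kv: "kv \<in> V (a, b)" "\<rho> (a, b) (x', b) kv = \<rho> (a, b) (x', b) k" "\<rho> (a, b) (a, y') kv = 0"
        using lift_horizontally[OF k(2,3)] by auto
      have kvH: "kv \<in> ?H x" using lift_horizontally[OF x(2) k(3) kv(1,3)] by blast
      have kd: "\<rho> (a, b) (x', b) (k - kv) = 0" "k - kv \<in> V (a, b)"
        using kv k by (simp_all add: map_diff diff_in)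
      have kL: "k - kv \<in> ?L y" using lift_vertically[OF k(2) y(2) kd(2,1)] by (metis imageI)
      have kK: "k - kv \<in> K" using KI[OF kd(2) k(2) order_refl kd(1)] .
      have eq: "v - (k - kv) = h + kv" using kh(3) by simp
      have "h + kv \<in> ?H x" by (rule subspace_add[OF subH[OF x(2)] kh(2) kvH])
      moreover have "h + kv \<in> ?L y" using subspace_diff[OF subL[OF y(2)] wv(2) kL] eq by simp
      ultimately have "h + kv \<in> W" using image_Int[OF x(2) y(2)] sub by auto
      moreover have "w \<in> W" "k - kv \<in> W" using wv(1) W(3) kK KW by auto
      ultimately have "w + (k - kv) + (h + kv) \<in> W" by (metis subspace_add W(1))
      moreover have "m = w + (k - kv) + (h + kv)" using wv(3) kh(3) by simp
      ultimately show ?thesis by (simp only:)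
    qed
    then show False using W(2) S(2) by auto
  qed
  let ?I = "{t \<in> B. t \<le> (a, b)}"
  \<comment> \<open>Some point of the block below \<open>(a, b)\<close> has the smallest image. By
    \<open>big\<close> it contains a vector outside \<open>W\<close>, and this vector comes from
    every point of the block below \<open>(a, b)\<close>.\<close>
  have "\<exists>k\<in>?I. \<forall>i\<in>?I. \<rho> k (a, b) ` V k \<subseteq> \<rho> i (a, b) ` V i"
  proof (rule least_subspace[where t = "(a, b)"])
    have "(a, b) \<in> ?I" using aP bQ by (simp add: B_def)
    then show "?I \<noteq> {}" by blast
    show "subspace (\<rho> i (a, b) ` V i)" if "i \<in> ?I" for i
      using that by (intro subspace_image_map subspace_V) auto
    show "\<rho> i (a, b) ` V i \<subseteq> V (a, b)" if "i \<in> ?I" for i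
      using that map_in[of i "(a, b)"] by auto
    show "\<exists>k\<in>?I. \<rho> k (a, b) ` V k \<subseteq> \<rho> i (a, b) ` V i \<and> \<rho> k (a, b) ` V k \<subseteq> \<rho> j (a, b) ` V j"
      if ij: "i \<in> ?I" "j \<in> ?I" for i j
    proof (intro bexI[of _ "inf i j"] conjI)
      have "inf i j \<in> B"
        using ij unfolding B_def by (auto simp: inf_prod_def inf_min min_def)
      then show "inf i j \<in> ?I" using ij by (auto intro: le_infI1)
      show "\<rho> (inf i j) (a, b) ` V (inf i j) \<subseteq> \<rho> i (a, b) ` V i"
        "\<rho> (inf i j) (a, b) ` V (inf i j) \<subseteq> \<rho> j (a, b) ` V j"
        by (intro image_map_mono; use ij in simp)+
    qed
  qed
  then obtain k where k: "k \<in> B" "k \<le> (a, b)" "\<forall>i\<in>?I. \<rho> k (a, b) ` V k \<subseteq> \<rho> i (a, b) ` V i" by auto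
  have "\<not> \<rho> k (a, b) ` V k \<subseteq> W" using k(1,2) big by (cases k) (simp add: B_def)
  then obtain z where z: "z \<in> \<rho> k (a, b) ` V k" "z \<notin> W" by blast
  have zV: "z \<in> V (a, b)" using z(1) map_in[OF k(2)] by auto
  have not_born: "\<rho> (a, b) (x', y') z \<notin> born_outside B (x', y')" if le: "a \<le> x'" "b \<le> y'" for x' y'
  proof
    assume bo: "\<rho> (a, b) (x', y') z \<in> born_outside B (x', y')"
    \<comment> \<open>Images from the columns outside \<open>P\<close> form a chain, and so do those
      from the rows outside \<open>Q\<close>. Hence a vector born outside the block is a sum of one
      vector from each side. Exactness pulls the summands back to \<open>(a, b)\<close>, up to an
      error in \<open>K\<close>, so \<open>z\<close> would lie in \<open>W\<close>.\<close>
    let ?H' = "{0} \<union> (\<Union>x\<in>-P. \<rho> (x, y') (x', y') ` V (x, y'))"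
    let ?L' = "{0} \<union> (\<Union>y\<in>-Q. \<rho> (x', y) (x', y') ` V (x', y))"
    have Plt: "x < x'" if "x \<in> - P" for x using notP(1)[of x] that le by simp
    have Qlt: "y < y'" if "y \<in> - Q" for y using notQ(1)[of y] that le by simp
    have "subspace ?H'"
    proof (rule subspace_chain_Union)
      show "subspace (\<rho> (x, y') (x', y') ` V (x, y'))" if "x \<in> - P" for x
        using Plt[OF that] by (intro subspace_image_map subspace_V) auto
      show "\<rho> (x, y') (x', y') ` V (x, y') \<subseteq> \<rho> (w, y') (x', y') ` V (w, y') \<or>
          \<rho> (w, y') (x', y') ` V (w, y') \<subseteq> \<rho> (x, y') (x', y') ` V (x, y')" if "x \<in> - P" "w \<in> - P" for x w
        using Plt[OF that(1)] Plt[OF that(2)] image_map_mono[of "(x, y')" "(w, y')" "(x', y')"]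
          image_map_mono[of "(w, y')" "(x, y')" "(x', y')"] by (cases "x \<le> w") auto
    qed
    moreover have "subspace ?L'"
    proof (rule subspace_chain_Union)
      show "subspace (\<rho> (x', y) (x', y') ` V (x', y))" if "y \<in> - Q" for y
        using Qlt[OF that] by (intro subspace_image_map subspace_V) auto
      show "\<rho> (x', y) (x', y') ` V (x', y) \<subseteq> \<rho> (x', w) (x', y') ` V (x', w) \<or>
          \<rho> (x', w) (x', y') ` V (x', w) \<subseteq> \<rho> (x', y) (x', y') ` V (x', y)" if "y \<in> - Q" "w \<in> - Q" for y w
        using Qlt[OF that(1)] Qlt[OF that(2)] image_map_mono[of "(x', y)" "(x', w)" "(x', y')"]
          image_map_mono[of "(x', w)" "(x', y)" "(x', y')"] by (cases "y \<le> w") auto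
    qed
    ultimately have sub: "subspace {\<alpha> + \<beta> | \<alpha> \<beta>. \<alpha> \<in> ?H' \<and> \<beta> \<in> ?L'}" by (rule subspace_sums)
    have "born_outside B (x', y') \<subseteq> {\<alpha> + \<beta> | \<alpha> \<beta>. \<alpha> \<in> ?H' \<and> \<beta> \<in> ?L'}"
      unfolding born_outside_def
    proof (rule span_minimal[OF _ sub], rule subsetI)
      fix v assume "v \<in> {\<rho> u (x', y') m | u m. u \<le> (x', y') \<and> u \<notin> B \<and> m \<in> V u}"
      then obtain x y m where v: "x \<le> x'" "y \<le> y'" "(x, y) \<notin> B" "m \<in> V (x, y)" "v = \<rho> (x, y) (x', y') m"
        by auto
      from v(3) consider "x \<notin> P" | "y \<notin> Q" by (auto simp: B_def)
      then have "v \<in> ?H' \<or> v \<in> ?L'"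
      proof cases
        case 1
        have "v \<in> \<rho> (x, y') (x', y') ` V (x, y')"
          using image_map_mono[of "(x, y)" "(x, y')" "(x', y')"] v by auto
        then show ?thesis using 1 by blast
      next
        case 2
        have "v \<in> \<rho> (x', y) (x', y') ` V (x', y)"
          using image_map_mono[of "(x, y)" "(x', y)" "(x', y')"] v by auto
        then show ?thesis using 2 by blast
      qed
      then have "\<exists>\<alpha> \<beta>. v = \<alpha> + \<beta> \<and> \<alpha> \<in> ?H' \<and> \<beta> \<in> ?L'"
        by (elim disjE) (rule exI[of _ v], rule exI[of _ 0], simp, rule exI[of _ 0], rule exI[of _ v], simp)
      then show "v \<in> {\<alpha> + \<beta> | \<alpha> \<beta>. \<alpha> \<in> ?H' \<and> \<beta> \<in> ?L'}" by simp
    qed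
    then obtain \<alpha> \<beta> where ab: "\<rho> (a, b) (x', y') z = \<alpha> + \<beta>" "\<alpha> \<in> ?H'" "\<beta> \<in> ?L'" using bo by blast
    from ab(2) consider "\<alpha> = 0" | x c where "x \<notin> P" "c \<in> V (x, y')" "\<alpha> = \<rho> (x, y') (x', y') c" by auto
    then have "z \<in> W"
    proof cases
      case 1
      from ab(3) consider "\<beta> = 0" | y d where "y \<notin> Q" "d \<in> V (x', y)" "\<beta> = \<rho> (x', y) (x', y') d" by auto
      then show ?thesis
      proof cases
        case 1
        then show ?thesis using ab(1) \<open>\<alpha> = 0\<close> KI[OF zV le] KW by auto
      next
        case (2 y d)
        have yb: "y \<le> b" using notQ(1)[OF 2(1)] by simp
        have yy: "y \<le> y'" using yb le by simp
        have "\<rho> (a, y') (x', y') (\<rho> (a, b) (a, y') z) = \<rho> (x', y) (x', y') d"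
          using ab(1) 1 2 map_comp[of "(a, b)" "(a, y')" "(x', y')" z] zV le by simp
        then obtain g where g: "g \<in> V (a, y)" "\<rho> (a, y) (a, y') g = \<rho> (a, b) (a, y') z"
          using exact[OF le(1) yy 2(2), of "\<rho> (a, b) (a, y') z"] zV le map_in[of "(a, b)" "(a, y')" z] by auto
        have gV: "\<rho> (a, y) (a, b) g \<in> V (a, b)" using g yb map_in by simp
        have "\<rho> (a, b) (a, y') (z - \<rho> (a, y) (a, b) g) = 0"
          using g gV zV yb le map_comp[of "(a, y)" "(a, b)" "(a, y')" g] by (simp add: map_diff)
        then have "z - \<rho> (a, y) (a, b) g \<in> K" using KI[OF diff_in[OF zV gV] order_refl le(2)] by simp
        moreover have "\<rho> (a, y) (a, b) g \<in> W" using notQ(2)[OF 2(1)] g by auto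
        ultimately have "z - \<rho> (a, y) (a, b) g + \<rho> (a, y) (a, b) g \<in> W" using KW W(1) by (intro subspace_add) auto
        then show ?thesis by simp
      qed
    next
      case (2 x c)
      have xa: "x \<le> a" using notP(1)[OF 2(1)] by simp
      have xx: "x \<le> x'" using xa le by simp
      from ab(3) consider "\<beta> = 0" | y d where "y \<notin> Q" "d \<in> V (x', y)" "\<beta> = \<rho> (x', y) (x', y') d" by auto
      then show ?thesis
      proof cases
        case 1
        have "\<rho> (x', b) (x', y') (\<rho> (a, b) (x', b) z) = \<rho> (x, y') (x', y') c"
          using ab(1) 1 2 map_comp[of "(a, b)" "(x', b)" "(x', y')" z] zV le by simp
        then obtain e where e: "e \<in> V (x, b)" "\<rho> (x, b) (x', b) e = \<rho> (a, b) (x', b) z"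
          using exact[OF xx le(2) _ 2(2), of "\<rho> (a, b) (x', b) z"] zV le map_in[of "(a, b)" "(x', b)" z] by auto
        have eV: "\<rho> (x, b) (a, b) e \<in> V (a, b)" using e xa map_in by simp
        have "\<rho> (a, b) (x', b) (z - \<rho> (x, b) (a, b) e) = 0"
          using e eV zV xa le map_comp[of "(x, b)" "(a, b)" "(x', b)" e] by (simp add: map_diff)
        then have "z - \<rho> (x, b) (a, b) e \<in> K" using KI[OF diff_in[OF zV eV] le(1) order_refl] by simp
        moreover have "\<rho> (x, b) (a, b) e \<in> W" using notP(2)[OF 2(1)] e by auto
        ultimately have "z - \<rho> (x, b) (a, b) e + \<rho> (x, b) (a, b) e \<in> W" using KW W(1) by (intro subspace_add) auto
        then show ?thesis by simp
      next
        case (2 y d)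
        have yb: "y \<le> b" using notQ(1)[OF 2(1)] by simp
        \<comment> \<open>The row part is removed first, at \<open>(x', b)\<close>: what remains
          agrees at \<open>(x', y')\<close> with a vector from the column \<open>x\<close>, so it
          comes from some \<open>e\<close> in that column. Then the image of \<open>z\<close> minus
          that of \<open>e\<close> comes from the row \<open>y\<close> at \<open>(x', b)\<close>,
          and by exactness already at \<open>(a, b)\<close>.\<close>
        define \<delta> where "\<delta> = \<rho> (a, b) (x', b) z - \<rho> (x', y) (x', b) d"
        have dV: "\<rho> (x', y) (x', b) d \<in> V (x', b)" using 2(2) yb map_in by simp
        have zx: "\<rho> (a, b) (x', b) z \<in> V (x', b)" using zV le map_in by simp
        have "\<rho> (x', b) (x', y') \<delta> = \<rho> (a, b) (x', y') z - \<beta>"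
          unfolding \<delta>_def using zV zx dV 2 le yb map_comp[of "(a, b)" "(x', b)" "(x', y')" z]
            map_comp[of "(x', y)" "(x', b)" "(x', y')" d] by (simp add: map_diff)
        also have "\<dots> = \<rho> (x, y') (x', y') c" using ab(1) \<open>\<alpha> = \<rho> (x, y') (x', y') c\<close> by simp
        finally obtain e where e: "e \<in> V (x, b)" "\<rho> (x, b) (x', b) e = \<delta>"
          using exact[OF xx le(2) _ \<open>c \<in> V (x, y')\<close>, of \<delta>] diff_in[OF zx dV] unfolding \<delta>_def by auto
        have eV: "\<rho> (x, b) (a, b) e \<in> V (a, b)" using e xa map_in by simp
        have "\<rho> (a, b) (x', b) (z - \<rho> (x, b) (a, b) e) = \<rho> (x', y) (x', b) d"
          using e eV zV xa le map_comp[of "(x, b)" "(a, b)" "(x', b)" e] by (simp add: map_diff \<delta>_def)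
        then obtain g where g: "g \<in> V (a, y)" "\<rho> (a, y) (a, b) g = z - \<rho> (x, b) (a, b) e"
          using exact[OF le(1) yb 2(2) diff_in[OF zV eV]] by auto
        have "\<rho> (a, y) (a, b) g \<in> W" using notQ(2)[OF 2(1)] g(1) by blast
        moreover have "\<rho> (x, b) (a, b) e \<in> W" using notP(2)[OF \<open>x \<notin> P\<close>] e(1) by blast
        ultimately have "\<rho> (a, y) (a, b) g + \<rho> (x, b) (a, b) e \<in> W" using W(1) by (intro subspace_add)
        then show ?thesis using g(2) by simp
      qed
    qed
    then show False using z(2) by simp
  qed
  have "\<exists>\<zeta>. block_section B \<zeta> \<and> (\<forall>t\<in>B. \<zeta> t \<notin> born_outside B t)"
  proof (rule lift_to_section[OF B_def])
    show "(a, b) \<in> B" using aP bQ by (simp add: B_def)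
    show "z \<in> \<rho> t (a, b) ` dying_outside B t" if "t \<in> B" "t \<le> (a, b)" for t
    proof -
      have "\<rho> k (a, b) ` V k \<subseteq> \<rho> t (a, b) ` V t" using bspec[OF k(3), of t] that by simp
      then show ?thesis using z(1) dying[OF that(1)] by auto
    qed
    show "\<rho> (a, b) t z \<notin> born_outside B t" if "t \<in> B" "(a, b) \<le> t" for t
      using not_born that by (cases t) simp
  qed (rule zV)
  moreover have "block B" unfolding B_def
  proof (rule birth_quadrantI)
    show "P \<times> Q \<noteq> {}" using aP bQ by auto
  qed (use Pup Qup in auto)
  ultimately show ?thesis by blast
qed

text \<open>A vector that dies vertically extends to the left by exactness, so only its vertical
  extent has to be optimised: \<open>z\<close> dies as early as possible and, among such vectors,
  comes from as far down as possible. By \<open>young\<close> some row does not reach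
  \<open>z\<close>, which also keeps \<open>z\<close> from dying horizontally.\<close>

lemma horizontal_band_section:
  assumes z0: "z0 \<in> V (a, b)" "z0 \<noteq> 0" "b \<le> y0" "\<rho> (a, b) (a, y0) z0 = 0"
    and young: "\<And>z. z \<in> V (a, b) \<Longrightarrow>
      (\<And>x y. x \<le> a \<Longrightarrow> y \<le> b \<Longrightarrow> z \<in> \<rho> (x, y) (a, b) ` V (x, y)) \<Longrightarrow> z = 0"
  shows "\<exists>B \<zeta>. horizontal_band B \<and> block_section B \<zeta> \<and> (\<forall>t\<in>B. \<zeta> t \<notin> born_outside B t)"
proof -
  let ?K = "\<lambda>y. {z \<in> V (a, b). \<rho> (a, b) (a, y) z = 0}"
  let ?L = "\<lambda>y. \<rho> (a, y) (a, b) ` V (a, y)"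
  obtain S where S: "finite S" "V (a, b) = span S" using finite_dim by blast
  have Lmono: "?L y \<subseteq> ?L y'" if "y \<le> y'" "y' \<le> b" for y y' using that by (intro image_map_mono) auto
  have "\<exists>z\<in>V (a, b). z \<noteq> 0 \<and> (\<forall>y\<in>{b..}. (\<exists>w\<in>V (a, b). w \<noteq> 0 \<and> w \<in> ?K y) \<longrightarrow> z \<in> ?K y)"
  proof (rule chain_common_nonzero[OF S(1) subspace_V _ z0(1,2)])
    show "?K y \<subseteq> ?K y' \<or> ?K y' \<subseteq> ?K y" if "y \<in> {b..}" "y' \<in> {b..}" for y y'
      using that by (intro kernel_map_chain) auto
    show "V (a, b) \<subseteq> span S" using S(2) by simp
    show "subspace (?K y)" if "y \<in> {b..}" for y using that by (intro subspace_kernel_map) auto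
  qed
  then obtain z1 where z1: "z1 \<in> V (a, b)" "z1 \<noteq> 0"
    "\<forall>y\<in>{b..}. (\<exists>w\<in>V (a, b). w \<noteq> 0 \<and> w \<in> ?K y) \<longrightarrow> z1 \<in> ?K y" by auto
  define Q where "Q = {y. b \<le> y \<and> (\<exists>w\<in>V (a, b). w \<noteq> 0 \<and> \<rho> (a, b) (a, y) w = 0)}"
  define Z where "Z = V (a, b) \<inter> (\<Inter>y\<in>Q. ?K y)"
  have Z: "subspace Z" unfolding Z_def
    by (intro subspace_inter subspace_V subspace_Int subspace_kernel_map) (auto simp: Q_def)
  have z1Z: "z1 \<in> Z" using z1 unfolding Z_def Q_def by auto
  have "\<exists>z\<in>Z. z \<noteq> 0 \<and> (\<forall>y\<in>{..b}. (\<exists>w\<in>Z. w \<noteq> 0 \<and> w \<in> ?L y) \<longrightarrow> z \<in> ?L y)"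
  proof (rule chain_common_nonzero[OF S(1) Z _ z1Z z1(2)])
    show "?L y \<subseteq> ?L y' \<or> ?L y' \<subseteq> ?L y" if "y \<in> {..b}" "y' \<in> {..b}" for y y'
      using that Lmono[of y y'] Lmono[of y' y] by (cases "y \<le> y'") auto
    show "Z \<subseteq> span S" using S(2) unfolding Z_def by auto
    show "subspace (?L y)" if "y \<in> {..b}" for y using that by (intro subspace_image_map subspace_V) auto
  qed
  then obtain z where z: "z \<in> Z" "z \<noteq> 0" "\<forall>y\<in>{..b}. (\<exists>w\<in>Z. w \<noteq> 0 \<and> w \<in> ?L y) \<longrightarrow> z \<in> ?L y" by auto
  \<comment> \<open>Rows above \<open>b\<close> are included so that \<open>P\<close> is an up-set
    and \<open>P - Q\<close> is the vertical extent of the band.\<close>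
  define P where "P = {y. y \<le> b \<longrightarrow> z \<in> ?L y}"
  have zV: "z \<in> V (a, b)" using z(1) unfolding Z_def by auto
  have zQ: "\<rho> (a, b) (a, y) z = 0" if "y \<in> Q" for y using z(1) that unfolding Z_def by auto
  have Qge: "b \<le> y" if "y \<in> Q" for y using that by (simp add: Q_def)
  have Qup: "y' \<in> Q" if "y \<in> Q" "y \<le> y'" for y y'
  proof -
    obtain w where w: "b \<le> y" "w \<in> V (a, b)" "w \<noteq> 0" "\<rho> (a, b) (a, y) w = 0" using \<open>y \<in> Q\<close> by (auto simp: Q_def)
    then have "\<rho> (a, b) (a, y') w = 0"
      using dies_mono[of "(a, b)" "(a, y)" "(a, y')" w] \<open>y \<le> y'\<close> by simp
    then show ?thesis using w \<open>y \<le> y'\<close> by (auto simp: Q_def)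
  qed
  have Pup: "y' \<in> P" if "y \<in> P" "y \<le> y'" for y y'
  proof (cases "y' \<le> b")
    case True
    then show ?thesis using that Lmono[of y y'] unfolding P_def by auto
  qed (simp add: P_def)
  have "Q \<noteq> {}" using z0 unfolding Q_def by auto
  have "z \<in> ?L b" using map_refl[OF zV] zV by (metis imageI)
  then have bP: "b \<in> P" by (simp add: P_def)
  have bQ: "b \<notin> Q" using map_refl unfolding Q_def by auto
  define B where "B = (UNIV :: real set) \<times> (P - Q)"
  have lift: "\<exists>c\<in>V (x, y). \<rho> (x, y) (a, b) c = z \<and> (\<forall>y'\<in>Q. \<rho> (x, y) (x, y') c = 0)"
    if x: "x \<le> a" and y: "y \<in> P" "y \<le> b" for x y
  proof -
    obtain c1 where c1: "c1 \<in> V (a, y)" "\<rho> (a, y) (a, b) c1 = z" using y unfolding P_def by auto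
    obtain y1 where y1: "y1 \<in> Q" "\<And>y' c. y' \<in> Q \<Longrightarrow> c \<in> V (x, y) \<Longrightarrow> \<rho> (x, y) (x, y1) c = 0 \<Longrightarrow> \<rho> (x, y) (x, y') c = 0"
      by (rule earliest_vertical_death[OF \<open>Q \<noteq> {}\<close> order_trans[OF y(2) Qge]]) iprover+
    have "\<rho> (a, y) (a, y1) c1 = 0"
      using map_comp[of "(a, y)" "(a, b)" "(a, y1)" c1] c1 y(2) Qge[OF y1(1)] zQ[OF y1(1)] by simp
    then obtain c where c: "c \<in> V (x, y)" "\<rho> (x, y) (a, y) c = c1" "\<rho> (x, y) (x, y1) c = 0"
      using lift_horizontally[of x a y y1 c1] c1 x y(2) Qge[OF y1(1)] by auto
    have "\<rho> (x, y) (a, b) c = z" using map_comp[of "(x, y)" "(a, y)" "(a, b)" c] c c1 x y(2) by simp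
    then show ?thesis using c y1(2) by blast
  qed
  have "\<exists>y. y \<notin> P"
  proof (rule ccontr)
    assume "\<not> ?thesis"
    then have "z \<in> \<rho> (x, y) (a, b) ` V (x, y)" if "x \<le> a" "y \<le> b" for x y
      using lift[of x y] that by blast
    then show False using young[OF zV] z(2) by blast
  qed
  then obtain y\<^sub>0 where y\<^sub>0: "y\<^sub>0 \<notin> P" by auto
  have dying: "z \<in> \<rho> (x, y) (a, b) ` dying_outside B (x, y)" if "x \<le> a" "y \<in> P" "y \<le> b" for x y
  proof -
    obtain c where c: "c \<in> V (x, y)" "\<rho> (x, y) (a, b) c = z" "\<And>y'. y' \<in> Q \<Longrightarrow> \<rho> (x, y) (x, y') c = 0"
      using lift[OF \<open>x \<le> a\<close> \<open>y \<in> P\<close> \<open>y \<le> b\<close>] by auto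
    have "\<rho> (x, y) (x', y') c = 0" if "x \<le> x'" "y \<le> y'" "(x', y') \<notin> B" for x' y'
    proof -
      have "y' \<in> Q" using that(2,3) Pup[OF \<open>y \<in> P\<close>] unfolding B_def by auto
      then show ?thesis using dies_mono[of "(x, y)" "(x, y')" "(x', y')" c] c that by simp
    qed
    then have "c \<in> dying_outside B (x, y)" using c(1) unfolding dying_outside_def by auto
    then show ?thesis using c(2) by blast
  qed
  have not_born: "\<rho> (a, b) (x', y') z \<notin> born_outside B (x', y')" if le: "a \<le> x'" "b \<le> y'" and yQ: "y' \<notin> Q" for x' y'
  proof
    assume bo: "\<rho> (a, b) (x', y') z \<in> born_outside B (x', y')"
    let ?L' = "{0} \<union> (\<Union>y\<in>-P. \<rho> (x', y) (x', y') ` V (x', y))"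
    have Plt: "y < b" if "y \<in> - P" for y
      using that bP by (cases "y = b") (auto simp: P_def)
    have sub: "subspace ?L'"
    proof (rule subspace_chain_Union)
      show "subspace (\<rho> (x', y) (x', y') ` V (x', y))" if "y \<in> - P" for y
        using Plt[OF that] le by (intro subspace_image_map subspace_V) auto
      show "\<rho> (x', y) (x', y') ` V (x', y) \<subseteq> \<rho> (x', w) (x', y') ` V (x', w) \<or>
          \<rho> (x', w) (x', y') ` V (x', w) \<subseteq> \<rho> (x', y) (x', y') ` V (x', y)" if "y \<in> - P" "w \<in> - P" for y w
        using Plt[OF that(1)] Plt[OF that(2)] le image_map_mono[of "(x', y)" "(x', w)" "(x', y')"]
          image_map_mono[of "(x', w)" "(x', y)" "(x', y')"] by (cases "y \<le> w") auto
    qed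
    have "born_outside B (x', y') \<subseteq> ?L'"
      unfolding born_outside_def
    proof (rule span_minimal[OF _ sub], rule subsetI)
      fix v assume "v \<in> {\<rho> u (x', y') m | u m. u \<le> (x', y') \<and> u \<notin> B \<and> m \<in> V u}"
      then obtain x y m where v: "x \<le> x'" "y \<le> y'" "(x, y) \<notin> B" "m \<in> V (x, y)" "v = \<rho> (x, y) (x', y') m"
        by auto
      have "y \<notin> P" using v(2,3) yQ Qup[of y y'] unfolding B_def by auto
      moreover have "v \<in> \<rho> (x', y) (x', y') ` V (x', y)"
        using image_map_mono[of "(x, y)" "(x', y)" "(x', y')"] v by auto
      ultimately show "v \<in> ?L'" by blast
    qed
    then have "\<rho> (a, b) (x', y') z \<in> ?L'" using bo by blast
    then consider "\<rho> (a, b) (x', y') z = 0" | y d where "y \<notin> P" "d \<in> V (x', y)" "\<rho> (a, b) (x', y') z = \<rho> (x', y) (x', y') d"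
      by auto
    then obtain y d where d: "y \<notin> P" "d \<in> V (x', y)" "\<rho> (a, b) (x', y') z = \<rho> (x', y) (x', y') d"
    proof cases
      \<comment> \<open>A vanishing image counts as the image of 0 from the row
        \<open>y\<^sub>0\<close> outside \<open>P\<close>, so that both cases can be treated
        together.\<close>
      case 1
      have "(x', y\<^sub>0) \<le> (x', y')" using Plt[of y\<^sub>0] y\<^sub>0 le by simp
      then show ?thesis using that[OF y\<^sub>0 zero_in] 1 map_zero by simp
    qed (use that in blast)
    have yb: "y \<le> b" using Plt[of y] d(1) by simp
    \<comment> \<open>\<open>\<kappa>\<close> dies at height \<open>y'\<close>, so it lifts to a
      vector at \<open>(a, b)\<close> that dies at the same height. As \<open>y'\<close> is not in
      \<open>Q\<close>, that vector is 0, and the image of \<open>z\<close> at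
      \<open>(x', b)\<close> comes from the row \<open>y\<close>; exactness carries this back to
      \<open>z\<close>, against \<open>y \<notin> P\<close>.\<close>
    define \<kappa> where "\<kappa> = \<rho> (a, b) (x', b) z - \<rho> (x', y) (x', b) d"
    have dV: "\<rho> (x', y) (x', b) d \<in> V (x', b)" using d(2) yb map_in by simp
    have zx: "\<rho> (a, b) (x', b) z \<in> V (x', b)" using zV le map_in by simp
    have "\<rho> (x', b) (x', y') \<kappa> = 0"
      unfolding \<kappa>_def using zV zx dV d le yb map_comp[of "(a, b)" "(x', b)" "(x', y')" z]
        map_comp[of "(x', y)" "(x', b)" "(x', y')" d] by (simp add: map_diff)
    then obtain c where c: "c \<in> V (a, b)" "\<rho> (a, b) (x', b) c = \<kappa>" "\<rho> (a, b) (a, y') c = 0"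
      using lift_horizontally[OF le, of \<kappa>] diff_in[OF zx dV] unfolding \<kappa>_def by auto
    have "c = 0" using c yQ le unfolding Q_def by auto
    then have "\<kappa> = 0" using c(2) le map_zero by simp
    then have "\<rho> (x', y) (x', b) d = \<rho> (a, b) (x', b) z" by (simp add: \<kappa>_def)
    then obtain g where g: "g \<in> V (a, y)" "\<rho> (a, y) (a, b) g = z"
      using exact[OF le(1) yb d(2) zV] by auto
    then show False using d(1) unfolding P_def by blast
  qed
  have "\<exists>\<zeta>. block_section B \<zeta> \<and> (\<forall>t\<in>B. \<zeta> t \<notin> born_outside B t)"
  proof (rule lift_to_section[OF B_def])
    show "(a, b) \<in> B" using bP bQ by (simp add: B_def)
    show "z \<in> \<rho> t (a, b) ` dying_outside B t" if "t \<in> B" "t \<le> (a, b)" for t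
      using dying that by (cases t) (simp add: B_def)
    show "\<rho> (a, b) t z \<notin> born_outside B t" if "t \<in> B" "(a, b) \<le> t" for t
      using not_born that by (cases t) (simp add: B_def)
  qed (rule zV)
  moreover have "horizontal_band B" unfolding B_def
    by (rule horizontal_bandI[OF Pup Qup]) (use bP bQ in auto)
  ultimately show ?thesis by blast
qed

section \<open>Vertical bands by reflection in the diagonal\<close>

lemma transpose: "exact_module (*s) (\<lambda>t. V (prod.swap t)) (\<lambda>s t. \<rho> (prod.swap s) (prod.swap t))"
proof unfold_locales
  have le: "s \<le> t \<Longrightarrow> prod.swap s \<le> prod.swap t" for s t :: "real \<times> real"
    by (simp add: less_eq_prod_def)
  show "subspace (V (prod.swap t))" for t by (rule subspace_V)
  show "\<exists>S. finite S \<and> V (prod.swap t) = span S" for t by (rule finite_dim)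
  fix s t u :: "real \<times> real" and x y c
  show "\<rho> (prod.swap t) (prod.swap t) x = x" if "x \<in> V (prod.swap t)" using that by (rule map_refl)
  assume st: "s \<le> t" and x: "x \<in> V (prod.swap s)"
  show "\<rho> (prod.swap s) (prod.swap t) x \<in> V (prod.swap t)" using map_in[OF le[OF st] x] .
  show "\<rho> (prod.swap s) (prod.swap t) (c *s x) = c *s \<rho> (prod.swap s) (prod.swap t) x" using map_scale[OF le[OF st] x] .
  show "\<rho> (prod.swap t) (prod.swap u) (\<rho> (prod.swap s) (prod.swap t) x) = \<rho> (prod.swap s) (prod.swap u) x" if "t \<le> u"
    using map_comp[OF le[OF st] le[OF that] x] .
  show "\<rho> (prod.swap s) (prod.swap t) (x + y) = \<rho> (prod.swap s) (prod.swap t) x + \<rho> (prod.swap s) (prod.swap t) y"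
    if "y \<in> V (prod.swap s)" using map_add[OF le[OF st] x that] .
next
  fix x x' y y' a b
  assume *: "x \<le> x'" "y \<le> y'" "a \<in> V (prod.swap (x', y))" "b \<in> V (prod.swap (x, y'))"
    "\<rho> (prod.swap (x', y)) (prod.swap (x', y')) a = \<rho> (prod.swap (x, y')) (prod.swap (x', y')) b"
  show "\<exists>c\<in>V (prod.swap (x, y)). \<rho> (prod.swap (x, y)) (prod.swap (x', y)) c = a \<and>
      \<rho> (prod.swap (x, y)) (prod.swap (x, y')) c = b"
    using exact[OF *(2,1), of b a] *(3-5) by auto
qed

lemma vertical_band_section:
  assumes z0: "z0 \<in> V (a, b)" "z0 \<noteq> 0" "a \<le> x0" "\<rho> (a, b) (x0, b) z0 = 0"
    and young: "\<And>z. z \<in> V (a, b) \<Longrightarrow>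
      (\<And>x y. x \<le> a \<Longrightarrow> y \<le> b \<Longrightarrow> z \<in> \<rho> (x, y) (a, b) ` V (x, y)) \<Longrightarrow> z = 0"
  shows "\<exists>B \<zeta>. vertical_band B \<and> block_section B \<zeta> \<and> (\<forall>t\<in>B. \<zeta> t \<notin> born_outside B t)"
proof -
  interpret T: exact_module "(*s)" "\<lambda>t. V (prod.swap t)" "\<lambda>s t. \<rho> (prod.swap s) (prod.swap t)"
    by (rule transpose)
  have "\<exists>B \<zeta>. horizontal_band B \<and> T.block_section B \<zeta> \<and> (\<forall>t\<in>B. \<zeta> t \<notin> T.born_outside B t)"
  proof (rule T.horizontal_band_section[of z0 b a x0])
    show "z = 0" if "z \<in> V (prod.swap (b, a))"
      "\<And>x y. x \<le> b \<Longrightarrow> y \<le> a \<Longrightarrow> z \<in> \<rho> (prod.swap (x, y)) (prod.swap (b, a)) ` V (prod.swap (x, y))" for z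
      using young[of z] that by simp
  qed (use z0 in simp_all)
  then obtain B \<zeta> where B: "horizontal_band B" "T.block_section B \<zeta>" "\<And>t. t \<in> B \<Longrightarrow> \<zeta> t \<notin> T.born_outside B t"
    by blast
  define B' where "B' = prod.swap -` B"
  define \<zeta>' where "\<zeta>' t = \<zeta> (prod.swap t)" for t
  have le: "prod.swap s \<le> prod.swap t \<longleftrightarrow> s \<le> t" for s t :: "real \<times> real"
    by (auto simp: less_eq_prod_def)
  have "block_section B' \<zeta>'"
    unfolding block_section_def
  proof (intro conjI allI impI)
    show "\<zeta>' t \<in> V t" for t using B(2) unfolding T.block_section_def \<zeta>'_def by (metis swap_swap)
    show "\<zeta>' t \<noteq> 0 \<longleftrightarrow> t \<in> B'" for t using B(2) unfolding T.block_section_def \<zeta>'_def B'_def by (metis vimage_eq)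
    show "\<rho> s t (\<zeta>' s) = \<zeta>' t" if "s \<le> t" "s \<in> B'" for s t
      using B(2) that le[of s t] unfolding T.block_section_def \<zeta>'_def B'_def by (metis swap_swap vimageE)
  qed
  moreover have "born_outside B' t = T.born_outside B (prod.swap t)" for t
  proof -
    have "{\<rho> u t x | u x. u \<le> t \<and> u \<notin> B' \<and> x \<in> V u} =
        {\<rho> (prod.swap u) (prod.swap (prod.swap t)) x | u x. u \<le> prod.swap t \<and> u \<notin> B \<and> x \<in> V (prod.swap u)}"
      (is "?X = ?Y")
    proof (intro antisym subsetI)
      fix v assume "v \<in> ?X"
      then obtain u x where "v = \<rho> u t x" "u \<le> t" "u \<notin> B'" "x \<in> V u" by blast
      then show "v \<in> ?Y"
        using le[of u t] unfolding B'_def by (intro CollectI exI[of _ "prod.swap u"] exI[of _ x]) simp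
    next
      fix v assume "v \<in> ?Y"
      then obtain u x where "v = \<rho> (prod.swap u) t x" "u \<le> prod.swap t" "u \<notin> B" "x \<in> V (prod.swap u)" by auto
      then show "v \<in> ?X"
        using le[of "prod.swap u" t] unfolding B'_def by (intro CollectI exI[of _ "prod.swap u"] exI[of _ x]) simp
    qed
    then show ?thesis unfolding born_outside_def T.born_outside_def by simp
  qed
  ultimately show ?thesis
    using B(1,3) vertical_band_swap[OF B(1)] unfolding \<zeta>'_def B'_def by (intro exI[of _ "prod.swap -` B"]) auto
qed

theorem exists_block_section:
  assumes v: "v \<in> V s" "v \<noteq> 0"
  shows "\<exists>B \<zeta>. block B \<and> block_section B \<zeta> \<and> (\<forall>t\<in>B. \<zeta> t \<notin> born_outside B t)"
proof -
  obtain a b where s: "s = (a, b)" by (cases s)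
  consider (death) z where "z \<in> V (a, b)" "z \<noteq> 0" "\<And>x y. x \<le> a \<Longrightarrow> y \<le> b \<Longrightarrow> z \<in> \<rho> (x, y) (a, b) ` V (x, y)"
    | (birth) "\<And>x y. a \<le> x \<Longrightarrow> b \<le> y \<Longrightarrow> \<rho> (a, b) (x, y) v \<noteq> 0"
    | (band) x y where "a \<le> x" "b \<le> y" "\<rho> (a, b) (x, y) v = 0"
      "\<And>z. z \<in> V (a, b) \<Longrightarrow> (\<And>x y. x \<le> a \<Longrightarrow> y \<le> b \<Longrightarrow> z \<in> \<rho> (x, y) (a, b) ` V (x, y)) \<Longrightarrow> z = 0"
    by metis
  then show ?thesis
  proof cases
    case death
    then show ?thesis by (rule death_section)
  next
    case birth
    then show ?thesis using v(1) s by (intro birth_section) auto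
  next
    case band
    show ?thesis
    proof (cases "\<rho> (a, b) (x, b) v = 0")
      case True
      then show ?thesis using vertical_band_section[of v a b x] band v s unfolding block_def by blast
    next
      case False
      have "\<rho> (x, b) (x, y) (\<rho> (a, b) (x, b) v) = 0" "\<rho> (a, b) (x, b) v \<in> V (x, b)"
        using band v s map_comp[of "(a, b)" "(x, b)" "(x, y)" v] map_in by simp_all
      \<comment> \<open>\<open>v\<close> is the sum of \<open>c\<close>, which dies vertically, and
        \<open>v - c\<close>, which dies horizontally. Since \<open>v\<close> itself does not die
        horizontally, \<open>c\<close> is nonzero and starts a horizontal band.\<close>
      then obtain c where c: "c \<in> V (a, b)" "\<rho> (a, b) (x, b) c = \<rho> (a, b) (x, b) v" "\<rho> (a, b) (a, y) c = 0"
        using lift_horizontally[OF band(1,2)] by auto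
      have "c \<noteq> 0" using c(2) False map_zero band(1) by force
      then show ?thesis using horizontal_band_section[of c a b y] band c unfolding block_def by blast
    qed
  qed
qed

end

section \<open>Existence of a decomposition\<close>

context persistence_module
begin

text \<open>Zero is dropped because an independent set cannot contain it. A set also forgets
  repetitions, hence the injectivity clause that accompanies it in
  \<open>partial_decomposition\<close>.\<close>

definition values_at :: "(real \<times> real \<Rightarrow> 'v) set \<Rightarrow> real \<times> real \<Rightarrow> 'v set" where
  "values_at F t = (\<lambda>z. z t) ` {z \<in> F. z t \<noteq> 0}"

text \<open>The complement \<open>N\<close> is part of the data because \<open>F\<close> does not
  determine it, and because its shrinking is what becomes stationary at each point.\<close>

definition partial_decomposition ::
  "(real \<times> real \<Rightarrow> 'v) set \<Rightarrow> (real \<times> real \<Rightarrow> 'v set) \<Rightarrow> bool" where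
  "partial_decomposition F N \<longleftrightarrow> submodule N \<and> (\<forall>z\<in>F. \<exists>B. block B \<and> block_section B z) \<and>
    (\<forall>t. inj_on (\<lambda>z. z t) {z \<in> F. z t \<noteq> 0} \<and> independent (values_at F t) \<and>
      span (values_at F t) \<inter> N t = {0} \<and> V t = {x + n | x n. x \<in> span (values_at F t) \<and> n \<in> N t})"

lemma block_sectionD:
  assumes "block_section B z"
  shows "z t \<in> V t" "z t \<noteq> 0 \<longleftrightarrow> t \<in> B" "s \<le> t \<Longrightarrow> s \<in> B \<Longrightarrow> \<rho> s t (z s) = z t"
  using assms unfolding block_section_def by simp_all

lemma partial_decompositionD:
  assumes "partial_decomposition F N"
  shows "submodule N" "z \<in> F \<Longrightarrow> \<exists>B. block B \<and> block_section B z"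
    "inj_on (\<lambda>z. z t) {z \<in> F. z t \<noteq> 0}" "independent (values_at F t)"
    "span (values_at F t) \<inter> N t = {0}" "V t = {x + n | x n. x \<in> span (values_at F t) \<and> n \<in> N t}"
proof -
  note D = assms[unfolded partial_decomposition_def]
  show "submodule N" using D by (rule conjunct1)
  show "\<exists>B. block B \<and> block_section B z" if "z \<in> F" using bspec[OF conjunct1[OF conjunct2[OF D]] that] .
  note Dt = spec[OF conjunct2[OF conjunct2[OF D]], of t]
  show "inj_on (\<lambda>z. z t) {z \<in> F. z t \<noteq> 0}" using Dt by (rule conjunct1)
  show "independent (values_at F t)" using conjunct2[OF Dt] by (rule conjunct1)
  show "span (values_at F t) \<inter> N t = {0}" using conjunct2[OF conjunct2[OF Dt]] by (rule conjunct1)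
  show "V t = {x + n | x n. x \<in> span (values_at F t) \<and> n \<in> N t}"
    using conjunct2[OF conjunct2[OF Dt]] by (rule conjunct2)
qed

lemma span_values_subset:
  assumes "partial_decomposition F N"
  shows "span (values_at F t) \<subseteq> V t"
proof
  fix x assume "x \<in> span (values_at F t)"
  moreover have "0 \<in> N t" using subspace_0[OF submoduleD(1)[OF partial_decompositionD(1)[OF assms]]] .
  ultimately have "\<exists>y n. x = y + n \<and> y \<in> span (values_at F t) \<and> n \<in> N t"
    by (intro exI[of _ x] exI[of _ 0]) simp
  then show "x \<in> V t" unfolding partial_decompositionD(6)[OF assms, of t] by simp
qed

lemma map_span_values:
  assumes D: "partial_decomposition F N" and st: "s \<le> t" and x: "x \<in> span (values_at F s)"
  shows "\<rho> s t x \<in> span (values_at F t)"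
proof -
  let ?U = "{x \<in> V s. \<rho> s t x \<in> span (values_at F t)}"
  have "subspace ?U"
    using st by (intro subspaceI) (auto simp: zero_in add_in scale_in map_zero map_add map_scale span_zero span_add span_scale)
  moreover have "values_at F s \<subseteq> ?U"
  proof
    fix v assume "v \<in> values_at F s"
    then obtain z where z: "z \<in> F" "z s \<noteq> 0" "v = z s" unfolding values_at_def by auto
    obtain B where "block_section B z" using partial_decompositionD(2)[OF D z(1)] by blast
    then have "\<rho> s t v = z t" "v \<in> V s" using block_sectionD(1,2)[of B z s] block_sectionD(3)[of B z s t] z st by simp_all
    moreover have "z t \<in> span (values_at F t)"
      using z(1) by (cases "z t = 0") (auto simp: values_at_def span_zero intro!: span_base)
    ultimately show "v \<in> ?U" by simp
  qed
  ultimately have "span (values_at F s) \<subseteq> ?U" by (rule span_minimal[rotated])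
  then show ?thesis using x by blast
qed

lemma persistence_submodule:
  assumes "submodule N"
  shows "persistence_module (*s) N \<rho>"
proof unfold_locales
  note in_V = submoduleD(2)[OF assms]
  show "subspace (N t)" for t by (rule submoduleD(1)[OF assms])
  fix s t u x y c
  show "\<rho> t t x = x" if "x \<in> N t" by (rule map_refl[OF in_V[OF that]])
  assume st: "s \<le> t" and x: "x \<in> N s"
  show "\<rho> s t x \<in> N t" using submoduleD(3)[OF assms st x] .
  show "\<rho> s t (c *s x) = c *s \<rho> s t x" using map_scale[OF st in_V[OF x]] .
  show "\<rho> t u (\<rho> s t x) = \<rho> s u x" if "t \<le> u" using map_comp[OF st that in_V[OF x]] .
  show "\<rho> s t (x + y) = \<rho> s t x + \<rho> s t y" if "y \<in> N s" using map_add[OF st in_V[OF x] in_V[OF that]] .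
qed

end

section \<open>Splitting off sections until nothing is left\<close>

context exact_module
begin

text \<open>A lift found in \<open>V\<close> has a component in the span of the sections. That
  component maps into \<open>N\<close> at both corners, hence to 0 because the sum is direct, so the
  other component is a lift inside \<open>N\<close>.\<close>

lemma exact_summand:
  assumes D: "partial_decomposition F N"
  shows "exact_module (*s) N \<rho>"
proof -
  have N: "submodule N" using partial_decompositionD(1)[OF D] .
  interpret N: persistence_module "(*s)" N \<rho> using persistence_submodule[OF N] .
  show ?thesis
  proof unfold_locales
    fix t
    obtain S where S: "finite S" "V t = span S" using finite_dim by blast
    obtain B where B: "B \<subseteq> N t" "independent B" "N t \<subseteq> span B" by (rule basis_exists[of "N t"])
    have "B \<subseteq> span S" using B(1) submoduleD(2)[OF N, of _ t] S(2) by auto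
    then have "finite B" using independent_span_bound[OF S(1) B(2)] by simp
    moreover have "N t = span B" using B span_minimal[OF B(1) N.subspace_V] by blast
    ultimately show "\<exists>S. finite S \<and> N t = span S" by blast
  next
    fix x x' y y' a b
    assume le: "x \<le> x'" "y \<le> y'" and a: "a \<in> N (x', y)" and b: "b \<in> N (x, y')"
      and eq: "\<rho> (x', y) (x', y') a = \<rho> (x, y') (x', y') b"
    obtain c where c: "c \<in> V (x, y)" "\<rho> (x, y) (x', y) c = a" "\<rho> (x, y) (x, y') c = b"
      using exact[OF le submoduleD(2)[OF N a] submoduleD(2)[OF N b] eq] by blast
    obtain v n where vn: "c = v + n" "v \<in> span (values_at F (x, y))" "n \<in> N (x, y)"
      using c(1) partial_decompositionD(6)[OF D, of "(x, y)"] by blast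
    have drop: "\<rho> (x, y) u c = \<rho> (x, y) u n" if u: "(x, y) \<le> u" "\<rho> (x, y) u c \<in> N u" for u
    proof -
      have "\<rho> (x, y) u c = \<rho> (x, y) u v + \<rho> (x, y) u n"
        unfolding vn(1) using map_add[OF u(1)] subsetD[OF span_values_subset[OF D] vn(2)] submoduleD(2)[OF N vn(3)] .
      moreover have "\<rho> (x, y) u n \<in> N u" using submoduleD(3)[OF N u(1) vn(3)] .
      ultimately have "\<rho> (x, y) u v \<in> N u"
        using subspace_diff[OF submoduleD(1)[OF N] u(2) \<open>\<rho> (x, y) u n \<in> N u\<close>] by simp
      then have "\<rho> (x, y) u v = 0"
        using map_span_values[OF D u(1) vn(2)] partial_decompositionD(5)[OF D, of u] by blast
      then show ?thesis using \<open>\<rho> (x, y) u c = \<rho> (x, y) u v + \<rho> (x, y) u n\<close> by simp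
    qed
    show "\<exists>c\<in>N (x, y). \<rho> (x, y) (x', y) c = a \<and> \<rho> (x, y) (x, y') c = b"
      using drop[of "(x', y)"] drop[of "(x, y')"] c a b le vn(3) by (intro bexI[of _ n]) auto
  qed
qed

text \<open>Both the new section and its complement are taken inside \<open>N\<close>, which is
  exact as a summand. A nonzero value of \<open>z\<close> lies in \<open>N\<close> and therefore
  outside the span of the old values, so \<open>z\<close> is really new.\<close>

lemma partial_decomposition_extend:
  assumes D: "partial_decomposition F N" and v: "v \<in> N s" "v \<noteq> 0"
  shows "\<exists>F' N'. partial_decomposition F' N' \<and> F \<subset> F' \<and> N' \<le> N"
proof -
  have N: "submodule N" using partial_decompositionD(1)[OF D] .
  interpret N: exact_module "(*s)" N \<rho> using exact_summand[OF D] .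
  obtain B z where B: "block B" and zN: "N.block_section B z" and av: "\<And>t. t \<in> B \<Longrightarrow> z t \<notin> N.born_outside B t"
    using N.exists_block_section[OF v] by blast
  obtain X Y where XY: "B = X \<times> Y" using block_Times[OF B] by blast
  have "sup s t \<in> B" if "s \<in> B" "t \<in> B" for s t
    using that unfolding XY by (auto simp: sup_prod_def sup_max max_def)
  then obtain N' where N': "N.submodule N'" "\<And>t. t \<in> B \<Longrightarrow> z t \<notin> N' t"
    "\<And>t m. m \<in> N t \<Longrightarrow> \<exists>c. m - c *s z t \<in> N' t"
    using N.block_section_complement[OF zN _ av] by metis
  note zD = N.block_sectionD[OF zN]
  have N'N: "x \<in> N t" if "x \<in> N' t" for x t using N.submoduleD(2)[OF N'(1) that] .
  have sN': "subspace (N' t)" for t using N.submoduleD(1)[OF N'(1)] .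
  have z: "block_section B z"
    using zN submoduleD(2)[OF N] by (simp add: block_section_def N.block_section_def)
  have subN': "submodule N'"
    unfolding submodule_def
  proof (intro conjI allI impI ballI)
    show "N' t \<subseteq> V t" for t using submoduleD(2)[OF N N'N] by (rule subsetI)
  qed (use sN' N.submoduleD(3)[OF N'(1)] in simp_all)
  \<comment> \<open>Off the block \<open>z t = 0\<close> forces \<open>N' t = N t\<close>, and
    nothing changes. On the block \<open>N t\<close> is the line of \<open>z t\<close> plus
    \<open>N' t\<close>, so exactly one vector joins the basis.\<close>
  have cases_t: "inj_on (\<lambda>w. w t) {w \<in> insert z F. w t \<noteq> 0} \<and> independent (values_at (insert z F) t) \<and>
      span (values_at (insert z F) t) \<inter> N' t = {0} \<and>
      V t = {x + n | x n. x \<in> span (values_at (insert z F) t) \<and> n \<in> N' t}" for t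
  proof (cases "z t = 0")
    case True
    then have eq: "{w \<in> insert z F. w t \<noteq> 0} = {w \<in> F. w t \<noteq> 0}" by auto
    have "x \<in> N' t" if "x \<in> N t" for x using N'(3)[OF that] True by auto
    then have "N' t = N t" using N'N by blast
    then show ?thesis using partial_decompositionD(3-6)[OF D, of t] unfolding values_at_def eq by simp
  next
    case False
    then have tB: "t \<in> B" using zD(2) by blast
    have eq: "{w \<in> insert z F. w t \<noteq> 0} = insert z {w \<in> F. w t \<noteq> 0}" using False by auto
    then have eqv: "values_at (insert z F) t = insert (z t) (values_at F t)" unfolding values_at_def by simp
    have zsp: "z t \<notin> span (values_at F t)"
      using partial_decompositionD(5)[OF D, of t] zD(1)[of t] False by blast
    have "inj_on (\<lambda>w. w t) {w \<in> insert z F. w t \<noteq> 0}"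
      unfolding eq using partial_decompositionD(3)[OF D, of t] zsp span_superset[of "values_at F t"]
      unfolding inj_on_insert values_at_def by blast
    moreover have "independent (values_at (insert z F) t)"
      unfolding eqv using zsp partial_decompositionD(4)[OF D] by (rule independent_insertI)
    moreover have "span (values_at (insert z F) t) \<inter> N' t = {0}"
    proof -
      have "x = 0" if x: "x \<in> span (values_at (insert z F) t)" "x \<in> N' t" for x
      proof -
        obtain c where c: "x - c *s z t \<in> span (values_at F t)" using x(1) unfolding eqv span_insert by blast
        have "x - c *s z t \<in> N t" using N.diff_in[OF N'N[OF x(2)] N.scale_in[OF zD(1)]] .
        then have "x - c *s z t \<in> span (values_at F t) \<inter> N t" using c by simp
        then have xc: "x = c *s z t" unfolding partial_decompositionD(5)[OF D] by simp
        have "c = 0"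
        proof (rule ccontr)
          assume "c \<noteq> 0"
          then have "inverse c *s x = z t" using xc by simp
          moreover have "inverse c *s x \<in> N' t" by (rule subspace_scale[OF sN' x(2)])
          ultimately show False using N'(2)[OF tB] by simp
        qed
        then show ?thesis using xc by simp
      qed
      moreover have "0 \<in> span (values_at (insert z F) t) \<inter> N' t" using subspace_0[OF sN'] span_zero by simp
      ultimately show ?thesis by blast
    qed
    moreover have "V t = {x + n | x n. x \<in> span (values_at (insert z F) t) \<and> n \<in> N' t}"
    proof (intro antisym subsetI)
      fix y assume "y \<in> V t"
      then obtain x n where xn: "y = x + n" "x \<in> span (values_at F t)" "n \<in> N t"
        using partial_decompositionD(6)[OF D, of t] by blast
      obtain c where c: "n - c *s z t \<in> N' t" using N'(3)[OF xn(3)] by blast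
      have "x + c *s z t \<in> span (values_at (insert z F) t)"
        unfolding eqv using subsetD[OF span_mono[OF subset_insertI] xn(2)]
        by (simp add: span_add span_scale span_base)
      moreover have "y = (x + c *s z t) + (n - c *s z t)" using xn(1) by simp
      ultimately show "y \<in> {x + n | x n. x \<in> span (values_at (insert z F) t) \<and> n \<in> N' t}" using c by blast
    next
      fix y assume "y \<in> {x + n | x n. x \<in> span (values_at (insert z F) t) \<and> n \<in> N' t}"
      then obtain x n where xn: "y = x + n" "x \<in> span (values_at (insert z F) t)" "n \<in> N' t" by blast
      have "values_at F t \<subseteq> V t" using span_values_subset[OF D, of t] span_superset by blast
      then have "span (insert (z t) (values_at F t)) \<subseteq> V t"
        using block_sectionD(1)[OF z] by (intro span_minimal subspace_V) simp
      then have "x \<in> V t" using xn(2) eqv by auto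
      moreover have "n \<in> V t" using submoduleD(2)[OF N N'N[OF xn(3)]] .
      ultimately show "y \<in> V t" using xn(1) add_in by simp
    qed
    ultimately show ?thesis by blast
  qed
  have "partial_decomposition (insert z F) N'"
    unfolding partial_decomposition_def
  proof (intro conjI allI ballI)
    show "\<exists>B. block B \<and> block_section B w" if "w \<in> insert z F" for w
      using that B z partial_decompositionD(2)[OF D, of w] by auto
  qed (use subN' cases_t in simp_all)
  moreover have "z \<notin> F"
  proof
    assume zF: "z \<in> F"
    obtain t where t: "t \<in> B" using block_nonempty[OF B] by blast
    then have "z t \<noteq> 0" using zD(2) by blast
    then have "z t \<in> span (values_at F t)" using zF unfolding values_at_def by (intro span_base) blast
    then show False using partial_decompositionD(5)[OF D, of t] zD(1)[of t] \<open>z t \<noteq> 0\<close> by blast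
  qed
  moreover have "N' \<le> N" using N'N by (auto simp: le_fun_def)
  ultimately show ?thesis by (intro exI[of _ "insert z F"] exI[of _ N']) auto
qed

text \<open>Along a chain the complements at a fixed point stabilise, and from then on no new section is
  alive at that point. Hence union and intersection form an upper bound.\<close>

lemma partial_decomposition_chain:
  assumes ne: "\<C> \<noteq> {}" and D: "\<And>F N. (F, N) \<in> \<C> \<Longrightarrow> partial_decomposition F N"
    and chain: "\<And>F N F' N'. (F, N) \<in> \<C> \<Longrightarrow> (F', N') \<in> \<C> \<Longrightarrow>
      F \<subseteq> F' \<and> N' \<le> N \<or> F' \<subseteq> F \<and> N \<le> N'"
  shows "partial_decomposition (\<Union>(F, N)\<in>\<C>. F) (\<lambda>t. \<Inter>(F, N)\<in>\<C>. N t)" (is "partial_decomposition ?F ?N")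
proof -
  have stable: "\<exists>F N. (F, N) \<in> \<C> \<and> {z \<in> ?F. z t \<noteq> 0} = {z \<in> F. z t \<noteq> 0} \<and> ?N t = N t" for t
  proof -
    have "\<exists>k\<in>\<C>. \<forall>i\<in>\<C>. snd k t \<subseteq> snd i t"
    proof (rule least_subspace[OF ne, where t = t])
      show "subspace (snd i t)" "snd i t \<subseteq> V t" if "i \<in> \<C>" for i
      proof -
        have "submodule (snd i)" using that by (intro partial_decompositionD(1)[OF D[of "fst i"]]) simp
        then show "subspace (snd i t)" "snd i t \<subseteq> V t" by (simp_all add: submodule_def)
      qed
      show "\<exists>k\<in>\<C>. snd k t \<subseteq> snd i t \<and> snd k t \<subseteq> snd j t" if "i \<in> \<C>" "j \<in> \<C>" for i j
      proof -
        have "snd j t \<subseteq> snd i t \<or> snd i t \<subseteq> snd j t"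
          using chain[of "fst i" "snd i" "fst j" "snd j"] that by (auto simp: le_fun_def)
        then show ?thesis using that by auto
      qed
    qed
    then obtain k where k: "k \<in> \<C>" "\<forall>i\<in>\<C>. snd k t \<subseteq> snd i t" ..
    obtain F N where FNk: "k = (F, N)" by (cases k)
    have least: "N t \<subseteq> N' t" if "(F', N') \<in> \<C>" for F' N'
      using bspec[OF k(2) that] FNk by simp
    have FN: "(F, N) \<in> \<C>" using k FNk by simp
    \<comment> \<open>Suppose a section outside \<open>F\<close> were alive at \<open>t\<close>. Its
      value minus the component along \<open>F\<close> lies both in the new span and in the
      complement, which is unchanged at \<open>t\<close>; so the difference is 0, against
      independence.\<close>
    have alive: "z \<in> F" if z: "z \<in> F'" "z t \<noteq> 0" "(F', N') \<in> \<C>" for z F' N'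
    proof (rule ccontr)
      assume "z \<notin> F"
      then have le: "F \<subseteq> F'" "N' \<le> N" using chain[OF FN z(3)] z(1) by auto
      have "N t \<subseteq> N' t" by (rule least[OF z(3)])
      then have eqN: "N' t = N t" using le(2) by (auto simp: le_fun_def)
      note D' = D[OF z(3)]
      have zv: "z t \<in> values_at F' t" using z unfolding values_at_def by auto
      then have "z t \<in> V t" using span_values_subset[OF D'] span_base by blast
      then obtain x n where xn: "z t = x + n" "x \<in> span (values_at F t)" "n \<in> N t"
        using partial_decompositionD(6)[OF D[OF FN], of t] by blast
      have sub: "values_at F t \<subseteq> values_at F' t - {z t}"
      proof
        fix v assume "v \<in> values_at F t"
        then obtain w where w: "w \<in> F" "w t \<noteq> 0" "v = w t" unfolding values_at_def by auto
        have "w \<in> F'" "w \<noteq> z" using w(1) le(1) \<open>z \<notin> F\<close> by auto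
        then have "w t \<noteq> z t"
          using inj_onD[OF partial_decompositionD(3)[OF D', of t], of w z] w(2) z(1,2) by blast
        then show "v \<in> values_at F' t - {z t}" using w(2,3) \<open>w \<in> F'\<close> unfolding values_at_def by simp
      qed
      have x': "x \<in> span (values_at F' t - {z t})" using subsetD[OF span_mono[OF sub] xn(2)] .
      then have "x \<in> span (values_at F' t)" by (rule subsetD[OF span_mono[OF Diff_subset]])
      then have "z t - x \<in> span (values_at F' t)" using span_diff[OF span_base[OF zv]] by simp
      moreover have "z t - x \<in> N' t" using xn eqN by simp
      ultimately have "z t - x \<in> span (values_at F' t) \<inter> N' t" by simp
      then have "z t - x = 0" unfolding partial_decompositionD(5)[OF D'] by simp
      then have "z t \<in> span (values_at F' t - {z t})" using x' by simp
      then show False using partial_decompositionD(4)[OF D', of t] zv unfolding dependent_def by blast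
    qed
    have "{z \<in> ?F. z t \<noteq> 0} = {z \<in> F. z t \<noteq> 0}"
    proof (intro antisym subsetI)
      fix z assume "z \<in> {z \<in> ?F. z t \<noteq> 0}"
      then obtain F' N' where "z \<in> F'" "z t \<noteq> 0" "(F', N') \<in> \<C>" by auto
      then show "z \<in> {z \<in> F. z t \<noteq> 0}" using alive by simp
    next
      fix z assume "z \<in> {z \<in> F. z t \<noteq> 0}"
      then show "z \<in> {z \<in> ?F. z t \<noteq> 0}" using FN by auto
    qed
    moreover have "?N t = N t"
    proof (rule antisym)
      show "?N t \<subseteq> N t" using FN by auto
      show "N t \<subseteq> ?N t"
      proof (rule INF_greatest)
        show "N t \<subseteq> (case p of (F, N) \<Rightarrow> N t)" if "p \<in> \<C>" for p using least that by (cases p) auto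
      qed
    qed
    ultimately show ?thesis using FN by (intro exI[of _ F] exI[of _ N]) simp
  qed
  have sub: "N t \<subseteq> V t" if "(F, N) \<in> \<C>" for F N t
    by (rule subsetI) (rule submoduleD(2)[OF partial_decompositionD(1)[OF D[OF that]]])
  have N: "submodule ?N"
    unfolding submodule_def
  proof (intro conjI allI impI ballI)
    show "subspace (?N t)" for t
    proof (rule subspace_Int)
      show "subspace (case p of (F, N) \<Rightarrow> N t)" if "p \<in> \<C>" for p
        using submoduleD(1)[OF partial_decompositionD(1)[OF D]] that by (cases p) auto
    qed
    show "?N t \<subseteq> V t" for t
    proof -
      obtain F N where "(F, N) \<in> \<C>" using ne by auto
      then show ?thesis using sub[of F N t] by auto
    qed
    show "\<rho> s t x \<in> ?N t" if "s \<le> t" "x \<in> ?N s" for s t x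
    proof (rule INT_I)
      fix p assume p: "p \<in> \<C>"
      have "x \<in> snd p s" using INT_D[OF \<open>x \<in> ?N s\<close> p] by (simp add: case_prod_beta)
      moreover have "submodule (snd p)" using p by (intro partial_decompositionD(1)[OF D[of "fst p"]]) simp
      ultimately show "\<rho> s t x \<in> (case p of (F, N) \<Rightarrow> N t)"
        using submoduleD(3)[OF _ \<open>s \<le> t\<close>] by (simp add: case_prod_beta)
    qed
  qed
  have F: "\<exists>B. block B \<and> block_section B z" if z: "z \<in> ?F" for z
  proof -
    obtain p where p: "p \<in> \<C>" "z \<in> (case p of (F, N) \<Rightarrow> F)" using z by (rule UN_E)
    then show ?thesis using partial_decompositionD(2)[OF D[of "fst p" "snd p"], of z] by (simp add: case_prod_beta)
  qed
  have sum: "inj_on (\<lambda>z. z t) {z \<in> ?F. z t \<noteq> 0} \<and> independent (values_at ?F t) \<and>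
      span (values_at ?F t) \<inter> ?N t = {0} \<and> V t = {x + n | x n. x \<in> span (values_at ?F t) \<and> n \<in> ?N t}" for t
  proof -
    obtain F N where FN: "(F, N) \<in> \<C>" "{z \<in> ?F. z t \<noteq> 0} = {z \<in> F. z t \<noteq> 0}" "?N t = N t"
      using stable[of t] by (elim exE conjE)
    have eq: "values_at ?F t = values_at F t" unfolding values_at_def FN(2) ..
    show ?thesis unfolding FN(2,3) eq by (intro conjI partial_decompositionD(3-6)[OF D[OF FN(1)]])
  qed
  show ?thesis
    unfolding partial_decomposition_def by (rule conjI[OF N conjI[OF ballI[OF F] allI[OF sum]]])
qed

text \<open>In a maximal pair the complement vanishes, since any nonzero vector in it would yield
  one more section. The order lets \<open>N\<close> decrease while \<open>F\<close> grows, starting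
  from the empty family with complement \<open>V\<close>.\<close>

theorem exists_decomposition: "\<exists>F. partial_decomposition F (\<lambda>_. {0})"
proof -
  define \<A> where "\<A> = {(F, N). partial_decomposition F N}"
  define R where "R p q \<longleftrightarrow> fst p \<subseteq> fst q \<and> snd q \<le> snd p"
    for p q :: "(real \<times> real \<Rightarrow> 'b) set \<times> (real \<times> real \<Rightarrow> 'b set)"
  have "\<exists>m\<in>\<A>. \<forall>p\<in>\<A>. R m p \<longrightarrow> p = m"
  proof (rule predicate_Zorn)
    show "partial_order_on \<A> (relation_of R \<A>)"
    proof (rule partial_order_on_relation_ofI)
      show "R p r" if "R p q" "R q r" for p q r using that unfolding R_def by (meson order_trans)
      show "p = q" if "R p q" "R q p" for p q using that unfolding R_def by (metis antisym prod_eqI)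
    qed (simp add: R_def)
    fix \<C> assume "\<C> \<in> Chains (relation_of R \<A>)"
    then have \<C>: "\<C> \<subseteq> \<A>" "\<And>p q. p \<in> \<C> \<Longrightarrow> q \<in> \<C> \<Longrightarrow> R p q \<or> R q p"
      unfolding Chains_def relation_of_def by auto
    show "\<exists>u\<in>\<A>. \<forall>p\<in>\<C>. R p u"
    proof (cases "\<C> = {}")
      case True
      have "submodule V" unfolding submodule_def using subspace_V map_in by simp
      then have "partial_decomposition {} V"
        unfolding partial_decomposition_def values_at_def using zero_in by (auto simp: independent_empty)
      then have "({}, V) \<in> \<A>" by (simp add: \<A>_def)
      then show ?thesis using True by blast
    next
      case False
      have "partial_decomposition (\<Union>(F, N)\<in>\<C>. F) (\<lambda>t. \<Inter>(F, N)\<in>\<C>. N t)"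
      proof (rule partial_decomposition_chain[OF False])
        show "partial_decomposition F N" if "(F, N) \<in> \<C>" for F N using that \<C>(1) unfolding \<A>_def by blast
        show "F \<subseteq> F' \<and> N' \<le> N \<or> F' \<subseteq> F \<and> N \<le> N'" if "(F, N) \<in> \<C>" "(F', N') \<in> \<C>" for F N F' N'
          using \<C>(2)[OF that] unfolding R_def by simp
      qed
      then have "(\<Union>(F, N)\<in>\<C>. F, \<lambda>t. \<Inter>(F, N)\<in>\<C>. N t) \<in> \<A>" (is "?u \<in> _") by (simp add: \<A>_def)
      moreover have "R p ?u" if "p \<in> \<C>" for p
        using that by (cases p) (auto simp: R_def le_fun_def)
      ultimately show ?thesis by blast
    qed
  qed
  then obtain m where m: "m \<in> \<A>" "\<forall>p\<in>\<A>. R m p \<longrightarrow> p = m" ..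
  obtain F N where FN: "m = (F, N)" by (cases m)
  have D: "partial_decomposition F N" using m(1) FN by (simp add: \<A>_def)
  have max: "F' = F" if "partial_decomposition F' N'" "F \<subseteq> F'" "N' \<le> N" for F' N'
    using bspec[OF m(2), of "(F', N')"] that FN by (simp add: \<A>_def R_def)
  have "N t = {0}" for t
  proof -
    have "v = 0" if v: "v \<in> N t" for v
    proof (rule ccontr)
      assume "v \<noteq> 0"
      then obtain F' N' where "partial_decomposition F' N'" "F \<subset> F'" "N' \<le> N"
        using partial_decomposition_extend[OF D v] by blast
      then show False using max[of F' N'] by auto
    qed
    then show ?thesis using subspace_0[OF submoduleD(1)[OF partial_decompositionD(1)[OF D]], of t] by auto
  qed
  then have "N = (\<lambda>_. {0})" by auto
  then show ?thesis using D by blast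
qed

end

section \<open>Coordinates and uniqueness\<close>

context persistence_module
begin

lemma map_sum_scale:
  assumes "s \<le> t" "\<And>j. j \<in> A \<Longrightarrow> w j \<in> V s"
  shows "\<rho> s t (\<Sum>j\<in>A. c j *s w j) = (\<Sum>j\<in>A. c j *s \<rho> s t (w j))"
  using assms(2)
proof (induction A rule: infinite_finite_induct)
  case (insert x F)
  have "(\<Sum>j\<in>F. c j *s w j) \<in> V s" by (intro subspace_sum subspace_V scale_in) (simp add: insert)
  then show ?case using insert assms(1) by (simp add: map_add map_scale scale_in)
qed (simp_all add: map_zero assms(1))

definition linear_form :: "real \<times> real \<Rightarrow> ('v \<Rightarrow> 'k) \<Rightarrow> bool" where
  "linear_form t \<phi> \<longleftrightarrow> (\<forall>x\<in>V t. \<forall>y\<in>V t. \<phi> (x + y) = \<phi> x + \<phi> y) \<and> (\<forall>c. \<forall>x\<in>V t. \<phi> (c *s x) = c * \<phi> x)"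

lemma linear_form_sum:
  assumes \<phi>: "linear_form t \<phi>" and w: "\<And>j. j \<in> A \<Longrightarrow> w j \<in> V t"
  shows "\<phi> (\<Sum>j\<in>A. c j *s w j) = (\<Sum>j\<in>A. c j * \<phi> (w j))"
  using w
proof (induction A rule: infinite_finite_induct)
  case (insert x F)
  have "(\<Sum>j\<in>F. c j *s w j) \<in> V t" by (intro subspace_sum subspace_V scale_in) (simp add: insert)
  then show ?case using insert \<phi> scale_in unfolding linear_form_def by simp
qed (use \<phi>[unfolded linear_form_def] zero_in[of t] in \<open>force dest: bspec\<close>)+

text \<open>An isomorphism with a direct sum of block modules, written inside the module:
  \<open>z i\<close> is the image of the generator of the summand \<open>i\<close>, and
  \<open>\<phi> i\<close> is the component function. In this form decompositions with different
  index types can be compared.\<close>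

definition coordinates ::
  "'i set \<Rightarrow> ('i \<Rightarrow> (real \<times> real) set) \<Rightarrow> ('i \<Rightarrow> real \<times> real \<Rightarrow> 'v \<Rightarrow> 'k) \<Rightarrow> ('i \<Rightarrow> real \<times> real \<Rightarrow> 'v) \<Rightarrow> bool" where
  "coordinates I C \<phi> z \<longleftrightarrow>
    (\<forall>i\<in>I. block_section (C i) (z i)) \<and>
    (\<forall>i\<in>I. \<forall>t. linear_form t (\<phi> i t)) \<and>
    (\<forall>i\<in>I. \<forall>t. t \<notin> C i \<longrightarrow> (\<forall>v\<in>V t. \<phi> i t v = 0)) \<and>
    (\<forall>i\<in>I. \<forall>j\<in>I. \<forall>t\<in>C j. \<phi> i t (z j t) = (if i = j then 1 else 0)) \<and>
    (\<forall>t. \<forall>v\<in>V t. finite {i \<in> I. \<phi> i t v \<noteq> 0} \<and> v = (\<Sum>i | i \<in> I \<and> \<phi> i t v \<noteq> 0. \<phi> i t v *s z i t))"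

lemma coordinatesD:
  assumes "coordinates I C \<phi> z"
  shows "i \<in> I \<Longrightarrow> block_section (C i) (z i)" "i \<in> I \<Longrightarrow> linear_form t (\<phi> i t)"
    "i \<in> I \<Longrightarrow> t \<notin> C i \<Longrightarrow> v \<in> V t \<Longrightarrow> \<phi> i t v = 0"
    "i \<in> I \<Longrightarrow> j \<in> I \<Longrightarrow> t \<in> C j \<Longrightarrow> \<phi> i t (z j t) = (if i = j then 1 else 0)"
    "v \<in> V t \<Longrightarrow> finite {i \<in> I. \<phi> i t v \<noteq> 0}"
    "v \<in> V t \<Longrightarrow> v = (\<Sum>i | i \<in> I \<and> \<phi> i t v \<noteq> 0. \<phi> i t v *s z i t)"
proof -
  note D = assms[unfolded coordinates_def]
  note D2 = conjunct2[OF D] note D3 = conjunct2[OF D2] note D4 = conjunct2[OF D3] note D5 = conjunct2[OF D4]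
  show "block_section (C i) (z i)" if "i \<in> I" using bspec[OF conjunct1[OF D] that] .
  show "linear_form t (\<phi> i t)" if "i \<in> I" using spec[OF bspec[OF conjunct1[OF D2] that]] .
  show "\<phi> i t v = 0" if "i \<in> I" "t \<notin> C i" "v \<in> V t"
    using bspec[OF mp[OF spec[OF bspec[OF conjunct1[OF D3] that(1)]] that(2)] that(3)] .
  show "\<phi> i t (z j t) = (if i = j then 1 else 0)" if "i \<in> I" "j \<in> I" "t \<in> C j"
    using bspec[OF bspec[OF bspec[OF conjunct1[OF D4] that(1)] that(2)] that(3)] .
  show "finite {i \<in> I. \<phi> i t v \<noteq> 0}" if "v \<in> V t" using conjunct1[OF bspec[OF spec[OF D5] that]] .
  show "v = (\<Sum>i | i \<in> I \<and> \<phi> i t v \<noteq> 0. \<phi> i t v *s z i t)" if "v \<in> V t" using conjunct2[OF bspec[OF spec[OF D5] that]] .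
qed

lemma coordinates_cong:
  assumes co: "coordinates I C \<phi> z" and CD: "\<And>i. i \<in> I \<Longrightarrow> C i = D i"
  shows "coordinates I D \<phi> z"
  unfolding coordinates_def
proof (intro conjI ballI allI impI)
  show "block_section (D i) (z i)" if "i \<in> I" for i using coordinatesD(1)[OF co that] CD[OF that] by simp
  show "\<phi> i t v = 0" if "i \<in> I" "t \<notin> D i" "v \<in> V t" for i t v
    using coordinatesD(3)[OF co that(1) _ that(3)] CD[OF that(1)] that(2) by simp
  show "\<phi> i t (z j t) = (if i = j then 1 else 0)" if "i \<in> I" "j \<in> I" "t \<in> D j" for i j t
    using coordinatesD(4)[OF co that(1,2)] CD[OF that(2)] that(3) by simp
qed (rule coordinatesD(2)[OF co] coordinatesD(5)[OF co] coordinatesD(6)[OF co]; assumption)+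

text \<open>The expansion of \<open>v\<close> at \<open>s\<close> is carried to one at
  \<open>t\<close> in which some sections may have vanished; \<open>z i\<close> has not, because
  \<open>t\<close> lies in \<open>C i\<close>. If \<open>s\<close> is outside \<open>C i\<close>,
  both sides are 0.\<close>

lemma coordinates_map:
  assumes co: "coordinates I C \<phi> z" and st: "s \<le> t" and i: "i \<in> I" "t \<in> C i" and v: "v \<in> V s"
  shows "\<phi> i t (\<rho> s t v) = \<phi> i s v"
proof -
  let ?A = "{j \<in> I. \<phi> j s v \<noteq> 0}"
  note fin = coordinatesD(5)[OF co v]
  have zV: "z j u \<in> V u" if "j \<in> I" for j u using block_sectionD(1)[OF coordinatesD(1)[OF co that]] .
  have zmap: "\<rho> s t (z j s) = z j t" if "j \<in> ?A" for j
  proof -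
    have "s \<in> C j" using coordinatesD(3)[OF co _ _ v, of j] that by auto
    then show ?thesis using block_sectionD(3)[OF coordinatesD(1)[OF co] st] that by simp
  qed
  have \<phi>z: "\<phi> i t (z j t) = (if i = j then 1 else 0)" if "j \<in> I" for j
  proof (cases "t \<in> C j")
    case True
    then show ?thesis using coordinatesD(4)[OF co i(1) that] by simp
  next
    case False
    then have "z j t = 0" using block_sectionD(2)[OF coordinatesD(1)[OF co that]] by blast
    moreover have "\<phi> i t 0 = 0"
      using linear_form_sum[OF coordinatesD(2)[OF co i(1)], of "{}"] by simp
    ultimately show ?thesis using False i(2) by auto
  qed
  have "\<rho> s t v = \<rho> s t (\<Sum>j\<in>?A. \<phi> j s v *s z j s)" using coordinatesD(6)[OF co v] by simp
  also have "\<dots> = (\<Sum>j\<in>?A. \<phi> j s v *s \<rho> s t (z j s))" using zV by (intro map_sum_scale[OF st]) simp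
  also have "\<dots> = (\<Sum>j\<in>?A. \<phi> j s v *s z j t)" using zmap by (intro sum.cong) simp_all
  finally have "\<phi> i t (\<rho> s t v) = (\<Sum>j\<in>?A. \<phi> j s v * \<phi> i t (z j t))"
    using linear_form_sum[OF coordinatesD(2)[OF co i(1)], of ?A "\<lambda>j. z j t"] zV by simp
  also have "\<dots> = (\<Sum>j\<in>?A. if j = i then \<phi> i s v else 0)" using \<phi>z by (intro sum.cong) auto
  also have "\<dots> = \<phi> i s v" using fin i(1) by simp
  finally show ?thesis .
qed

text \<open>One half of the fact that a nonzero composite \<open>k\<^sub>B \<rightarrow> k\<^sub>D \<rightarrow> k\<^sub>B\<close> forces \<open>B = D\<close>: the form \<open>\<phi> i\<close>
  restricted to the section \<open>w\<close> is a homomorphism from the module of \<open>D\<close> to that of \<open>C i\<close>.\<close>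

lemma coordinates_nonzero:
  assumes co: "coordinates I C \<phi> z" and i: "i \<in> I" and w: "block_section D w" and nz: "\<phi> i s (w s) \<noteq> 0"
  shows "t \<le> s \<Longrightarrow> t \<in> D \<Longrightarrow> t \<in> C i" and "s \<le> t \<Longrightarrow> t \<in> C i \<Longrightarrow> t \<in> D"
    and "s \<in> C i" and "s \<in> D"
proof -
  have wV: "w t \<in> V t" for t using block_sectionD(1)[OF w] .
  have \<phi>0: "\<phi> i t 0 = 0" for t using linear_form_sum[OF coordinatesD(2)[OF co i], of "{}"] by simp
  show s: "s \<in> C i" using coordinatesD(3)[OF co i _ wV] nz by blast
  have "w s \<noteq> 0" using nz \<phi>0[of s] by metis
  then show sD: "s \<in> D" using block_sectionD(2)[OF w] by simp
  show "t \<in> C i" if "t \<le> s" "t \<in> D"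
  proof -
    have "\<phi> i s (w s) = \<phi> i t (w t)"
      using coordinates_map[OF co that(1) i s wV] block_sectionD(3)[OF w that] by simp
    then show ?thesis using nz coordinatesD(3)[OF co i _ wV] by metis
  qed
  show "t \<in> D" if "s \<le> t" "t \<in> C i"
  proof -
    have "\<phi> i t (w t) = \<phi> i s (w s)"
      using coordinates_map[OF co that(1) i that(2) wV] block_sectionD(3)[OF w that(1) sD] by simp
    then have "w t \<noteq> 0" using nz \<phi>0[of t] by metis
    then show ?thesis using block_sectionD(2)[OF w] by simp
  qed
qed

end

section \<open>Multiplicities of a block in two decompositions\<close>

context pfd_module
begin

text \<open>All copies of \<open>B\<close> are alive at the one point \<open>s\<close>, where the
  coordinate forms make their values independent in a finite-dimensional space.\<close>

lemma coordinates_finite: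
  assumes co: "coordinates I C \<phi> z" and s: "s \<in> B"
  shows "finite {i \<in> I. C i = B}"
proof -
  let ?I = "{i \<in> I. C i = B}"
  obtain S where S: "finite S" "V s = span S" using finite_dim by blast
  have zV: "z i s \<in> V s" if "i \<in> I" for i using block_sectionD(1)[OF coordinatesD(1)[OF co that]] .
  have *: "inj_on (\<lambda>i. z i s) ?I" "independent ((\<lambda>i. z i s) ` ?I)"
    by (rule independent_of_dual_family[where U = "V s" and \<phi> = "\<lambda>i. \<phi> i s"],
        use zV subspace_V coordinatesD(2)[OF co] coordinatesD(4)[OF co] s in \<open>simp_all add: linear_form_def\<close>)+
  have "(\<lambda>i. z i s) ` ?I \<subseteq> span S" using zV S(2) by auto
  then show ?thesis using independent_span_bound[OF S(1) *(2)] *(1) by (simp add: finite_image_iff)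
qed

text \<open>\<open>v i\<close> is the component of \<open>z i s\<close> along the copies of
  \<open>B\<close> in the second decomposition. The discarded components are invisible to the forms
  of the copies of \<open>B\<close> in the first, so the \<open>v i\<close> are still dual to these
  forms, hence independent, in a space spanned by \<open>?J\<close> many vectors.\<close>

lemma coordinates_card_le:
  assumes I: "coordinates I C \<phi> z" "\<And>i. i \<in> I \<Longrightarrow> block (C i)"
    and J: "coordinates J D \<psi> w" "\<And>j. j \<in> J \<Longrightarrow> block (D j)" and s: "s \<in> B"
  shows "card {i \<in> I. C i = B} \<le> card {j \<in> J. D j = B}"
proof -
  let ?I = "{i \<in> I. C i = B}" and ?J = "{j \<in> J. D j = B}"
  have finJ: "finite ?J" using coordinates_finite[OF J(1) s] .
  have zV: "z i s \<in> V s" if "i \<in> I" for i using block_sectionD(1)[OF coordinatesD(1)[OF I(1) that]] .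
  have wV: "w j s \<in> V s" if "j \<in> J" for j using block_sectionD(1)[OF coordinatesD(1)[OF J(1) that]] .
  define v where "v i = (\<Sum>j\<in>?J. \<psi> j s (z i s) *s w j s)" for i
  have vV: "v i \<in> V s" for i unfolding v_def by (intro subspace_sum subspace_V scale_in wV) simp
  have dual: "\<phi> i' s (v i) = (if i' = i then 1 else 0)" if i: "i \<in> ?I" "i' \<in> ?I" for i i'
  proof -
    have iI: "i \<in> I" "C i = B" "i' \<in> I" "C i' = B" using i by auto
    let ?S = "{j \<in> J. \<psi> j s (z i s) \<noteq> 0}"
    have finS: "finite ?S" using coordinatesD(5)[OF J(1) zV[OF iI(1)]] .
    \<comment> \<open>A nonzero product would be a nonzero composite from the module of
      \<open>B\<close> through that of \<open>D j\<close> back to that of \<open>B\<close>. Its two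
      halves give opposite inclusions both below and above \<open>s\<close>, which force
      \<open>D j = B\<close>.\<close>
    have off: "\<psi> j s (z i s) * \<phi> i' s (w j s) = 0" if j: "j \<in> J" "D j \<noteq> B" for j
    proof (rule ccontr)
      assume "\<not> ?thesis"
      then have nz: "\<psi> j s (z i s) \<noteq> 0" "\<phi> i' s (w j s) \<noteq> 0" by auto
      note a = coordinates_nonzero[OF J(1) j(1) coordinatesD(1)[OF I(1) iI(1)] nz(1), unfolded iI(2)]
      note b = coordinates_nonzero[OF I(1) iI(3) coordinatesD(1)[OF J(1) j(1)] nz(2), unfolded iI(4)]
      obtain X Y X' Y' where "B = X \<times> Y" "D j = X' \<times> Y'"
        using block_Times[OF I(2)[OF iI(1)]] block_Times[OF J(2)[OF j(1)]] iI(2) by auto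
      then have "B = D j"
      proof (rule Times_eqI)
        show "s \<in> B" "s \<in> D j" by (rule a(4), rule b(4))
        show "t \<in> B \<longleftrightarrow> t \<in> D j" if "t \<le> s" for t using a(1)[OF that] b(1)[OF that] by (rule iffI)
        show "t \<in> B \<longleftrightarrow> t \<in> D j" if "s \<le> t" for t using b(2)[OF that] a(2)[OF that] by (rule iffI)
      qed
      then show False using j(2) by simp
    qed
    \<comment> \<open>Indices in \<open>?J\<close> alone have coefficient 0, and those in
      \<open>?S\<close> alone contribute 0 by \<open>off\<close>, so the truncated sum and the full
      expansion have the same value under \<open>\<phi> i'\<close>.\<close>
    have "\<phi> i' s (v i) = (\<Sum>j\<in>?J. \<psi> j s (z i s) * \<phi> i' s (w j s))"
      unfolding v_def using wV by (intro linear_form_sum[OF coordinatesD(2)[OF I(1) iI(3)]]) simp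
    also have "\<dots> = (\<Sum>j\<in>?J \<union> ?S. \<psi> j s (z i s) * \<phi> i' s (w j s))"
      using finJ finS off by (intro sum.mono_neutral_left) auto
    also have "\<dots> = (\<Sum>j\<in>?S. \<psi> j s (z i s) * \<phi> i' s (w j s))"
      using finJ finS by (intro sum.mono_neutral_right) auto
    also have "\<dots> = \<phi> i' s (\<Sum>j\<in>?S. \<psi> j s (z i s) *s w j s)"
      using wV by (intro linear_form_sum[OF coordinatesD(2)[OF I(1) iI(3)], symmetric]) simp
    also have "\<dots> = \<phi> i' s (z i s)" using coordinatesD(6)[OF J(1) zV[OF iI(1)]] by simp
    also have "\<dots> = (if i' = i then 1 else 0)" using coordinatesD(4)[OF I(1) iI(3,1)] iI s by simp
    finally show ?thesis .
  qed
  have inj: "inj_on v ?I" and ind: "independent (v ` ?I)"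
    by (rule independent_of_dual_family[where U = "V s" and \<phi> = "\<lambda>i. \<phi> i s"],
        use vV subspace_V coordinatesD(2)[OF I(1)] dual in \<open>simp_all add: linear_form_def\<close>)+
  have "v ` ?I \<subseteq> span ((\<lambda>j. w j s) ` ?J)"
    unfolding v_def by (intro image_subsetI span_sum span_scale span_base) simp
  then have "card (v ` ?I) \<le> card ((\<lambda>j. w j s) ` ?J)"
    using independent_span_bound[OF _ ind] finJ by blast
  then show ?thesis using card_image[OF inj] card_image_le[OF finJ, of "\<lambda>j. w j s"] by simp
qed

text \<open>The forms are the coefficients in the basis \<open>values_at F t\<close>;
  \<open>representation\<close> is 0 off the basis, which takes care of sections vanishing at
  \<open>t\<close>. The reindexing \<open>h\<close> allows the sections to be labelled by
  \<open>copies m\<close> later.\<close>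

lemma coordinates_of_decomposition:
  assumes D: "partial_decomposition F (\<lambda>_. {0})" and h: "bij_betw h I F"
  shows "coordinates I (\<lambda>i. {t. h i t \<noteq> 0}) (\<lambda>i t v. representation (values_at F t) v (h i t)) h"
proof -
  let ?\<phi> = "\<lambda>i t v. representation (values_at F t) v (h i t)"
  have hF: "h i \<in> F" if "i \<in> I" for i using bspec[OF bij_betwE[OF h] that] .
  have ind: "independent (values_at F t)" for t by (rule partial_decompositionD(4)[OF D])
  have span: "v \<in> span (values_at F t)" if "v \<in> V t" for v t
    using that unfolding partial_decompositionD(6)[OF D, of t] by auto
  have mem: "h i t \<in> values_at F t" if "i \<in> I" "h i t \<noteq> 0" for i t
    unfolding values_at_def by (rule image_eqI[of _ _ "h i"]) (use hF that in simp_all)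
  have zero: "?\<phi> i t v = 0" if "h i t = 0" for i t v
  proof (rule ccontr)
    assume "?\<phi> i t v \<noteq> 0"
    then have "h i t \<in> values_at F t" by (rule representation_ne_zero)
    then show False using that unfolding values_at_def by (elim imageE CollectE) simp
  qed
  have eq: "i = j" if "i \<in> I" "j \<in> I" "h i t = h j t" "h j t \<noteq> 0" for i j t
  proof -
    have "h i = h j" using inj_onD[OF partial_decompositionD(3)[OF D, of t], of "h i" "h j"] that hF by simp
    then show ?thesis using inj_onD[OF bij_betw_imp_inj_on[OF h]] that by simp
  qed
  have sec: "block_section {t. h i t \<noteq> 0} (h i)" if i: "i \<in> I" for i
  proof -
    obtain B where B: "block_section B (h i)" using partial_decompositionD(2)[OF D hF[OF i]] by blast
    have "{t. h i t \<noteq> 0} = B" using block_sectionD(2)[OF B] by blast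
    then show ?thesis using B by simp
  qed
  have fin: "finite {i \<in> I. ?\<phi> i t v \<noteq> 0}" and sum: "v = (\<Sum>i | i \<in> I \<and> ?\<phi> i t v \<noteq> 0. ?\<phi> i t v *s h i t)"
    if v: "v \<in> V t" for t v
  proof -
    let ?A = "{i \<in> I. ?\<phi> i t v \<noteq> 0}" and ?E = "{b. representation (values_at F t) v b \<noteq> 0}"
    have inj: "inj_on (\<lambda>i. h i t) ?A"
    proof (rule inj_onI)
      fix i j assume ij: "i \<in> ?A" "j \<in> ?A" "h i t = h j t"
      have "h j t \<noteq> 0"
      proof
        assume "h j t = 0"
        then have "?\<phi> j t v = 0" by (rule zero)
        then show False using ij(2) by simp
      qed
      then show "i = j" using eq[OF _ _ ij(3)] ij(1,2) by simp
    qed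
    have img: "(\<lambda>i. h i t) ` ?A = ?E"
    proof (intro antisym subsetI)
      fix b assume b: "b \<in> ?E"
      then have "b \<in> values_at F t" using representation_ne_zero by blast
      then obtain y where y: "y \<in> F" "b = y t" unfolding values_at_def by auto
      have "y \<in> h ` I" using y(1) unfolding bij_betw_imp_surj_on[OF h] .
      then obtain i where i: "i \<in> I" "y = h i" by (elim imageE)
      show "b \<in> (\<lambda>i. h i t) ` ?A"
        by (rule image_eqI[where x = i]) (use b y(2) i in simp_all)
    next
      fix b assume "b \<in> (\<lambda>i. h i t) ` ?A"
      then show "b \<in> ?E" by (elim imageE CollectE conjE) simp
    qed
    have "finite ?E" by (rule finite_representation)
    then show "finite ?A" using finite_imageD[OF _ inj] unfolding img by blast
    have "v = (\<Sum>b\<in>?E. representation (values_at F t) v b *s b)"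
      using sum_nonzero_representation_eq[OF ind span[OF v]] by simp
    also have "\<dots> = (\<Sum>i\<in>?A. ?\<phi> i t v *s h i t)"
      unfolding img[symmetric] by (rule sum.reindex[OF inj, unfolded comp_def])
    finally show "v = (\<Sum>i | i \<in> I \<and> ?\<phi> i t v \<noteq> 0. ?\<phi> i t v *s h i t)" .
  qed
  show ?thesis
    unfolding coordinates_def
  proof (intro conjI ballI allI impI)
    show "linear_form t (?\<phi> i t)" for i t
      unfolding linear_form_def using ind span by (simp add: representation_add representation_scale)
    show "?\<phi> i t v = 0" if "t \<notin> {t. h i t \<noteq> 0}" for i t v using that zero by simp
    show "?\<phi> i t (h j t) = (if i = j then 1 else 0)" if "i \<in> I" "j \<in> I" "t \<in> {t. h j t \<noteq> 0}" for i j t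
      using representation_basis[OF ind mem[OF that(2)], of t] eq[OF that(1,2), of t] that(3) by auto
    show "v = (\<Sum>i | i \<in> I \<and> ?\<phi> i t v \<noteq> 0. ?\<phi> i t v *s h i t)" if "v \<in> V t" for t v
      using that by (rule sum)
    show "finite {i \<in> I. ?\<phi> i t v \<noteq> 0}" if "v \<in> V t" for t v using that by (rule fin)
    show "block_section {t. h i t \<noteq> 0} (h i)" if "i \<in> I" for i using that by (rule sec)
  qed
qed

end

text \<open>Each class of equal blocks is finite and can be numbered on its own, so the multiplicity
  function determines the family up to reordering.\<close>

lemma bij_betw_copies:
  assumes "\<And>B. finite {i \<in> I. C i = B}" "\<And>B. card {i \<in> I. C i = B} = m B"
  shows "\<exists>\<pi>. bij_betw \<pi> I (copies m) \<and> (\<forall>i\<in>I. fst (\<pi> i) = C i)"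
proof -
  have "\<exists>g. bij_betw g {i \<in> I. C i = B} {0..<m B}" for B
    using ex_bij_betw_finite_nat[OF assms(1)[of B]] assms(2) by simp
  then obtain g where "\<forall>B. bij_betw (g B) {i \<in> I. C i = B} {0..<m B}"
    using choice[of "\<lambda>B g. bij_betw g {i \<in> I. C i = B} {0..<m B}"] by auto
  then have g: "bij_betw (g B) {i \<in> I. C i = B} {0..<m B}" for B by (rule spec)
  have "bij_betw (\<lambda>i. (C i, g (C i) i)) I (copies m)"
  proof (rule bij_betw_imageI)
    show "inj_on (\<lambda>i. (C i, g (C i) i)) I"
    proof (rule inj_onI)
      fix i j assume *: "i \<in> I" "j \<in> I" "(C i, g (C i) i) = (C j, g (C j) j)"
      have eq: "C i = C j \<and> g (C i) i = g (C j) j" using *(3) unfolding prod.inject .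
      have c: "C i = C j" using conjunct1[OF eq] .
      have e: "g (C j) i = g (C j) j" using conjunct2[OF eq] unfolding c .
      have "i \<in> {k \<in> I. C k = C j}" "j \<in> {k \<in> I. C k = C j}" using *(1,2) c by simp_all
      then show "i = j" by (rule inj_onD[OF bij_betw_imp_inj_on[OF g] e])
    qed
    show "(\<lambda>i. (C i, g (C i) i)) ` I = copies m"
    proof (intro antisym subsetI)
      fix p assume "p \<in> (\<lambda>i. (C i, g (C i) i)) ` I"
      then obtain i where i: "i \<in> I" "p = (C i, g (C i) i)" by (elim imageE)
      then have "g (C i) i \<in> {0..<m (C i)}" by (intro bij_betwE[OF g, rule_format]) simp
      then show "p \<in> copies m" using i by (simp add: copies_def)
    next
      fix p assume "p \<in> copies m"
      then obtain B n where p: "p = (B, n)" "n \<in> {0..<m B}" by (auto simp: copies_def)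
      have "n \<in> g B ` {i \<in> I. C i = B}" unfolding bij_betw_imp_surj_on[OF g] by (rule p(2))
      then obtain i where i: "i \<in> I" "C i = B" "n = g B i" by (elim imageE CollectE conjE)
      show "p \<in> (\<lambda>i. (C i, g (C i) i)) ` I"
        by (rule image_eqI[where x = i]) (simp_all only: p(1) i)
    qed
  qed
  then show ?thesis by (intro exI[of _ "\<lambda>i. (C i, g (C i) i)"]) simp
qed

section \<open>Direct sums of block modules\<close>

context
  fixes M :: "('k::field, 'v::ab_group_add) bimodule"
  assumes M: "persistence_module (smult M) (fiber M) (tmap M)"
begin

interpretation persistence_module "smult M" "fiber M" "tmap M" by (rule M)

lemma isomorphic_of_coordinates:
  assumes co: "coordinates I C \<phi> z"
  shows "M \<simeq>\<^sub>b direct_sum I (\<lambda>i. rectangle_module (C i))"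
proof -
  let ?N = "direct_sum I (\<lambda>i. rectangle_module (C i)) :: ('k, 'a \<Rightarrow> 'k) bimodule"
  define f where "f t v = (\<lambda>i. if i \<in> I then \<phi> i t v else 0)" for t v
  have fiber: "x \<in> fiber ?N t \<longleftrightarrow> finite {i. x i \<noteq> 0} \<and> (\<forall>i. x i \<noteq> 0 \<longrightarrow> i \<in> I \<and> t \<in> C i)" for x t
    unfolding direct_sum_def rectangle_module_def by (auto split: if_splits)
  have zV: "z i t \<in> fiber M t" if "i \<in> I" for i t using block_sectionD(1)[OF coordinatesD(1)[OF co that]] .
  have lin: "linear_form t (\<phi> i t)" if "i \<in> I" for i t using coordinatesD(2)[OF co that] .
  have lin_add: "\<phi> i t (x + y) = \<phi> i t x + \<phi> i t y" if "i \<in> I" "x \<in> fiber M t" "y \<in> fiber M t" for i t x y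
    using lin[OF that(1), of t] that(2,3) unfolding linear_form_def by simp
  have lin_scale: "\<phi> i t (smult M c x) = c * \<phi> i t x" if "i \<in> I" "x \<in> fiber M t" for i t c x
    using lin[OF that(1), of t] that(2) unfolding linear_form_def by simp
  have off: "\<phi> i t v = 0" if "i \<in> I" "t \<notin> C i" "v \<in> fiber M t" for i t v using coordinatesD(3)[OF co that] .
  have in_N: "f t v \<in> fiber ?N t" if v: "v \<in> fiber M t" for t v
  proof -
    have "{i. f t v i \<noteq> 0} = {i \<in> I. \<phi> i t v \<noteq> 0}" by (auto simp: f_def)
    then have "finite {i. f t v i \<noteq> 0}" using coordinatesD(5)[OF co v] by simp
    moreover have "i \<in> I \<and> t \<in> C i" if "f t v i \<noteq> 0" for i
      using that off[OF _ _ v] by (auto simp: f_def split: if_splits)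
    ultimately show ?thesis unfolding fiber by simp
  qed
  have linear: "linear_between (smult M) (smult ?N) (fiber M t) (fiber ?N t) (f t)" for t
    unfolding linear_between_def
  proof (intro conjI ballI allI)
    show "f t (x + y) = f t x + f t y" if "x \<in> fiber M t" "y \<in> fiber M t" for x y
      using that by (simp add: f_def fun_eq_iff lin_add)
    show "f t (smult M c x) = smult ?N c (f t x)" if "x \<in> fiber M t" for c x
      using that by (simp add: f_def fun_eq_iff lin_scale direct_sum_def rectangle_module_def)
  qed (rule in_N)
  have bij: "bij_betw (f t) (fiber M t) (fiber ?N t)" for t
  proof (rule bij_betw_imageI)
    show "inj_on (f t) (fiber M t)"
    proof (rule inj_onI)
      fix v w assume v: "v \<in> fiber M t" and w: "w \<in> fiber M t" and fvw: "f t v = f t w"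
      have eq: "\<phi> i t v = \<phi> i t w" if "i \<in> I" for i using that fun_cong[OF fvw, of i] by (simp add: f_def)
      then have "{i. i \<in> I \<and> \<phi> i t v \<noteq> 0} = {i. i \<in> I \<and> \<phi> i t w \<noteq> 0}" by auto
      then have "(\<Sum>i | i \<in> I \<and> \<phi> i t v \<noteq> 0. smult M (\<phi> i t v) (z i t)) = (\<Sum>i | i \<in> I \<and> \<phi> i t w \<noteq> 0. smult M (\<phi> i t w) (z i t))"
        using eq by (intro sum.cong) auto
      then show "v = w" using coordinatesD(6)[OF co v] coordinatesD(6)[OF co w] by simp
    qed
    show "f t ` fiber M t = fiber ?N t"
    proof (intro antisym subsetI)
      fix x assume "x \<in> f t ` fiber M t"
      then show "x \<in> fiber ?N t" using in_N by (elim imageE) simp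
    next
      fix x assume x: "x \<in> fiber ?N t"
      let ?A = "{i. x i \<noteq> 0}"
      have A: "finite ?A" "\<And>i. i \<in> ?A \<Longrightarrow> i \<in> I \<and> t \<in> C i" using x unfolding fiber by auto
      define v where "v = (\<Sum>j\<in>?A. smult M (x j) (z j t))"
      have v: "v \<in> fiber M t" unfolding v_def using A zV by (intro subspace_sum subspace_V scale_in) auto
      have "f t v i = x i" for i
      proof (cases "i \<in> I")
        case True
        have "\<phi> i t v = (\<Sum>j\<in>?A. x j * \<phi> i t (z j t))"
          unfolding v_def using zV A by (intro linear_form_sum[OF lin[OF True]]) auto
        also have "\<dots> = (\<Sum>j\<in>?A. if j = i then x i else 0)"
        proof (rule sum.cong)
          fix j assume "j \<in> ?A"
          then have "j \<in> I" "t \<in> C j" using A(2) by auto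
          then show "x j * \<phi> i t (z j t) = (if j = i then x i else 0)"
            using coordinatesD(4)[OF co True, of j t] by auto
        qed simp
        also have "\<dots> = x i" using A(1) by simp
        finally show ?thesis using True by (simp add: f_def)
      next
        case False
        then show ?thesis using A(2)[of i] by (auto simp: f_def)
      qed
      then have "f t v = x" by (rule ext)
      then show "x \<in> f t ` fiber M t" using v by (intro image_eqI[of _ _ v]) simp_all
    qed
  qed
  have natural: "f t (tmap M s t v) = tmap ?N s t (f s v)" if st: "s \<le> t" and v: "v \<in> fiber M s" for s t v
  proof (rule ext)
    fix i
    show "f t (tmap M s t v) i = tmap ?N s t (f s v) i"
    proof (cases "i \<in> I \<and> t \<in> C i")
      case True
      then show ?thesis using coordinates_map[OF co st _ _ v, of i] off[of i s v] v
        by (simp add: f_def direct_sum_def rectangle_module_def)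
    next
      case False
      then show ?thesis using off[of i t "tmap M s t v"] map_in[OF st v]
        by (auto simp: f_def direct_sum_def rectangle_module_def)
    qed
  qed
  show ?thesis
    unfolding bimodule_isomorphic_def using linear bij natural by (intro exI[of _ f]) simp
qed

lemma coordinates_of_isomorphic:
  assumes "M \<simeq>\<^sub>b direct_sum I (\<lambda>i. rectangle_module (C i))"
  shows "\<exists>\<phi> z. coordinates I C \<phi> z"
proof -
  let ?N = "direct_sum I (\<lambda>i. rectangle_module (C i)) :: ('k, 'a \<Rightarrow> 'k) bimodule"
  obtain f where f: "\<forall>t. linear_between (smult M) (smult ?N) (fiber M t) (fiber ?N t) (f t) \<and> bij_betw (f t) (fiber M t) (fiber ?N t)"
    "\<forall>s t. s \<le> t \<longrightarrow> (\<forall>x\<in>fiber M s. f t (tmap M s t x) = tmap ?N s t (f s x))"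
    using assms unfolding bimodule_isomorphic_def by (elim exE conjE)
  have bij: "bij_betw (f t) (fiber M t) (fiber ?N t)" for t using f(1) by simp
  have inj: "v = w" if "f t v = f t w" "v \<in> fiber M t" "w \<in> fiber M t" for t v w
    using inj_onD[OF bij_betw_imp_inj_on[OF bij] that] .
  have add: "f t (x + y) = f t x + f t y" if "x \<in> fiber M t" "y \<in> fiber M t" for t x y
    using f(1) that unfolding linear_between_def by blast
  have scale: "f t (smult M c x) = (\<lambda>i. c * f t x i)" if "x \<in> fiber M t" for t c x
  proof -
    have "f t (smult M c x) = smult ?N c (f t x)" using f(1) that unfolding linear_between_def by blast
    then show ?thesis by (simp add: direct_sum_def rectangle_module_def)
  qed
  have nat: "f t (tmap M s t v) i = (if i \<in> I \<and> s \<in> C i \<and> t \<in> C i then f s v i else 0)"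
    if "s \<le> t" "v \<in> fiber M s" for s t v i
    using f(2) that by (simp add: direct_sum_def rectangle_module_def)
  have fiber: "x \<in> fiber ?N t \<longleftrightarrow> finite {i. x i \<noteq> 0} \<and> (\<forall>i. x i \<noteq> 0 \<longrightarrow> i \<in> I \<and> t \<in> C i)" for x t
    unfolding direct_sum_def rectangle_module_def by (auto split: if_splits)
  have fN: "finite {i. f t v i \<noteq> 0}" "\<And>i. f t v i \<noteq> 0 \<Longrightarrow> i \<in> I \<and> t \<in> C i" if "v \<in> fiber M t" for t v
    using bij_betwE[OF bij[of t]] that unfolding fiber by auto
  have lin: "linear_form t (\<lambda>v. f t v i)" for t i
    unfolding linear_form_def using add scale by simp
  have f0: "f t 0 i = 0" for t i using linear_form_sum[OF lin[of t i], of "{}"] by simp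
  define e where "e i = (\<lambda>j::'a. if j = i then 1 else 0 :: 'k)" for i
  \<comment> \<open>The section is the preimage of the unit vector \<open>e i\<close>. Outside
    \<open>C i\<close> that vector does not belong to the fibre, so the value is set to 0
    there.\<close>
  define z where "z i t = (if t \<in> C i then inv_into (fiber M t) (f t) (e i) else 0)" for i t
  have z: "z i t \<in> fiber M t" "f t (z i t) = e i" if "i \<in> I" "t \<in> C i" for i t
  proof -
    have "e i \<in> fiber ?N t" unfolding fiber e_def using that by simp
    then have "e i \<in> f t ` fiber M t" using bij_betw_imp_surj_on[OF bij] by simp
    then show "z i t \<in> fiber M t" "f t (z i t) = e i"
      using inv_into_into[of "e i" "f t"] f_inv_into_f[of "e i" "f t"] that unfolding z_def by simp_all
  qed
  have zV: "z i t \<in> fiber M t" if "i \<in> I" for i t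
    using z[OF that] zero_in by (cases "t \<in> C i") (simp_all add: z_def)
  have sec: "block_section (C i) (z i)" if i: "i \<in> I" for i
    unfolding block_section_def
  proof (intro conjI allI impI)
    show "z i t \<in> fiber M t" for t by (rule zV[OF i])
    show "z i t \<noteq> 0 \<longleftrightarrow> t \<in> C i" for t
    proof (cases "t \<in> C i")
      case True
      have "f t (z i t) i \<noteq> f t 0 i" unfolding z(2)[OF i True] f0 by (simp add: e_def)
      then show ?thesis using True by auto
    qed (simp add: z_def)
    show "tmap M s t (z i s) = z i t" if st: "s \<le> t" and s: "s \<in> C i" for s t
    proof (rule inj)
      show "f t (tmap M s t (z i s)) = f t (z i t)"
      proof (rule ext)
        fix j
        show "f t (tmap M s t (z i s)) j = f t (z i t) j"
          unfolding nat[OF st zV[OF i]] z(2)[OF i s]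
          using z(2)[OF i, of t] f0[of t j] i s by (cases "t \<in> C i") (auto simp: e_def z_def)
      qed
      show "tmap M s t (z i s) \<in> fiber M t" by (rule map_in[OF st zV[OF i]])
    qed (rule zV[OF i])
  qed
  have "coordinates I C (\<lambda>i t v. f t v i) z"
    unfolding coordinates_def
  proof (intro conjI ballI allI impI)
    show "f t v i = 0" if "t \<notin> C i" "v \<in> fiber M t" for i t v using fN(2)[OF that(2)] that(1) by blast
    show "f t (z j t) i = (if i = j then 1 else 0)" if "j \<in> I" "t \<in> C j" for i j t
      using z(2)[OF that] by (simp add: e_def)
    fix t v assume v: "v \<in> fiber M t"
    have A: "{i \<in> I. f t v i \<noteq> 0} = {i. f t v i \<noteq> 0}" using fN(2)[OF v] by auto
    then show fin: "finite {i \<in> I. f t v i \<noteq> 0}" using fN(1)[OF v] by simp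
    let ?A = "{i \<in> I. f t v i \<noteq> 0}"
    let ?w = "\<Sum>i\<in>?A. smult M (f t v i) (z i t)"
    show "v = ?w"
    proof (rule inj)
      show "?w \<in> fiber M t" using zV by (intro subspace_sum subspace_V scale_in) simp
      show "f t v = f t ?w"
      proof (rule ext)
        fix j
        have "f t ?w j = (\<Sum>i\<in>?A. f t v i * f t (z i t) j)"
          using zV by (intro linear_form_sum[OF lin]) simp
        also have "\<dots> = (\<Sum>i\<in>?A. if i = j then f t v j else 0)"
        proof (rule sum.cong)
          fix i assume "i \<in> ?A"
          then have "i \<in> I" "t \<in> C i" using fN(2)[OF v, of i] by auto
          then show "f t v i * f t (z i t) j = (if i = j then f t v j else 0)" using z(2)[of i t] by (simp add: e_def)
        qed simp
        also have "\<dots> = f t v j" using fin fN(2)[OF v, of j] by auto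
        finally show "f t v j = f t ?w j" by simp
      qed
    qed (rule v)
  qed (use lin sec in simp_all)
  then show ?thesis by (intro exI)
qed

end

section \<open>The decomposition theorem for bimodules\<close>

lemma exact_module_of_bimodule:
  assumes "persistence_bimodule M" "pfd M" "exact_bimodule M"
  shows "exact_module (smult M) (fiber M) (tmap M)"
proof -
  have P: "vector_space (smult M)" "\<And>t. module.subspace (smult M) (fiber M t)"
    "\<And>s t. s \<le> t \<Longrightarrow> linear_between (smult M) (smult M) (fiber M s) (fiber M t) (tmap M s t)"
    "\<And>t x. x \<in> fiber M t \<Longrightarrow> tmap M t t x = x"
    "\<And>s t u x. s \<le> t \<Longrightarrow> t \<le> u \<Longrightarrow> x \<in> fiber M s \<Longrightarrow> tmap M t u (tmap M s t x) = tmap M s u x"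
    using assms(1) unfolding persistence_bimodule_def by simp_all
  interpret vector_space "smult M" by (rule P(1))
  interpret persistence_module "smult M" "fiber M" "tmap M"
    using P(2-5) by unfold_locales (simp_all add: linear_between_def)
  show ?thesis
  proof unfold_locales
    show "\<exists>S. finite S \<and> fiber M t = span S" for t using assms(2) unfolding pfd_def by metis
    fix x x' y y' a b
    assume le: "x \<le> x'" "y \<le> y'" and a: "a \<in> fiber M (x', y)" and b: "b \<in> fiber M (x, y')"
      and eq: "tmap M (x', y) (x', y') a = tmap M (x, y') (x', y') b"
    have "(\<lambda>c. (tmap M (x, y) (x', y) c, tmap M (x, y) (x, y') c)) ` fiber M (x, y) =
      {p \<in> fiber M (x', y) \<times> fiber M (x, y'). (\<lambda>(a, b). tmap M (x', y) (x', y') a - tmap M (x, y') (x', y') b) p = 0}"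
      using assms(3) le unfolding exact_bimodule_def Let_def by (elim allE[of _ "(x, y)"] allE[of _ "(x', y')"]) simp
    moreover have "(a, b) \<in> {p \<in> fiber M (x', y) \<times> fiber M (x, y'). (\<lambda>(a, b). tmap M (x', y) (x', y') a - tmap M (x, y') (x', y') b) p = 0}"
      using a b eq by simp
    ultimately have "(a, b) \<in> (\<lambda>c. (tmap M (x, y) (x', y) c, tmap M (x, y) (x, y') c)) ` fiber M (x, y)" by (simp only:)
    then show "\<exists>c\<in>fiber M (x, y). tmap M (x, y) (x', y) c = a \<and> tmap M (x, y) (x, y') c = b" by auto
  qed
qed

theorem theorem2p1:
  fixes M :: "('k::field, 'v::ab_group_add) bimodule"
  assumes "persistence_bimodule M" and "pfd M" and "exact_bimodule M"
  shows "\<exists>m :: (real \<times> real) set \<Rightarrow> nat.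
    (\<forall>B. m B > 0 \<longrightarrow> block B) \<and>
    M \<simeq>\<^sub>b direct_sum (copies m) (\<lambda>(B, n). rectangle_module B) \<and>
    (\<forall>(I :: 'i set) C.
       (\<forall>i\<in>I. block (C i)) \<and> M \<simeq>\<^sub>b direct_sum I (\<lambda>i. rectangle_module (C i)) \<longrightarrow>
       (\<exists>\<pi>. bij_betw \<pi> I (copies m) \<and> (\<forall>i\<in>I. fst (\<pi> i) = C i)))"
proof -
  interpret exact_module "smult M" "fiber M" "tmap M"
    using assms by (rule exact_module_of_bimodule)
  note pm = persistence_module_axioms
  obtain F where F: "partial_decomposition F (\<lambda>_. {0})" using exists_decomposition by blast
  define C where "C z = {t. z t \<noteq> 0}" for z :: "real \<times> real \<Rightarrow> 'v"
  have blockF: "block (C z)" if z: "z \<in> F" for z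
  proof -
    obtain B where B: "block B" "block_section B z" using partial_decompositionD(2)[OF F z] by blast
    then have "C z = B" using block_sectionD(2)[OF B(2)] unfolding C_def by blast
    then show ?thesis using B(1) by simp
  qed
  have coF: "\<exists>\<phi>. coordinates F C \<phi> (\<lambda>z. z)"
  proof -
    have "bij_betw (\<lambda>z. z) F F" by (simp add: bij_betw_def)
    moreover have "C = (\<lambda>z. {t. z t \<noteq> 0})" by (simp add: C_def fun_eq_iff)
    ultimately show ?thesis using coordinates_of_decomposition[OF F, of "\<lambda>z. z" F] by auto
  qed
  define m where "m B = card {z \<in> F. C z = B}" for B
  \<comment> \<open>Stated for any index type, since it is applied both to the sections themselves
    and to the index set of another decomposition. The empty set has its own case because every
    other \<open>B\<close> offers a point at which to evaluate.\<close>
  have finite_copies: "finite {i \<in> I. D i = B}"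
    if "coordinates I D \<psi> w" "\<And>i. i \<in> I \<Longrightarrow> block (D i)" for I :: "'j set" and D \<psi> w B
  proof (cases "B = {}")
    case True
    have "{i \<in> I. D i = B} = {}" using that(2) block_nonempty True by blast
    then show ?thesis by (metis finite.emptyI)
  next
    case False
    then obtain s where "s \<in> B" by blast
    then show ?thesis by (rule coordinates_finite[OF that(1)])
  qed
  have card_copies: "card {i \<in> I. D i = B} = m B"
    if co: "coordinates I D \<psi> w" "\<And>i. i \<in> I \<Longrightarrow> block (D i)" for I :: "'j set" and D \<psi> w B
  proof (cases "B = {}")
    case True
    have "{i \<in> I. D i = B} = {}" "{z \<in> F. C z = B} = {}" using co(2) blockF block_nonempty True by blast+
    then show ?thesis unfolding m_def by (metis card.empty)
  next
    case False
    then obtain s where s: "s \<in> B" by blast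
    obtain \<phi> where \<phi>: "coordinates F C \<phi> (\<lambda>z. z)" using coF by blast
    show ?thesis unfolding m_def
      using coordinates_card_le[OF co \<phi> blockF s] coordinates_card_le[OF \<phi> blockF co s] by (rule antisym)
  qed
  show ?thesis
  proof (intro exI[of _ m] conjI allI impI)
    show "block B" if "m B > 0" for B
    proof -
      have "{z \<in> F. C z = B} \<noteq> {}" using that unfolding m_def by (metis card.empty less_irrefl)
      then show ?thesis using blockF by blast
    qed
    obtain \<phi> where \<phi>: "coordinates F C \<phi> (\<lambda>z. z)" using coF by blast
    have "\<exists>\<pi>. bij_betw \<pi> F (copies m) \<and> (\<forall>z\<in>F. fst (\<pi> z) = C z)"
      by (rule bij_betw_copies[OF finite_copies[OF \<phi> blockF] m_def[symmetric]])
    then obtain \<pi> where \<pi>: "bij_betw \<pi> F (copies m)" "\<And>z. z \<in> F \<Longrightarrow> fst (\<pi> z) = C z" by auto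
    \<comment> \<open>The sections are renamed by pairs of a block and a number, so that the index
      set of the decomposition becomes \<open>copies m\<close>.\<close>
    define h where "h = inv_into F \<pi>"
    have h: "bij_betw h (copies m) F" unfolding h_def using \<pi>(1) by (rule bij_betw_inv_into)
    have hC: "{t. h p t \<noteq> 0} = fst p" if "p \<in> copies m" for p
    proof -
      have "\<pi> (h p) = p" unfolding h_def using \<pi>(1) that by (rule bij_betw_inv_into_right)
      moreover have "h p \<in> F" using bspec[OF bij_betwE[OF h] that] .
      ultimately show ?thesis using \<pi>(2)[of "h p"] by (simp add: C_def)
    qed
    have "coordinates (copies m) fst (\<lambda>p t v. representation (values_at F t) v (h p t)) h"
      by (rule coordinates_cong[OF coordinates_of_decomposition[OF F h] hC])
    then have "M \<simeq>\<^sub>b direct_sum (copies m) (\<lambda>p. rectangle_module (fst p))"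
      by (rule isomorphic_of_coordinates[OF pm])
    then show "M \<simeq>\<^sub>b direct_sum (copies m) (\<lambda>(B, n). rectangle_module B)" by (simp add: case_prod_unfold)
    fix I :: "'i set" and D
    assume D: "(\<forall>i\<in>I. block (D i)) \<and> M \<simeq>\<^sub>b direct_sum I (\<lambda>i. rectangle_module (D i))"
    then obtain \<psi> w where co: "coordinates I D \<psi> w" using coordinates_of_isomorphic[OF pm] by blast
    show "\<exists>\<pi>. bij_betw \<pi> I (copies m) \<and> (\<forall>i\<in>I. fst (\<pi> i) = D i)"
    proof (rule bij_betw_copies)
      have bl: "block (D i)" if "i \<in> I" for i using D that by simp
      show "finite {i \<in> I. D i = B}" "card {i \<in> I. D i = B} = m B" for B
        by (rule finite_copies[OF co bl], assumption) (rule card_copies[OF co bl], assumption)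
    qed
  qed
qed

end
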